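(* Let $\mathcal A$ be a Banach ring, let $b$ be a point of $B=\mathcal M(\mathcal A)$ and let $G(T)$ be a nonconstant monic polynomial with coefficients in $\mathcal O_{B,b}$. Then $b$ satisfies condition $(D_G)$; that is, if $G(b)(T)=\prod_{i=1}^r h_i(T)^{n_i}$ is the decomposition of $G(b)(T)$ in $\mathcal H(b)[T]$ into powers of pairwise distinct monic irreducible polynomials, then there exist monic polynomials $H_1,\dots,H_r$ with coefficients in $\mathcal O_{B,b}$ such that (i) $G=\prod_{i=1}^r H_i$ in $\mathcal O_{B,b}[T]$; (ii) for every $i\in\{1,\dots,r\}$, $H_i(b)=h_i^{n_i}$ in $\mathcal H(b)[T]$.
   Context: A Banach ring is a commutative unital ring complete for a submultiplicative norm $\|\cdot\|$. $\mathcal M(\mathcal A)$ is the set of multiplicative seminorms on $\mathcal A$ bounded by $\|\cdot\|$, with the coarsest topology making all maps $|\cdot|_x\mapsto|f|_x$ ($f\in\mathcal A$) continuous. For a point $x$, $\mathcal H(x)$ is the completion of $\mathrm{Frac}(\mathcal A/\ker|\cdot|_x)$. Sections of the structure sheaf $\mathcal O_B$ on an open $U$ are maps $f:U\to\bigsqcup_{x\in U}\mathcal H(x)$ with $f(x)\in\mathcal H(x)$ that are locally uniform limits of elements of the total ring of fractions of $\mathcal A$ without poles (with denominators not vanishing on the set considered). For a polynomial $H$ over $\mathcal O_{B,b}$, $H(b)\in\mathcal H(b)[T]$ is obtained by evaluating its coefficients at $b$.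
   Formalization: Sections of the structure sheaf are taken as locally uniform limits of fractions a/s with s nowhere vanishing on the set, where s may be a zero divisor of A; with denominators restricted to non-zero-divisors (the total ring of fractions read literally) the claim is false. *)

theory Defs
  imports "HOL-Analysis.Abstract_Topology" "HOL-Algebra.Polynomial_Divisibility"
begin

section \<open>Banach rings and their spectrum\<close>

locale banach_ring = cring A for A (structure) +
  fixes nrm :: "'a \<Rightarrow> real"
  assumes nrm_nonneg: "f \<in> carrier A \<Longrightarrow> 0 \<le> nrm f"
    and nrm_eq_0_iff: "f \<in> carrier A \<Longrightarrow> nrm f = 0 \<longleftrightarrow> f = \<zero>"
    and nrm_minus: "f \<in> carrier A \<Longrightarrow> nrm (\<ominus> f) = nrm f"
    and nrm_triangle: "f \<in> carrier A \<Longrightarrow> g \<in> carrier A \<Longrightarrow> nrm (f \<oplus> g) \<le> nrm f + nrm g"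
    and nrm_submult: "f \<in> carrier A \<Longrightarrow> g \<in> carrier A \<Longrightarrow> nrm (f \<otimes> g) \<le> nrm f * nrm g"
    and complete: "(\<And>i. \<sigma> i \<in> carrier A) \<Longrightarrow>
        (\<And>\<epsilon>. \<epsilon> > 0 \<Longrightarrow> \<exists>N::nat. \<forall>i\<ge>N. \<forall>j\<ge>N. nrm (\<sigma> i \<ominus> \<sigma> j) < \<epsilon>) \<Longrightarrow>
        \<exists>l\<in>carrier A. (\<lambda>i. nrm (\<sigma> i \<ominus> l)) \<longlonglongrightarrow> 0"

text \<open>A point is a function on the whole type, made \<^const>\<open>extensional\<close> so that it is
  determined by its restriction to the carrier.\<close>

definition spectrum :: "('a, 'm) ring_scheme \<Rightarrow> ('a \<Rightarrow> real) \<Rightarrow> ('a \<Rightarrow> real) set" where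
  "spectrum A nrm = {x \<in> extensional (carrier A).
     x \<zero>\<^bsub>A\<^esub> = 0 \<and> x \<one>\<^bsub>A\<^esub> = 1 \<and>
     (\<forall>f\<in>carrier A. 0 \<le> x f \<and> x f \<le> nrm f) \<and>
     (\<forall>f\<in>carrier A. \<forall>g\<in>carrier A.
        x (f \<oplus>\<^bsub>A\<^esub> g) \<le> x f + x g \<and> x (f \<otimes>\<^bsub>A\<^esub> g) = x f * x g)}"

definition spectrum_topology ::
    "('a, 'm) ring_scheme \<Rightarrow> ('a \<Rightarrow> real) \<Rightarrow> ('a \<Rightarrow> real) topology" where
  "spectrum_topology A nrm =
     topology_generated_by {{x \<in> spectrum A nrm. x f \<in> T} | f T. f \<in> carrier A \<and> open T}"


section \<open>The completed residue field of a point\<close>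

definition seminorm_ker :: "('a, 'm) ring_scheme \<Rightarrow> ('a \<Rightarrow> real) \<Rightarrow> 'a set" where
  "seminorm_ker A x = {f \<in> carrier A. x f = 0}"

text \<open>Fraction field of a domain \<open>D\<close>: the class of \<open>(a, s)\<close> is the set of all pairs
  \<open>(a', s')\<close> with \<open>a s' = a' s\<close>. In the operations, all members of the union coincide.\<close>

definition frac_class :: "('c, 'm) ring_scheme \<Rightarrow> 'c \<Rightarrow> 'c \<Rightarrow> ('c \<times> 'c) set" where
  "frac_class D a s = {(a', s'). a' \<in> carrier D \<and> s' \<in> carrier D - {\<zero>\<^bsub>D\<^esub>} \<and>
                           a \<otimes>\<^bsub>D\<^esub> s' = a' \<otimes>\<^bsub>D\<^esub> s}"

definition frac_field :: "('c, 'm) ring_scheme \<Rightarrow> ('c \<times> 'c) set ring" where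
  "frac_field D =
     \<lparr> carrier = {frac_class D a s | a s. a \<in> carrier D \<and> s \<in> carrier D - {\<zero>\<^bsub>D\<^esub>}},
       mult = (\<lambda>P Q. \<Union>(a, s)\<in>P. \<Union>(c, t)\<in>Q. frac_class D (a \<otimes>\<^bsub>D\<^esub> c) (s \<otimes>\<^bsub>D\<^esub> t)),
       one = frac_class D \<one>\<^bsub>D\<^esub> \<one>\<^bsub>D\<^esub>,
       zero = frac_class D \<zero>\<^bsub>D\<^esub> \<one>\<^bsub>D\<^esub>,
       add = (\<lambda>P Q. \<Union>(a, s)\<in>P. \<Union>(c, t)\<in>Q.
                frac_class D (a \<otimes>\<^bsub>D\<^esub> t \<oplus>\<^bsub>D\<^esub> c \<otimes>\<^bsub>D\<^esub> s) (s \<otimes>\<^bsub>D\<^esub> t)) \<rparr>"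

text \<open>Completion of a ring \<open>K\<close> for \<open>v\<close>: Cauchy sequences modulo null sequences.\<close>

definition cauchy_ring :: "('k, 'm) ring_scheme \<Rightarrow> ('k \<Rightarrow> real) \<Rightarrow> (nat \<Rightarrow> 'k) ring" where
  "cauchy_ring K v =
     \<lparr> carrier = {\<sigma>. (\<forall>i. \<sigma> i \<in> carrier K) \<and>
                    (\<forall>\<epsilon>>0. \<exists>N. \<forall>i\<ge>N. \<forall>j\<ge>N. v (\<sigma> i \<ominus>\<^bsub>K\<^esub> \<sigma> j) < \<epsilon>)},
       mult = (\<lambda>\<sigma> \<tau> i. \<sigma> i \<otimes>\<^bsub>K\<^esub> \<tau> i),
       one = (\<lambda>i. \<one>\<^bsub>K\<^esub>),
       zero = (\<lambda>i. \<zero>\<^bsub>K\<^esub>),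
       add = (\<lambda>\<sigma> \<tau> i. \<sigma> i \<oplus>\<^bsub>K\<^esub> \<tau> i) \<rparr>"

definition null_seqs :: "('k, 'm) ring_scheme \<Rightarrow> ('k \<Rightarrow> real) \<Rightarrow> (nat \<Rightarrow> 'k) set" where
  "null_seqs K v = {\<sigma>. (\<forall>i. \<sigma> i \<in> carrier K) \<and> (\<lambda>i. v (\<sigma> i)) \<longlonglongrightarrow> 0}"

definition completion :: "('k, 'm) ring_scheme \<Rightarrow> ('k \<Rightarrow> real) \<Rightarrow> (nat \<Rightarrow> 'k) set ring" where
  "completion K v = cauchy_ring K v Quot null_seqs K v"

definition completion_abs :: "('k \<Rightarrow> real) \<Rightarrow> (nat \<Rightarrow> 'k) set \<Rightarrow> real" where
  "completion_abs v C = the_elem ((\<lambda>\<sigma>. lim (\<lambda>i. v (\<sigma> i))) ` C)"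

definition completion_of :: "('k, 'm) ring_scheme \<Rightarrow> ('k \<Rightarrow> real) \<Rightarrow> 'k \<Rightarrow> (nat \<Rightarrow> 'k) set" where
  "completion_of K v c = null_seqs K v +>\<^bsub>cauchy_ring K v\<^esub> (\<lambda>i. c)"

definition residue_dom :: "('a, 'm) ring_scheme \<Rightarrow> ('a \<Rightarrow> real) \<Rightarrow> 'a set ring" where
  "residue_dom A x = A Quot seminorm_ker A x"

text \<open>The absolute value induced by \<open>x\<close> on \<open>Frac(A / ker x)\<close>; the images under
  \<^const>\<open>the_elem\<close> are singletons because \<open>x\<close> is constant on cosets of its kernel and
  multiplicative.\<close>

definition residue_frac_abs :: "('a \<Rightarrow> real) \<Rightarrow> ('a set \<times> 'a set) set \<Rightarrow> real" where
  "residue_frac_abs x P = the_elem ((\<lambda>(a, s). the_elem (x ` a) / the_elem (x ` s)) ` P)"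

type_synonym 'a residue = "(nat \<Rightarrow> ('a set \<times> 'a set) set) set"

definition residue_field :: "('a, 'm) ring_scheme \<Rightarrow> ('a \<Rightarrow> real) \<Rightarrow> 'a residue ring"
    (\<open>\<H>\<close>) where
  "\<H> A x = completion (frac_field (residue_dom A x)) (residue_frac_abs x)"

definition residue_abs :: "('a \<Rightarrow> real) \<Rightarrow> 'a residue \<Rightarrow> real" where
  "residue_abs x = completion_abs (residue_frac_abs x)"

text \<open>The value \<open>a(x) / s(x)\<close> in \<open>\<H> A x\<close>, for \<open>a, s\<close> in \<open>A\<close> with \<open>s(x) \<noteq> 0\<close>.\<close>

definition fraction_value ::
    "('a, 'm) ring_scheme \<Rightarrow> ('a \<Rightarrow> real) \<Rightarrow> 'a \<Rightarrow> 'a \<Rightarrow> 'a residue" where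
  "fraction_value A x a s =
     completion_of (frac_field (residue_dom A x)) (residue_frac_abs x)
       (frac_class (residue_dom A x) (seminorm_ker A x +>\<^bsub>A\<^esub> a) (seminorm_ker A x +>\<^bsub>A\<^esub> s))"


section \<open>The structure sheaf and its stalks\<close>

text \<open>The fractions without poles on \<open>V\<close> are the \<open>a / s\<close> with \<open>s\<close> nowhere vanishing on
  \<open>V\<close>, i.e. the elements of the localisation of \<open>A\<close> at these \<open>s\<close>. Such an \<open>s\<close> is deliberately
  not required to be a non-zero-divisor of \<open>A\<close>: under that restriction a germ that does not
  vanish at \<open>b\<close> need not be invertible, so stalks would fail to be local rings.\<close>

definition sections ::
    "('a, 'm) ring_scheme \<Rightarrow> ('a \<Rightarrow> real) \<Rightarrow> ('a \<Rightarrow> real) set \<Rightarrow> (('a \<Rightarrow> real) \<Rightarrow> 'a residue) set" where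
  "sections A nrm U = {f \<in> \<Pi>\<^sub>E y\<in>U. carrier (\<H> A y).
     \<forall>x\<in>U. \<exists>V. openin (spectrum_topology A nrm) V \<and> x \<in> V \<and> V \<subseteq> U \<and>
       (\<forall>\<epsilon>>0. \<exists>a\<in>carrier A. \<exists>s\<in>carrier A.
          (\<forall>y\<in>V. y s \<noteq> 0) \<and>
          (\<forall>y\<in>V. residue_abs y (f y \<ominus>\<^bsub>\<H> A y\<^esub> fraction_value A y a s) < \<epsilon>))}"

type_synonym 'a germ = "(('a \<Rightarrow> real) set \<times> (('a \<Rightarrow> real) \<Rightarrow> 'a residue)) set"

text \<open>Pairs of an open neighbourhood of \<open>b\<close> and a section on it; a germ is an equivalence class
  of such pairs.\<close>

definition sections_near ::
    "('a, 'm) ring_scheme \<Rightarrow> ('a \<Rightarrow> real) \<Rightarrow> ('a \<Rightarrow> real) \<Rightarrow>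
     (('a \<Rightarrow> real) set \<times> (('a \<Rightarrow> real) \<Rightarrow> 'a residue)) set" where
  "sections_near A nrm b =
     {(U, f). openin (spectrum_topology A nrm) U \<and> b \<in> U \<and> f \<in> sections A nrm U}"

definition germ ::
    "('a, 'm) ring_scheme \<Rightarrow> ('a \<Rightarrow> real) \<Rightarrow> ('a \<Rightarrow> real) \<Rightarrow>
     ('a \<Rightarrow> real) set \<Rightarrow> (('a \<Rightarrow> real) \<Rightarrow> 'a residue) \<Rightarrow>
     (('a \<Rightarrow> real) set \<times> (('a \<Rightarrow> real) \<Rightarrow> 'a residue)) set" where
  "germ A nrm b U f = {(V, g) \<in> sections_near A nrm b.
     \<exists>W. openin (spectrum_topology A nrm) W \<and> b \<in> W \<and> W \<subseteq> U \<inter> V \<and> (\<forall>y\<in>W. f y = g y)}"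

definition stalk ::
    "('a, 'm) ring_scheme \<Rightarrow> ('a \<Rightarrow> real) \<Rightarrow> ('a \<Rightarrow> real) \<Rightarrow> 'a germ ring" (\<open>\<O>\<close>) where
  "\<O> A nrm b =
     \<lparr> carrier = {germ A nrm b U f | U f. (U, f) \<in> sections_near A nrm b},
       mult = (\<lambda>\<phi> \<psi>. \<Union>(U, f)\<in>\<phi>. \<Union>(V, g)\<in>\<psi>.
         germ A nrm b (U \<inter> V) (\<lambda>y\<in>U \<inter> V. f y \<otimes>\<^bsub>\<H> A y\<^esub> g y)),
       one = germ A nrm b (spectrum A nrm) (\<lambda>y\<in>spectrum A nrm. \<one>\<^bsub>\<H> A y\<^esub>),
       zero = germ A nrm b (spectrum A nrm) (\<lambda>y\<in>spectrum A nrm. \<zero>\<^bsub>\<H> A y\<^esub>),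
       add = (\<lambda>\<phi> \<psi>. \<Union>(U, f)\<in>\<phi>. \<Union>(V, g)\<in>\<psi>.
         germ A nrm b (U \<inter> V) (\<lambda>y\<in>U \<inter> V. f y \<oplus>\<^bsub>\<H> A y\<^esub> g y)) \<rparr>"

definition germ_value :: "('a \<Rightarrow> real) \<Rightarrow> 'a germ \<Rightarrow> 'a residue" where
  "germ_value b \<phi> = the_elem ((\<lambda>(U, f). f b) ` \<phi>)"


section \<open>Polynomials and the condition \<open>D\<^sub>G\<close>\<close>

definition monic_polys :: "('c, 'm) ring_scheme \<Rightarrow> 'c list set" where
  "monic_polys R = {p \<in> carrier (poly_ring R). p \<noteq> [] \<and> lead_coeff p = \<one>\<^bsub>R\<^esub>}"

text \<open>\<open>H(b)\<close>. Library polynomials are coefficient lists without leading zeros, hence the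
  normalisation.\<close>

definition poly_at ::
    "('a, 'm) ring_scheme \<Rightarrow> ('a \<Rightarrow> real) \<Rightarrow> 'a germ list \<Rightarrow> 'a residue list" where
  "poly_at A b H = ring.normalize (\<H> A b) (map (germ_value b) H)"

text \<open>\<open>p\<close> is the product of the powers \<open>h i ^ n i\<close>, \<open>1 \<le> i \<le> r\<close>, of pairwise distinct monic
  irreducible polynomials.\<close>

definition irreducible_decomposition ::
    "('c, 'm) ring_scheme \<Rightarrow> 'c list \<Rightarrow> nat \<Rightarrow> (nat \<Rightarrow> 'c list) \<Rightarrow> (nat \<Rightarrow> nat) \<Rightarrow> bool" where
  "irreducible_decomposition K p r h n \<longleftrightarrow>
     (\<forall>i\<in>{1..r}. h i \<in> monic_polys K \<and> pirreducible\<^bsub>K\<^esub> (carrier K) (h i) \<and> 1 \<le> n i) \<and>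
     inj_on h {1..r} \<and>
     p = (\<Otimes>\<^bsub>poly_ring K\<^esub> i\<in>{1..r}. h i [^]\<^bsub>poly_ring K\<^esub> n i)"

definition condition_D ::
    "('a, 'm) ring_scheme \<Rightarrow> ('a \<Rightarrow> real) \<Rightarrow> ('a \<Rightarrow> real) \<Rightarrow> 'a germ list \<Rightarrow> bool" where
  "condition_D A nrm b G \<longleftrightarrow>
     (\<forall>r h n. irreducible_decomposition (\<H> A b) (poly_at A b G) r h n \<longrightarrow>
        (\<exists>H. (\<forall>i\<in>{1..r}. H i \<in> monic_polys (\<O> A nrm b)) \<and>
             G = (\<Otimes>\<^bsub>poly_ring (\<O> A nrm b)\<^esub> i\<in>{1..r}. H i) \<and>
             (\<forall>i\<in>{1..r}. poly_at A b (H i) = h i [^]\<^bsub>poly_ring (\<H> A b)\<^esub> n i)))"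

end

theory Submission
  imports Defs "HOL-Algebra.UnivPoly"
begin

text \<open>
  The factors are found by Newton's method, and identified at \<open>b\<close> by a uniqueness argument.

  Let \<open>G(b) = P Q\<close> with \<open>P, Q\<close> monic and coprime over \<open>\<H>(b)\<close>. The differential at \<open>(P, Q)\<close> of the
  multiplication of monic polynomials is \<open>(u, v) \<mapsto> u Q + v P\<close>, where \<open>deg u < deg P\<close> and
  \<open>deg v < deg Q\<close>. It is invertible because \<open>P\<close> and \<open>Q\<close> are coprime, and its inverse is described by
  the Bezout relations \<open>u\<^sub>k Q + v\<^sub>k P = T\<^sup>k\<close> (\<open>bezout_basis\<close>). Values of fractions of \<open>A\<close> are dense in
  \<open>\<H>(b)\<close>, so \<open>P, Q, u\<^sub>k, v\<^sub>k\<close> are approximated by polynomials over the stalk (\<open>germ_value_dense\<close>). The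
  defects of \<open>G = P Q\<close> and of the Bezout relations are then small at \<open>b\<close>, hence on a neighbourhood \<open>W\<close>
  of \<open>b\<close> (\<open>poly_norm_near\<close>).

  The bounded functions on \<open>W\<close> that are uniform limits of fractions without poles form a Banach ring
  for the supremum norm (\<open>banach_ring_section_ring\<close>). Newton's iteration, with the inverse of the
  differential replaced by a fixed approximation, converges there (\<open>newton_iteration\<close>,
  \<open>factorization_near\<close>). It yields \<open>G = p q\<close> near \<open>b\<close>, with \<open>p(b)\<close> and \<open>q(b)\<close> close to \<open>P\<close> and \<open>Q\<close>. As
  a factorisation into coprime monic factors is isolated among the factorisations with the same
  degrees (\<open>coprime_factors_isolated\<close>), \<open>p(b) = P\<close> and \<open>q(b) = Q\<close>. This is \<open>lift_coprime_factors\<close>; powers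
  of distinct irreducible polynomials are split off by it one at a time.

  The stalk is the union of these Banach rings over the neighbourhoods of \<open>b\<close>: finitely many germs
  always come from one of them, and this is also how the stalk inherits the ring laws
  (\<open>cring_of_lifts\<close>). The estimates use polynomials as coefficient functions; reading off the
  coefficients of a list translates between these and the polynomials of the theorem.
\<close>

section \<open>Newton iteration in a normed ring\<close>

text \<open>Banach rings without completeness: polynomials over a Banach ring form such a ring, and only
  the polynomials of bounded degree are complete in it.\<close>

locale normed_cring = cring R for R (structure) +
  fixes nrm :: "'a \<Rightarrow> real"
  assumes norm_nonneg: "f \<in> carrier R \<Longrightarrow> 0 \<le> nrm f"
    and norm_eq_0_iff: "f \<in> carrier R \<Longrightarrow> nrm f = 0 \<longleftrightarrow> f = \<zero>"
    and norm_minus: "f \<in> carrier R \<Longrightarrow> nrm (\<ominus> f) = nrm f"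
    and norm_triangle: "f \<in> carrier R \<Longrightarrow> g \<in> carrier R \<Longrightarrow> nrm (f \<oplus> g) \<le> nrm f + nrm g"
    and norm_submult: "f \<in> carrier R \<Longrightarrow> g \<in> carrier R \<Longrightarrow> nrm (f \<otimes> g) \<le> nrm f * nrm g"

sublocale banach_ring \<subseteq> normed_cring A nrm
  by unfold_locales (simp_all add: nrm_nonneg nrm_eq_0_iff nrm_minus nrm_triangle nrm_submult)

context cring
begin

lemma minus_trans:
  assumes "a \<in> carrier R" "b \<in> carrier R" "c \<in> carrier R"
  shows "a \<ominus> c = (a \<ominus> b) \<oplus> (b \<ominus> c)"
  using assms by (simp add: a_minus_def a_assoc r_neg1)

lemma add_diff_cancel_left:
  assumes "a \<in> carrier R" "b \<in> carrier R"
  shows "(a \<oplus> b) \<ominus> a = b"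
  using assms by (simp add: a_minus_def a_comm[of a b] a_assoc r_neg)

lemma add_diff_add:
  assumes "a \<in> carrier R" "c \<in> carrier R" "d \<in> carrier R" "e \<in> carrier R"
  shows "(a \<oplus> c) \<ominus> (d \<oplus> e) = (a \<ominus> d) \<oplus> (c \<ominus> e)"
  using assms by (simp add: a_minus_def minus_add a_ac)

lemma add_diff_add_left:
  assumes "a \<in> carrier R" "b \<in> carrier R" "c \<in> carrier R"
  shows "(a \<oplus> b) \<ominus> (a \<oplus> c) = b \<ominus> c"
  using add_diff_add[of a b a c] assms by (simp add: a_minus_def r_neg)

lemma product_diff:
  assumes "a \<in> carrier R" "b \<in> carrier R" "c \<in> carrier R" "d \<in> carrier R"
  shows "a \<otimes> b \<ominus> c \<otimes> d = (a \<ominus> c) \<otimes> b \<oplus> c \<otimes> (b \<ominus> d)"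
proof -
  have "(a \<ominus> c) \<otimes> b = a \<otimes> b \<ominus> c \<otimes> b" "c \<otimes> (b \<ominus> d) = c \<otimes> b \<ominus> c \<otimes> d"
    using assms by (simp_all add: a_minus_def l_distr r_distr l_minus r_minus)
  then show ?thesis using minus_trans[of "a \<otimes> b" "c \<otimes> b" "c \<otimes> d"] assms by simp
qed

text \<open>Correcting the factors \<open>p + x\<close> and \<open>q + y\<close> by \<open>s\<close> and \<open>t\<close> leaves the defect of \<open>(s, t)\<close> as a
  solution of the linear equation at \<open>(p, q)\<close>, and terms of second order.\<close>

lemma newton_error_identity:
  assumes "g \<in> carrier R" "p \<in> carrier R" "q \<in> carrier R" "x \<in> carrier R" "y \<in> carrier R"
    and "s \<in> carrier R" "t \<in> carrier R"
  shows "g \<ominus> (p \<oplus> (x \<oplus> s)) \<otimes> (q \<oplus> (y \<oplus> t)) =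
    \<ominus> (((s \<otimes> q \<oplus> t \<otimes> p) \<ominus> (g \<ominus> (p \<oplus> x) \<otimes> (q \<oplus> y))) \<oplus> (s \<otimes> y \<oplus> (t \<otimes> x \<oplus> s \<otimes> t)))"
proof -
  let ?b = "(p \<oplus> x) \<otimes> (q \<oplus> y)" and ?a = "s \<otimes> q \<oplus> t \<otimes> p" and ?w = "s \<otimes> y \<oplus> (t \<otimes> x \<oplus> s \<otimes> t)"
  have rearrange: "g \<ominus> (b \<oplus> (a \<oplus> w)) = \<ominus> ((a \<ominus> (g \<ominus> b)) \<oplus> w)"
    if "a \<in> carrier R" "b \<in> carrier R" "w \<in> carrier R" for a b w
    using assms(1) that by (simp add: a_minus_def minus_add a_ac)
  have "(p \<oplus> (x \<oplus> s)) \<otimes> (q \<oplus> (y \<oplus> t)) = ?b \<oplus> (?a \<oplus> ?w)"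
    using assms by (simp add: l_distr r_distr m_ac a_ac)
  then show ?thesis using rearrange[of ?a ?b ?w] assms by simp
qed

end

context normed_cring
begin

lemma norm_zero [simp]: "nrm \<zero> = 0"
  using norm_eq_0_iff by blast

lemma norm_diff_triangle:
  "f \<in> carrier R \<Longrightarrow> g \<in> carrier R \<Longrightarrow> nrm (f \<ominus> g) \<le> nrm f + nrm g"
  using norm_triangle[of f "\<ominus> g"] norm_minus[of g] by (simp add: a_minus_def)

lemma norm_diff_commute:
  assumes "f \<in> carrier R" "g \<in> carrier R"
  shows "nrm (f \<ominus> g) = nrm (g \<ominus> f)"
proof -
  have "g \<ominus> f = \<ominus> (f \<ominus> g)" using assms by (simp add: a_minus_def minus_add a_comm)
  then show ?thesis using assms norm_minus[of "f \<ominus> g"] by simp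
qed

lemma norm_diff_trans:
  assumes "a \<in> carrier R" "b \<in> carrier R" "c \<in> carrier R"
  shows "nrm (a \<ominus> c) \<le> nrm (a \<ominus> b) + nrm (b \<ominus> c)"
  using minus_trans[OF assms] norm_triangle[of "a \<ominus> b" "b \<ominus> c"] assms by simp

lemma norm_le_diff:
  assumes "a \<in> carrier R" "b \<in> carrier R"
  shows "nrm a \<le> nrm (a \<ominus> b) + nrm b"
  using norm_diff_trans[of a b \<zero>] assms by (simp add: a_minus_def)

lemma norm_reverse_triangle:
  assumes "a \<in> carrier R" "b \<in> carrier R"
  shows "\<bar>nrm a - nrm b\<bar> \<le> nrm (a \<ominus> b)"
  using norm_le_diff[OF assms] norm_le_diff[OF assms(2,1)] norm_diff_commute[OF assms] by linarith

lemma norm_product_diff: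
  assumes "a \<in> carrier R" "b \<in> carrier R" "c \<in> carrier R" "d \<in> carrier R"
  shows "nrm (a \<otimes> b \<ominus> c \<otimes> d) \<le> nrm (a \<ominus> c) * nrm b + nrm c * nrm (b \<ominus> d)"
  using product_diff[OF assms] norm_triangle[of "(a \<ominus> c) \<otimes> b" "c \<otimes> (b \<ominus> d)"]
    norm_submult[of "a \<ominus> c" b] norm_submult[of c "b \<ominus> d"] assms by fastforce

lemma norm_finsum:
  assumes "finite I" "f \<in> I \<rightarrow> carrier R"
  shows "nrm (\<Oplus>i\<in>I. f i) \<le> (\<Sum>i\<in>I. nrm (f i))"
  using assms
proof (induction rule: finite_induct)
  case (insert i I)
  then have "nrm (\<Oplus>i\<in>insert i I. f i) \<le> nrm (f i) + nrm (\<Oplus>i\<in>I. f i)"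
    by (simp add: norm_triangle)
  then show ?case using insert by force
qed simp

lemma norm_geometric_steps:
  assumes "\<And>j. \<sigma> j \<in> carrier R" and "\<And>j::nat. nrm (\<sigma> (Suc j) \<ominus> \<sigma> j) \<le> c * (1/2) ^ j"
  shows "nrm (\<sigma> (i + k) \<ominus> \<sigma> i) \<le> 2 * c * ((1/2) ^ i - (1/2) ^ (i + k))"
proof (induction k)
  case (Suc k)
  have "nrm (\<sigma> (i + Suc k) \<ominus> \<sigma> i) \<le> nrm (\<sigma> (Suc (i + k)) \<ominus> \<sigma> (i + k)) + nrm (\<sigma> (i + k) \<ominus> \<sigma> i)"
    using norm_diff_trans assms(1) by simp
  then show ?case using Suc assms(2)[of "i + k"] by (simp add: algebra_simps)
qed (simp add: assms a_minus_def r_neg)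

lemma geometric_steps_Cauchy:
  assumes \<sigma>: "\<And>j. \<sigma> j \<in> carrier R" and step: "\<And>j::nat. nrm (\<sigma> (Suc j) \<ominus> \<sigma> j) \<le> c * (1/2) ^ j"
    and "\<epsilon> > 0"
  shows "\<exists>N. \<forall>i\<ge>N. \<forall>j\<ge>N. nrm (\<sigma> i \<ominus> \<sigma> j) < \<epsilon>"
proof -
  have c: "0 \<le> c" using order_trans[OF norm_nonneg step[of 0]] \<sigma> by simp
  have "(\<lambda>N. 4 * c * (1/2::real) ^ N) \<longlonglongrightarrow> 4 * c * 0"
    by (intro tendsto_intros LIMSEQ_power_zero) simp
  from order_tendstoD(2)[OF this, of \<epsilon>] obtain N where N: "4 * c * (1/2::real) ^ N < \<epsilon>"
    using \<open>\<epsilon> > 0\<close> by (auto simp: eventually_sequentially)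
  have "nrm (\<sigma> i \<ominus> \<sigma> j) < \<epsilon>" if "i \<ge> N" "j \<ge> N" for i j
  proof -
    have near: "nrm (\<sigma> k \<ominus> \<sigma> N) \<le> 2 * c * (1/2) ^ N" if "k \<ge> N" for k
    proof -
      have "nrm (\<sigma> k \<ominus> \<sigma> N) \<le> 2 * c * ((1/2) ^ N - (1/2) ^ k)"
        using norm_geometric_steps[OF \<sigma> step, of N "k - N"] that by simp
      also have "\<dots> \<le> 2 * c * (1/2) ^ N" using c by (intro mult_left_mono) auto
      finally show ?thesis .
    qed
    have "nrm (\<sigma> i \<ominus> \<sigma> j) \<le> nrm (\<sigma> i \<ominus> \<sigma> N) + nrm (\<sigma> N \<ominus> \<sigma> j)"
      using norm_diff_trans \<sigma> by simp
    then show ?thesis using near[OF that(1)] near[OF that(2)] norm_diff_commute[OF \<sigma>[of N] \<sigma>[of j]] N by linarith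
  qed
  then show ?thesis by blast
qed

text \<open>The maps \<open>S\<close> and \<open>T\<close> solve the equation \<open>s q + t p = e\<close>, linearised at the starting point, up to a
  quarter of the size of \<open>e\<close>. They are not updated, so the convergence is only linear: the second
  order terms contribute at most another quarter because of \<open>20 C\<^sup>2 \<eta> \<le> 1\<close>, and each step halves
  the error. The sets \<open>M\<close>, \<open>N\<close>, \<open>E\<close> will consist of the polynomials below given degrees.\<close>

lemma newton_iteration:
  fixes C \<eta> :: real
  assumes g: "g \<in> carrier R" and p: "p \<in> carrier R" and q: "q \<in> carrier R"
    and M: "M \<subseteq> carrier R" "\<zero> \<in> M" "\<And>x x'. x \<in> M \<Longrightarrow> x' \<in> M \<Longrightarrow> x \<oplus> x' \<in> M"
    and N: "N \<subseteq> carrier R" "\<zero> \<in> N" "\<And>y y'. y \<in> N \<Longrightarrow> y' \<in> N \<Longrightarrow> y \<oplus> y' \<in> N"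
    and complete_M: "\<And>\<sigma> c. (\<And>j::nat. \<sigma> j \<in> M) \<Longrightarrow> (\<And>j. nrm (\<sigma> (Suc j) \<ominus> \<sigma> j) \<le> c * (1/2) ^ j) \<Longrightarrow>
          \<exists>l\<in>M. (\<lambda>j. nrm (\<sigma> j \<ominus> l)) \<longlonglongrightarrow> 0"
    and complete_N: "\<And>\<sigma> c. (\<And>j::nat. \<sigma> j \<in> N) \<Longrightarrow> (\<And>j. nrm (\<sigma> (Suc j) \<ominus> \<sigma> j) \<le> c * (1/2) ^ j) \<Longrightarrow>
          \<exists>l\<in>N. (\<lambda>j. nrm (\<sigma> j \<ominus> l)) \<longlonglongrightarrow> 0"
    and E: "\<And>x y. x \<in> M \<Longrightarrow> y \<in> N \<Longrightarrow> g \<ominus> (p \<oplus> x) \<otimes> (q \<oplus> y) \<in> E"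
    and S: "\<And>e. e \<in> E \<Longrightarrow> S e \<in> M" "\<And>e. e \<in> E \<Longrightarrow> nrm (S e) \<le> C * nrm e"
    and T: "\<And>e. e \<in> E \<Longrightarrow> T e \<in> N" "\<And>e. e \<in> E \<Longrightarrow> nrm (T e) \<le> C * nrm e"
    and ST: "\<And>e. e \<in> E \<Longrightarrow> nrm (S e \<otimes> q \<oplus> T e \<otimes> p \<ominus> e) \<le> nrm e / 4"
    and start: "nrm (g \<ominus> p \<otimes> q) \<le> \<eta>" and C: "1 \<le> C" and \<eta>: "20 * C\<^sup>2 * \<eta> \<le> 1"
  shows "\<exists>x\<in>M. \<exists>y\<in>N. (p \<oplus> x) \<otimes> (q \<oplus> y) = g \<and> nrm x \<le> 2 * C * \<eta> \<and> nrm y \<le> 2 * C * \<eta>"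
proof -
  define err where "err = (\<lambda>(x, y). g \<ominus> (p \<oplus> x) \<otimes> (q \<oplus> y))"
  define z where "z = rec_nat (\<zero>, \<zero>) (\<lambda>_ w. (fst w \<oplus> S (err w), snd w \<oplus> T (err w)))"
  define x where "x j = fst (z j)" for j
  define y where "y j = snd (z j)" for j
  define e where "e j = err (z j)" for j
  have e_def': "e j = g \<ominus> (p \<oplus> x j) \<otimes> (q \<oplus> y j)" for j
    by (simp add: e_def err_def x_def y_def case_prod_beta)
  have x0: "x 0 = \<zero>" and y0: "y 0 = \<zero>" by (simp_all add: x_def y_def z_def)
  have xS: "x (Suc j) = x j \<oplus> S (e j)" and yS: "y (Suc j) = y j \<oplus> T (e j)" for j
    by (simp_all add: x_def y_def z_def e_def)
  have xy: "x j \<in> M \<and> y j \<in> N" for j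
    by (induction j) (auto simp: x0 y0 xS yS M N e_def' E S T)
  then have eE: "e j \<in> E" for j using E by (simp add: e_def')
  have xc: "x j \<in> carrier R" and yc: "y j \<in> carrier R" for j using xy M N by blast+
  have sc: "S (e j) \<in> carrier R" and tc: "T (e j) \<in> carrier R" for j using eE S T M N by blast+
  have ec: "e j \<in> carrier R" for j using g p q xc yc by (simp add: e_def')
  have \<eta>0: "0 \<le> \<eta>" using start norm_nonneg[of "g \<ominus> p \<otimes> q"] g p q by simp
  \<comment> \<open>The bounds on \<open>x j\<close> and \<open>y j\<close> are sums of geometric series, kept exact so that they propagate.\<close>
  have bounds: "nrm (e j) \<le> \<eta> * (1/2) ^ j \<and> nrm (x j) \<le> 2 * C * \<eta> * (1 - (1/2) ^ j)
      \<and> nrm (y j) \<le> 2 * C * \<eta> * (1 - (1/2) ^ j)" for j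
  proof (induction j)
    case 0
    then show ?case using start g p q by (simp add: e_def' x0 y0)
  next
    case (Suc j)
    let ?n = "nrm (e j)" and ?h = "(1/2::real) ^ j"
    have h: "0 < ?h" "?h \<le> 1" by (auto simp: power_le_one)
    have n0: "0 \<le> ?n" using norm_nonneg ec by blast
    have n\<eta>: "?n \<le> \<eta>" using Suc \<eta>0 mult_left_mono[OF h(2) \<eta>0] by linarith
    have s: "nrm (S (e j)) \<le> C * ?n" and t: "nrm (T (e j)) \<le> C * ?n" using S T eE by blast+
    have C\<eta>: "2 * C * \<eta> * (1 - ?h) \<le> 2 * C * \<eta>"
      using C \<eta>0 h by (simp add: mult_left_le)
    have xb: "nrm (x j) \<le> 2 * C * \<eta>" and yb: "nrm (y j) \<le> 2 * C * \<eta>" using Suc C\<eta> by linarith+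
    have Cn: "0 \<le> C * ?n" using C n0 by simp
    have "C * ?n \<le> C * (\<eta> * ?h)" using Suc C by (intro mult_left_mono) auto
    then have Ch: "C * ?n \<le> C * \<eta> * ?h" by (simp add: mult.assoc)
    have x': "nrm (x (Suc j)) \<le> nrm (x j) + C * ?n"
      using norm_triangle[OF xc[of j] sc[of j]] s xS[of j] by simp
    have y': "nrm (y (Suc j)) \<le> nrm (y j) + C * ?n"
      using norm_triangle[OF yc[of j] tc[of j]] t yS[of j] by simp
    have sy: "nrm (S (e j) \<otimes> y j) \<le> C * ?n * (2 * C * \<eta>)"
      using norm_submult[OF sc[of j] yc[of j]] mult_mono[OF s yb Cn norm_nonneg[OF yc]] by linarith
    have tx: "nrm (T (e j) \<otimes> x j) \<le> C * ?n * (2 * C * \<eta>)"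
      using norm_submult[OF tc[of j] xc[of j]] mult_mono[OF t xb Cn norm_nonneg[OF xc]] by linarith
    have "C * ?n \<le> C * \<eta>" using n\<eta> C by simp
    then have t': "nrm (T (e j)) \<le> C * \<eta>" using t by linarith
    have st: "nrm (S (e j) \<otimes> T (e j)) \<le> C * ?n * (C * \<eta>)"
      using norm_submult[OF sc[of j] tc[of j]] mult_mono[OF s t' Cn norm_nonneg[OF tc]] by linarith
    let ?a = "S (e j) \<otimes> q \<oplus> T (e j) \<otimes> p \<ominus> e j"
    let ?b = "S (e j) \<otimes> y j \<oplus> (T (e j) \<otimes> x j \<oplus> S (e j) \<otimes> T (e j))"
    have ac: "?a \<in> carrier R" and bc: "?b \<in> carrier R" using sc tc p q ec xc yc by auto
    have "e (Suc j) = \<ominus> (?a \<oplus> ?b)"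
      using newton_error_identity[OF g p q xc[of j] yc[of j] sc[of j] tc[of j]]
      by (simp add: e_def' xS yS)
    then have "nrm (e (Suc j)) \<le> nrm ?a + nrm ?b" using ac bc norm_minus norm_triangle by simp
    also have "nrm ?b \<le> nrm (S (e j) \<otimes> y j) + (nrm (T (e j) \<otimes> x j) + nrm (S (e j) \<otimes> T (e j)))"
      using norm_triangle[of "S (e j) \<otimes> y j" "T (e j) \<otimes> x j \<oplus> S (e j) \<otimes> T (e j)"]
        norm_triangle[of "T (e j) \<otimes> x j" "S (e j) \<otimes> T (e j)"] sc tc xc yc by fastforce
    also have "\<dots> \<le> C * ?n * (2 * C * \<eta>) + (C * ?n * (2 * C * \<eta>) + C * ?n * (C * \<eta>))"
      using sy tx st by linarith
    also have "\<dots> = (20 * C\<^sup>2 * \<eta>) * ?n / 4" by (simp add: power2_eq_square)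
    also have "\<dots> \<le> ?n / 4" using mult_right_mono[OF \<eta> n0] by linarith
    finally have "nrm (e (Suc j)) \<le> nrm ?a + ?n / 4" by simp
    also have "\<dots> \<le> ?n / 2" using ST[OF eE[of j]] by simp
    finally have "nrm (e (Suc j)) \<le> \<eta> * (1/2) ^ Suc j" using Suc by simp
    moreover have "nrm (x (Suc j)) \<le> 2 * C * \<eta> * (1 - (1/2) ^ Suc j)"
      using x' Ch Suc by (simp add: algebra_simps)
    moreover have "nrm (y (Suc j)) \<le> 2 * C * \<eta> * (1 - (1/2) ^ Suc j)"
      using y' Ch Suc by (simp add: algebra_simps)
    ultimately show ?case by simp
  qed
  have Ce: "C * nrm (e j) \<le> C * \<eta> * (1/2) ^ j" for j
    using mult_left_mono[of "nrm (e j)" "\<eta> * (1/2)^j" C] bounds[of j] C by (simp add: mult.assoc)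
  have "x (Suc j) \<ominus> x j = S (e j)" for j
    using add_diff_cancel_left[OF xc sc] xS by simp
  then have "nrm (x (Suc j) \<ominus> x j) \<le> C * \<eta> * (1/2) ^ j" for j
    using order_trans[OF S(2)[OF eE] Ce] by simp
  then obtain u where u: "u \<in> M" "(\<lambda>j. nrm (x j \<ominus> u)) \<longlonglongrightarrow> 0"
    using complete_M[of x "C * \<eta>"] xy by blast
  have "y (Suc j) \<ominus> y j = T (e j)" for j
    using add_diff_cancel_left[OF yc tc] yS by simp
  then have "nrm (y (Suc j) \<ominus> y j) \<le> C * \<eta> * (1/2) ^ j" for j
    using order_trans[OF T(2)[OF eE] Ce] by simp
  then obtain v where v: "v \<in> N" "(\<lambda>j. nrm (y j \<ominus> v)) \<longlonglongrightarrow> 0"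
    using complete_N[of y "C * \<eta>"] xy by blast
  have uc: "u \<in> carrier R" and vc: "v \<in> carrier R" using u v M N by blast+
  have half: "(\<lambda>j. (1/2::real) ^ j) \<longlonglongrightarrow> 0" by (intro LIMSEQ_power_zero) simp
  have C\<eta>0: "0 \<le> 2 * C * \<eta>" using C \<eta>0 by simp
  have 1: "2 * C * \<eta> * (1 - (1/2) ^ j) \<le> 2 * C * \<eta>" for j :: nat
    using C\<eta>0 by (intro mult_left_le) auto
  have xb: "nrm (x j) \<le> 2 * C * \<eta>" and yb: "nrm (y j) \<le> 2 * C * \<eta>" for j
    using bounds[of j] 1[of j] by linarith+
  have "nrm u \<le> nrm (x j \<ominus> u) + 2 * C * \<eta>" for j
    using norm_le_diff[OF uc xc[of j]] norm_diff_commute[OF uc xc[of j]] xb[of j] by simp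
  then have ub: "nrm u \<le> 0 + 2 * C * \<eta>"
    by (intro LIMSEQ_le_const[OF tendsto_add[OF u(2) tendsto_const]]) blast
  have "nrm v \<le> nrm (y j \<ominus> v) + 2 * C * \<eta>" for j
    using norm_le_diff[OF vc yc[of j]] norm_diff_commute[OF vc yc[of j]] yb[of j] by simp
  then have vb: "nrm v \<le> 0 + 2 * C * \<eta>"
    by (intro LIMSEQ_le_const[OF tendsto_add[OF v(2) tendsto_const]]) blast
  let ?D = "g \<ominus> (p \<oplus> u) \<otimes> (q \<oplus> v)"
  let ?K = "nrm p + 2 * C * \<eta>" and ?L = "nrm q + 2 * C * \<eta>"
  have Dc: "?D \<in> carrier R" using g p q uc vc by simp
  have "nrm ?D \<le> \<eta> * (1/2) ^ j + (nrm (x j \<ominus> u) * ?L + ?K * nrm (y j \<ominus> v))" for j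
  proof -
    have c: "p \<oplus> x j \<in> carrier R" "q \<oplus> y j \<in> carrier R" "p \<oplus> u \<in> carrier R" "q \<oplus> v \<in> carrier R"
      using p q xc yc uc vc by auto
    have d: "(p \<oplus> x j) \<ominus> (p \<oplus> u) = x j \<ominus> u" "(q \<oplus> y j) \<ominus> (q \<oplus> v) = y j \<ominus> v"
      using p q xc yc uc vc by (simp_all add: add_diff_add_left)
    have "nrm ?D \<le> nrm (e j) + nrm ((p \<oplus> x j) \<otimes> (q \<oplus> y j) \<ominus> (p \<oplus> u) \<otimes> (q \<oplus> v))"
      using norm_diff_trans[of g "(p \<oplus> x j) \<otimes> (q \<oplus> y j)" "(p \<oplus> u) \<otimes> (q \<oplus> v)"] c g
      by (simp add: e_def')
    also have "nrm ((p \<oplus> x j) \<otimes> (q \<oplus> y j) \<ominus> (p \<oplus> u) \<otimes> (q \<oplus> v))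
        \<le> nrm (x j \<ominus> u) * nrm (q \<oplus> y j) + nrm (p \<oplus> u) * nrm (y j \<ominus> v)"
      using norm_product_diff[OF c] d by simp
    also have "\<dots> \<le> nrm (x j \<ominus> u) * ?L + ?K * nrm (y j \<ominus> v)"
      using norm_triangle[OF p uc] norm_triangle[OF q yc[of j]] yb[of j] ub xc uc yc vc
      by (intro add_mono mult_left_mono mult_right_mono norm_nonneg) auto
    finally show ?thesis using bounds[of j] by simp
  qed
  moreover have "(\<lambda>j. \<eta> * (1/2) ^ j + (nrm (x j \<ominus> u) * ?L + ?K * nrm (y j \<ominus> v))) \<longlonglongrightarrow> \<eta> * 0 + (0 * ?L + ?K * 0)"
    by (intro tendsto_intros u v half)
  ultimately have "nrm ?D \<le> \<eta> * 0 + (0 * ?L + ?K * 0)"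
    by (intro LIMSEQ_le_const) auto
  then have "nrm ?D = 0" using norm_nonneg[OF Dc] by simp
  then have "?D = \<zero>" using norm_eq_0_iff Dc by blast
  then have "g = (p \<oplus> u) \<otimes> (q \<oplus> v)" using g p q uc vc by simp
  then show ?thesis using u v ub vb by auto
qed

end

section \<open>Polynomials over a normed ring\<close>

context ring
begin

lemma UP_carrierI:
  assumes "\<And>i. p i \<in> carrier R" "\<And>i. i \<ge> n \<Longrightarrow> p i = \<zero>"
  shows "p \<in> carrier (UP R)"
  using assms unfolding UP_def up_def bound_def by (force intro: exI[of _ n])

lemma UP_coeff_closed [simp]: "p \<in> carrier (UP R) \<Longrightarrow> p i \<in> carrier R"
  by (auto simp: UP_def)

lemma UP_carrierE:
  assumes "p \<in> carrier (UP R)"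
  obtains n where "\<And>i. i \<ge> n \<Longrightarrow> p i = \<zero>"
proof -
  obtain n where "bound \<zero> n p" using assms by (auto simp: UP_def)
  then show ?thesis using that[of "Suc n"] by (auto simp: bound_def)
qed

lemma UP_add_app [simp]:
  "p \<in> carrier (UP R) \<Longrightarrow> q \<in> carrier (UP R) \<Longrightarrow> (p \<oplus>\<^bsub>UP R\<^esub> q) i = p i \<oplus> q i"
  by (simp add: UP_def)

lemma UP_mult_app:
  "p \<in> carrier (UP R) \<Longrightarrow> q \<in> carrier (UP R) \<Longrightarrow>
    (p \<otimes>\<^bsub>UP R\<^esub> q) i = (\<Oplus>k\<in>{..i}. p k \<otimes> q (i - k))"
  by (simp add: UP_def)

lemma UP_zero_app [simp]: "\<zero>\<^bsub>UP R\<^esub> i = \<zero>"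
  by (simp add: UP_def)

lemma UP_one_app: "\<one>\<^bsub>UP R\<^esub> i = (if i = 0 then \<one> else \<zero>)"
  by (simp add: UP_def)

lemma UP_smult_app [simp]:
  "a \<in> carrier R \<Longrightarrow> p \<in> carrier (UP R) \<Longrightarrow> (a \<odot>\<^bsub>UP R\<^esub> p) i = a \<otimes> p i"
  by (simp add: UP_def)

lemma UP_monom_app [simp]: "a \<in> carrier R \<Longrightarrow> up_ring.monom (UP R) a n i = (if i = n then a else \<zero>)"
  by (simp add: UP_def)

lemma ring_UP: "ring (UP R)"
  by (rule UP_ring.UP_ring) (rule UP_ring.intro, rule ring_axioms)

lemma UP_minus_app [simp]:
  assumes "p \<in> carrier (UP R)"
  shows "(\<ominus>\<^bsub>UP R\<^esub> p) i = \<ominus> p i"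
proof -
  interpret P: ring "UP R" by (rule ring_UP)
  have "p i \<oplus> (\<ominus>\<^bsub>UP R\<^esub> p) i = \<zero>"
    using assms P.r_neg[OF assms] UP_add_app[of p "\<ominus>\<^bsub>UP R\<^esub> p" i] by simp
  then show ?thesis
    using assms by (metis P.a_inv_closed UP_coeff_closed a_comm minus_equality)
qed

lemma UP_diff_app [simp]:
  assumes "p \<in> carrier (UP R)" "q \<in> carrier (UP R)"
  shows "(p \<ominus>\<^bsub>UP R\<^esub> q) i = p i \<ominus> q i"
proof -
  interpret P: ring "UP R" by (rule ring_UP)
  show ?thesis using assms by (simp add: a_minus_def[of "UP R"] a_minus_def)
qed

lemma UP_finsum_app:
  assumes "finite I" "f \<in> I \<rightarrow> carrier (UP R)"
  shows "(\<Oplus>\<^bsub>UP R\<^esub>k\<in>I. f k) i = (\<Oplus>k\<in>I. f k i)"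
proof -
  interpret P: ring "UP R" by (rule ring_UP)
  show ?thesis using assms
    by (induction rule: finite_induct) (auto simp: Pi_iff)
qed

end

lemma (in cring) cring_UP: "cring (UP R)"
  by (rule UP_cring.UP_cring) (rule UP_cring.intro, rule is_cring)

text \<open>A degree bound that holds for the zero polynomial and defines an additive subgroup.\<close>

definition polys_below :: "('a, 'm) ring_scheme \<Rightarrow> nat \<Rightarrow> (nat \<Rightarrow> 'a) set" where
  "polys_below R n = {p \<in> carrier (UP R). \<forall>i\<ge>n. p i = \<zero>\<^bsub>R\<^esub>}"

definition monics :: "('a, 'm) ring_scheme \<Rightarrow> nat \<Rightarrow> (nat \<Rightarrow> 'a) set" where
  "monics R n = {p \<in> carrier (UP R). p n = \<one>\<^bsub>R\<^esub> \<and> (\<forall>i>n. p i = \<zero>\<^bsub>R\<^esub>)}"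

context ring
begin

lemma polys_below_carrier: "polys_below R n \<subseteq> carrier (UP R)"
  by (auto simp: polys_below_def)

lemma monics_below: "monics R n \<subseteq> polys_below R (Suc n)"
  by (auto simp: monics_def polys_below_def)

lemma monics_carrier: "monics R n \<subseteq> carrier (UP R)"
  by (auto simp: monics_def)

lemma polys_below_iff:
  "p \<in> polys_below R n \<longleftrightarrow> (\<forall>i. p i \<in> carrier R) \<and> (\<forall>i\<ge>n. p i = \<zero>)"
  using UP_carrierI[of p n] by (auto simp: polys_below_def)

lemma polys_below_mono: "m \<le> n \<Longrightarrow> polys_below R m \<subseteq> polys_below R n"
  by (auto simp: polys_below_def)

lemma polys_below_zero: "\<zero>\<^bsub>UP R\<^esub> \<in> polys_below R n"
  by (auto simp: polys_below_iff)

lemma polys_below_add: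
  "p \<in> polys_below R n \<Longrightarrow> q \<in> polys_below R n \<Longrightarrow> p \<oplus>\<^bsub>UP R\<^esub> q \<in> polys_below R n"
  using ring.ring_simprules(1)[OF ring_UP] by (auto simp: polys_below_def)

lemma polys_below_diff:
  assumes "p \<in> polys_below R n" "q \<in> polys_below R n"
  shows "p \<ominus>\<^bsub>UP R\<^esub> q \<in> polys_below R n"
proof -
  interpret P: ring "UP R" by (rule ring_UP)
  show ?thesis using assms by (auto simp: polys_below_def a_minus_def r_neg)
qed

lemma polys_below_smult:
  assumes "a \<in> carrier R" "p \<in> polys_below R n"
  shows "a \<odot>\<^bsub>UP R\<^esub> p \<in> polys_below R n"
proof -
  have "p \<in> carrier (UP R)" using assms polys_below_carrier by blast
  then show ?thesis using assms by (auto simp: polys_below_iff)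
qed

lemma polys_below_finsum:
  assumes "finite I" "\<And>k. k \<in> I \<Longrightarrow> f k \<in> polys_below R n"
  shows "(\<Oplus>\<^bsub>UP R\<^esub>k\<in>I. f k) \<in> polys_below R n"
proof -
  interpret P: ring "UP R" by (rule ring_UP)
  have c: "p \<in> polys_below R n \<Longrightarrow> p \<in> carrier (UP R)" for p using polys_below_carrier by blast
  show ?thesis using assms
    by (induction rule: finite_induct) (auto simp: polys_below_zero polys_below_add Pi_iff c)
qed

lemma polys_below_mult:
  assumes "p \<in> polys_below R a" "q \<in> polys_below R (Suc c)"
  shows "p \<otimes>\<^bsub>UP R\<^esub> q \<in> polys_below R (a + c)"
proof -
  interpret P: ring "UP R" by (rule ring_UP)
  have pq: "p \<in> carrier (UP R)" "q \<in> carrier (UP R)" using assms polys_below_carrier by blast+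
  have "(p \<otimes>\<^bsub>UP R\<^esub> q) i = \<zero>" if "i \<ge> a + c" for i
  proof -
    have "p k \<otimes> q (i - k) = \<zero>" if "k \<le> i" for k
    proof (cases "k < a")
      case True
      then have "q (i - k) = \<zero>" using assms(2) \<open>i \<ge> a + c\<close> by (simp add: polys_below_def)
      then show ?thesis using pq by simp
    next
      case False
      then have "p k = \<zero>" using assms(1) by (simp add: polys_below_def)
      then show ?thesis using pq by simp
    qed
    then have "(\<Oplus>k\<in>{..i}. p k \<otimes> q (i - k)) = (\<Oplus>k\<in>{..i}. \<zero>)"
      by (intro finsum_cong) auto
    then show ?thesis using pq by (simp add: UP_mult_app)
  qed
  then show ?thesis using pq by (simp add: polys_below_def)
qed

lemma monics_mult_top:
  assumes p: "p \<in> monics R m" and q: "q \<in> polys_below R (Suc n)"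
  shows "(p \<otimes>\<^bsub>UP R\<^esub> q) (m + n) = q n"
proof -
  have pq: "p \<in> carrier (UP R)" "q \<in> carrier (UP R)" using p q monics_carrier polys_below_carrier by blast+
  have "p k \<otimes> q (m + n - k) = (if m = k then q n else \<zero>)" if "k \<le> m + n" for k
  proof (cases "m < k")
    case True
    then show ?thesis using p pq by (simp add: monics_def)
  next
    case False
    show ?thesis
    proof (cases "m = k")
      case False
      with \<open>\<not> m < k\<close> have "Suc n \<le> m + n - k" by simp
      then have "q (m + n - k) = \<zero>" using q by (simp add: polys_below_def)
      then show ?thesis using pq False by simp
    qed (use p pq in \<open>simp add: monics_def\<close>)
  qed
  then have "(\<Oplus>k\<in>{..m+n}. p k \<otimes> q (m + n - k)) = (\<Oplus>k\<in>{..m+n}. if m = k then q n else \<zero>)"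
    using pq by (intro finsum_cong') auto
  also have "\<dots> = q n" using finsum_singleton[of m "{..m+n}" "\<lambda>_. q n"] pq by auto
  finally show ?thesis using pq by (simp add: UP_mult_app)
qed

lemma monics_mult:
  assumes "p \<in> monics R m" "q \<in> monics R n"
  shows "p \<otimes>\<^bsub>UP R\<^esub> q \<in> monics R (m + n)"
proof -
  have "p \<otimes>\<^bsub>UP R\<^esub> q \<in> polys_below R (Suc m + n)"
    using polys_below_mult assms monics_below by blast
  then show ?thesis
    using monics_mult_top[OF assms(1) subsetD[OF monics_below assms(2)]] assms(2)
    by (simp add: monics_def polys_below_def)
qed

text \<open>Leading coefficients do not cancel in a product with a monic polynomial, so such a product
  bounds the degree of the other factor over any commutative ring.\<close>

lemma monic_mult_below:
  assumes p: "p \<in> monics R m" and w: "w \<in> carrier (UP R)"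
    and pw: "p \<otimes>\<^bsub>UP R\<^esub> w \<in> polys_below R (m + n)"
  shows "w \<in> polys_below R n"
proof -
  obtain N where N: "\<And>i. i \<ge> N \<Longrightarrow> w i = \<zero>" using UP_carrierE[OF w] by blast
  have "w \<in> polys_below R (n + k) \<Longrightarrow> w \<in> polys_below R n" for k
  proof (induction k)
    case (Suc k)
    have "w (n + k) = (p \<otimes>\<^bsub>UP R\<^esub> w) (m + (n + k))"
      using monics_mult_top[OF p, of w "n + k"] Suc.prems by simp
    also have "\<dots> = \<zero>" using pw by (simp add: polys_below_def)
    finally have "w i = \<zero>" if "i \<ge> n + k" for i
      using that Suc.prems by (cases "i = n + k") (auto simp: polys_below_def)
    then show ?case using Suc.IH w by (simp add: polys_below_def)
  qed simp
  moreover have "w \<in> polys_below R (n + N)" using w N by (simp add: polys_below_def)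
  ultimately show ?thesis by blast
qed

lemma monics_diff:
  assumes "p \<in> monics R n" "q \<in> monics R n"
  shows "p \<ominus>\<^bsub>UP R\<^esub> q \<in> polys_below R n"
proof -
  interpret P: ring "UP R" by (rule ring_UP)
  have "p i \<ominus> q i = \<zero>" if "i \<ge> n" for i
    using assms that by (cases "i = n") (auto simp: monics_def a_minus_def r_neg)
  then show ?thesis using assms by (simp add: polys_below_def monics_def)
qed

lemma monics_add:
  assumes "p \<in> monics R n" "q \<in> polys_below R n"
  shows "p \<oplus>\<^bsub>UP R\<^esub> q \<in> monics R n"
  using assms ring.ring_simprules(1)[OF ring_UP] by (auto simp: polys_below_def monics_def)

end

text \<open>The sum norm is submultiplicative over every normed ring, whereas the maximum of the coefficients
  is so only in the ultrametric case.\<close>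

definition poly_norm :: "('a, 'm) ring_scheme \<Rightarrow> ('a \<Rightarrow> real) \<Rightarrow> (nat \<Rightarrow> 'a) \<Rightarrow> real" where
  "poly_norm R nrm p = (\<Sum>i | p i \<noteq> \<zero>\<^bsub>R\<^esub>. nrm (p i))"

context normed_cring
begin

abbreviation pnorm :: "(nat \<Rightarrow> 'a) \<Rightarrow> real" where "pnorm \<equiv> poly_norm R nrm"

lemma poly_norm_eq:
  assumes "\<And>i. i \<ge> n \<Longrightarrow> p i = \<zero>"
  shows "pnorm p = (\<Sum>i<n. nrm (p i))"
  unfolding poly_norm_def
  by (rule sum.mono_neutral_left) (use assms in \<open>auto simp: not_less[symmetric]\<close>)

lemma poly_norm_triangle:
  assumes "p \<in> carrier (UP R)" "q \<in> carrier (UP R)"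
  shows "pnorm (p \<oplus>\<^bsub>UP R\<^esub> q) \<le> pnorm p + pnorm q"
proof -
  obtain m where m: "\<And>i. i \<ge> m \<Longrightarrow> p i = \<zero>" using UP_carrierE[OF assms(1)] by blast
  obtain n where n: "\<And>i. i \<ge> n \<Longrightarrow> q i = \<zero>" using UP_carrierE[OF assms(2)] by blast
  have "pnorm (p \<oplus>\<^bsub>UP R\<^esub> q) = (\<Sum>i<max m n. nrm (p i \<oplus> q i))"
    using m n assms by (subst poly_norm_eq[of "max m n"]) auto
  also have "\<dots> \<le> (\<Sum>i<max m n. nrm (p i) + nrm (q i))"
    using assms by (intro sum_mono norm_triangle) auto
  also have "\<dots> = pnorm p + pnorm q"
    using poly_norm_eq[of "max m n" p] poly_norm_eq[of "max m n" q] m n by (simp add: sum.distrib)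
  finally show ?thesis .
qed

lemma poly_norm_submult:
  assumes "p \<in> carrier (UP R)" "q \<in> carrier (UP R)"
  shows "pnorm (p \<otimes>\<^bsub>UP R\<^esub> q) \<le> pnorm p * pnorm q"
proof -
  obtain m where m: "\<And>i. i \<ge> m \<Longrightarrow> p i = \<zero>" using UP_carrierE[OF assms(1)] by blast
  obtain n where n: "\<And>i. i \<ge> n \<Longrightarrow> q i = \<zero>" using UP_carrierE[OF assms(2)] by blast
  let ?f = "\<lambda>i j. nrm (p i) * nrm (q j)"
  have B: "p \<in> polys_below R m" "q \<in> polys_below R (Suc n)"
    using assms m n by (auto simp: polys_below_def)
  have z: "\<And>i. i \<ge> m + n \<Longrightarrow> (p \<otimes>\<^bsub>UP R\<^esub> q) i = \<zero>"
    using polys_below_mult[OF B] by (auto simp: polys_below_def)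
  have "nrm (\<Oplus>k\<in>{..i}. p k \<otimes> q (i - k)) \<le> (\<Sum>k\<le>i. ?f k (i - k))" for i
  proof -
    have "nrm (\<Oplus>k\<in>{..i}. p k \<otimes> q (i - k)) \<le> (\<Sum>k\<le>i. nrm (p k \<otimes> q (i - k)))"
      using assms by (intro norm_finsum) auto
    also have "\<dots> \<le> (\<Sum>k\<le>i. ?f k (i - k))"
      using assms by (intro sum_mono norm_submult) auto
    finally show ?thesis .
  qed
  then have "pnorm (p \<otimes>\<^bsub>UP R\<^esub> q) \<le> (\<Sum>i<m+n. \<Sum>k\<le>i. ?f k (i - k))"
    using assms by (subst poly_norm_eq[OF z]) (auto simp: UP_mult_app intro!: sum_mono)
  also have "\<dots> = (\<Sum>(i,j)\<in>{(i,j). i + j < m + n}. ?f i j)"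
    by (rule sum.triangle_reindex[symmetric])
  also have "\<dots> \<le> (\<Sum>(i,j)\<in>{..<m+n} \<times> {..<m+n}. ?f i j)"
    using assms by (intro sum_mono2) (auto intro!: mult_nonneg_nonneg norm_nonneg)
  also have "\<dots> = (\<Sum>i<m+n. nrm (p i)) * (\<Sum>j<m+n. nrm (q j))"
    by (simp add: sum_product sum.cartesian_product)
  also have "\<dots> = pnorm p * pnorm q"
    using poly_norm_eq[of "m + n" p] poly_norm_eq[of "m + n" q] m n by simp
  finally show ?thesis .
qed

lemma poly_norm_nonneg: "p \<in> carrier (UP R) \<Longrightarrow> 0 \<le> pnorm p"
  unfolding poly_norm_def by (intro sum_nonneg norm_nonneg) auto

lemma coeff_norm_le:
  assumes "p \<in> carrier (UP R)"
  shows "nrm (p i) \<le> pnorm p"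
proof -
  obtain m where m: "\<And>i. i \<ge> m \<Longrightarrow> p i = \<zero>" using UP_carrierE[OF assms(1)] by blast
  have "nrm (p i) \<le> (\<Sum>j<max m (Suc i). nrm (p j))"
    using assms by (intro member_le_sum) (auto intro: norm_nonneg)
  then show ?thesis using m by (subst poly_norm_eq[of "max m (Suc i)"]) auto
qed

lemma normed_cring_UP: "normed_cring (UP R) pnorm"
proof -
  interpret P: cring "UP R" by (rule cring_UP)
  show ?thesis
  proof
    fix p q assume p: "p \<in> carrier (UP R)"
    show "0 \<le> pnorm p" using p by (rule poly_norm_nonneg)
    show "pnorm p = 0 \<longleftrightarrow> p = \<zero>\<^bsub>UP R\<^esub>"
    proof
      assume "pnorm p = 0"
      then have "nrm (p i) = 0" for i using coeff_norm_le[OF p, of i] norm_nonneg p by (simp add: antisym)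
      then show "p = \<zero>\<^bsub>UP R\<^esub>" using p norm_eq_0_iff by (intro ext) simp
    qed (simp add: poly_norm_def)
    show "pnorm (\<ominus>\<^bsub>UP R\<^esub> p) = pnorm p"
    proof -
      obtain m where m: "\<And>i. i \<ge> m \<Longrightarrow> p i = \<zero>" using UP_carrierE[OF p] by blast
      show ?thesis using m p norm_minus poly_norm_eq[of m p] poly_norm_eq[of m "\<ominus>\<^bsub>UP R\<^esub> p"] by simp
    qed
    assume q: "q \<in> carrier (UP R)"
    show "pnorm (p \<oplus>\<^bsub>UP R\<^esub> q) \<le> pnorm p + pnorm q" "pnorm (p \<otimes>\<^bsub>UP R\<^esub> q) \<le> pnorm p * pnorm q"
      using p q by (rule poly_norm_triangle poly_norm_submult)+
  qed
qed

lemma poly_norm_smult: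
  assumes "a \<in> carrier R" "p \<in> carrier (UP R)"
  shows "pnorm (a \<odot>\<^bsub>UP R\<^esub> p) \<le> nrm a * pnorm p"
proof -
  obtain m where m: "\<And>i. i \<ge> m \<Longrightarrow> p i = \<zero>" using UP_carrierE[OF assms(2)] by blast
  have "pnorm (a \<odot>\<^bsub>UP R\<^esub> p) = (\<Sum>i<m. nrm (a \<otimes> p i))"
    using assms m by (subst poly_norm_eq[of m]) auto
  also have "\<dots> \<le> (\<Sum>i<m. nrm a * nrm (p i))"
    using assms by (intro sum_mono norm_submult) auto
  also have "\<dots> = nrm a * pnorm p" using poly_norm_eq[of m p] m by (simp add: sum_distrib_left)
  finally show ?thesis .
qed

text \<open>The expansion of a polynomial in the basis \<open>1, T, T\<^sup>2, \<dots>\<close> turns a family of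
  polynomials \<open>u k\<close>, the images of the basis, into a linear map with norm bound.\<close>

definition extend_linearly :: "nat \<Rightarrow> (nat \<Rightarrow> nat \<Rightarrow> 'a) \<Rightarrow> (nat \<Rightarrow> 'a) \<Rightarrow> (nat \<Rightarrow> 'a)" where
  "extend_linearly N u e = (\<Oplus>\<^bsub>UP R\<^esub>k\<in>{..<N}. e k \<odot>\<^bsub>UP R\<^esub> u k)"

lemma extend_linearly_below:
  assumes "e \<in> carrier (UP R)" "\<And>k. k < N \<Longrightarrow> u k \<in> polys_below R m"
  shows "extend_linearly N u e \<in> polys_below R m"
  unfolding extend_linearly_def using assms by (intro polys_below_finsum polys_below_smult) auto

lemma extend_linearly_bound:
  assumes e: "e \<in> polys_below R N" and u: "\<And>k. k < N \<Longrightarrow> u k \<in> carrier (UP R)"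
    and bd: "\<And>k. k < N \<Longrightarrow> pnorm (u k) \<le> c"
  shows "pnorm (extend_linearly N u e) \<le> c * pnorm e"
proof -
  interpret P: normed_cring "UP R" pnorm by (rule normed_cring_UP)
  interpret U: UP_cring R "UP R" by unfold_locales simp
  have ec: "e \<in> carrier (UP R)" using e polys_below_carrier by blast
  have "pnorm (extend_linearly N u e) \<le> (\<Sum>k<N. pnorm (e k \<odot>\<^bsub>UP R\<^esub> u k))"
    unfolding extend_linearly_def using ec u by (intro P.norm_finsum) auto
  also have "\<dots> \<le> (\<Sum>k<N. nrm (e k) * c)"
  proof (rule sum_mono)
    fix k assume "k \<in> {..<N}"
    then show "pnorm (e k \<odot>\<^bsub>UP R\<^esub> u k) \<le> nrm (e k) * c"
      using poly_norm_smult[of "e k" "u k"] ec u bd mult_left_mono[OF bd norm_nonneg[of "e k"]] by force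
  qed
  also have "\<dots> = c * pnorm e"
    using e poly_norm_eq[of N e] by (simp add: polys_below_def sum_distrib_left mult.commute)
  finally show ?thesis .
qed

lemma extend_linearly_mult:
  assumes e: "e \<in> carrier (UP R)" and u: "\<And>k. k < N \<Longrightarrow> u k \<in> carrier (UP R)" and p: "p \<in> carrier (UP R)"
  shows "extend_linearly N u e \<otimes>\<^bsub>UP R\<^esub> p = extend_linearly N (\<lambda>k. u k \<otimes>\<^bsub>UP R\<^esub> p) e"
proof -
  interpret P: cring "UP R" by (rule cring_UP)
  interpret U: UP_cring R "UP R" by unfold_locales simp
  show ?thesis unfolding extend_linearly_def
    using e u p by (subst P.finsum_ldistr) (auto simp: U.UP_smult_assoc2 intro!: P.finsum_cong')
qed

lemma extend_linearly_add:
  assumes e: "e \<in> carrier (UP R)" and u: "\<And>k. k < N \<Longrightarrow> u k \<in> carrier (UP R)"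
    and v: "\<And>k. k < N \<Longrightarrow> v k \<in> carrier (UP R)"
  shows "extend_linearly N u e \<oplus>\<^bsub>UP R\<^esub> extend_linearly N v e =
    extend_linearly N (\<lambda>k. u k \<oplus>\<^bsub>UP R\<^esub> v k) e"
proof -
  interpret P: cring "UP R" by (rule cring_UP)
  interpret U: UP_cring R "UP R" by unfold_locales simp
  have "extend_linearly N (\<lambda>k. u k \<oplus>\<^bsub>UP R\<^esub> v k) e =
      (\<Oplus>\<^bsub>UP R\<^esub>k\<in>{..<N}. e k \<odot>\<^bsub>UP R\<^esub> u k \<oplus>\<^bsub>UP R\<^esub> e k \<odot>\<^bsub>UP R\<^esub> v k)"
    unfolding extend_linearly_def using e u v
    by (intro P.finsum_cong') (auto simp: U.UP_smult_r_distr)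
  then show ?thesis unfolding extend_linearly_def using e u v by (simp add: P.finsum_addf Pi_iff)
qed

lemma extend_linearly_diff:
  assumes e: "e \<in> carrier (UP R)" and u: "\<And>k. k < N \<Longrightarrow> u k \<in> carrier (UP R)"
    and v: "\<And>k. k < N \<Longrightarrow> v k \<in> carrier (UP R)"
  shows "extend_linearly N u e \<ominus>\<^bsub>UP R\<^esub> extend_linearly N v e =
    extend_linearly N (\<lambda>k. u k \<ominus>\<^bsub>UP R\<^esub> v k) e"
proof -
  interpret P: cring "UP R" by (rule cring_UP)
  interpret U: UP_cring R "UP R" by unfold_locales simp
  have c: "extend_linearly N w e \<in> carrier (UP R)" if "\<And>k. k < N \<Longrightarrow> w k \<in> carrier (UP R)" for w
    unfolding extend_linearly_def using e that by (intro P.finsum_closed) auto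
  have "extend_linearly N (\<lambda>k. u k \<ominus>\<^bsub>UP R\<^esub> v k) e \<oplus>\<^bsub>UP R\<^esub> extend_linearly N v e =
    extend_linearly N (\<lambda>k. (u k \<ominus>\<^bsub>UP R\<^esub> v k) \<oplus>\<^bsub>UP R\<^esub> v k) e"
    using u v by (intro extend_linearly_add e) auto
  also have "\<dots> = extend_linearly N u e"
    unfolding extend_linearly_def
    using e u v by (intro P.finsum_cong') (auto simp: a_minus_def[of "UP R"] P.a_assoc P.l_neg)
  finally have *: "extend_linearly N u e =
    extend_linearly N (\<lambda>k. u k \<ominus>\<^bsub>UP R\<^esub> v k) e \<oplus>\<^bsub>UP R\<^esub> extend_linearly N v e" ..
  show ?thesis unfolding *
    using c[of v] c[of "\<lambda>k. u k \<ominus>\<^bsub>UP R\<^esub> v k"] u v by (simp add: a_minus_def[of "UP R"] P.a_assoc P.r_neg)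
qed

lemma extend_linearly_monom:
  assumes e: "e \<in> polys_below R N"
  shows "extend_linearly N (up_ring.monom (UP R) \<one>) e = e"
proof
  fix i
  interpret U: UP_cring R "UP R" by unfold_locales simp
  have ec: "e \<in> carrier (UP R)" using e polys_below_carrier by blast
  have "extend_linearly N (up_ring.monom (UP R) \<one>) e i = (\<Oplus>k\<in>{..<N}. if i = k then e k else \<zero>)"
    unfolding extend_linearly_def using ec
    by (subst UP_finsum_app) (auto intro!: finsum_cong')
  also have "\<dots> = e i"
  proof (cases "i < N")
    case True
    then show ?thesis using ec finsum_singleton[of i "{..<N}" e] by auto
  next
    case False
    then have "(\<Oplus>k\<in>{..<N}. if i = k then e k else \<zero>) = (\<Oplus>k\<in>{..<N}. \<zero>)"
      by (intro finsum_cong') auto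
    then show ?thesis using False e by (simp add: polys_below_def)
  qed
  finally show "extend_linearly N (up_ring.monom (UP R) \<one>) e i = e i" .
qed

end

context banach_ring
begin

text \<open>Limits of polynomials of bounded degree are taken coefficient by coefficient.\<close>

lemma polys_below_complete:
  assumes \<sigma>: "\<And>j. \<sigma> j \<in> polys_below A N"
    and step: "\<And>j::nat. pnorm (\<sigma> (Suc j) \<ominus>\<^bsub>UP A\<^esub> \<sigma> j) \<le> c * (1/2) ^ j"
  shows "\<exists>l\<in>polys_below A N. (\<lambda>j. pnorm (\<sigma> j \<ominus>\<^bsub>UP A\<^esub> l)) \<longlonglongrightarrow> 0"
proof -
  interpret P: normed_cring "UP A" pnorm by (rule normed_cring_UP)
  have \<sigma>c: "\<sigma> j \<in> carrier (UP A)" for j using \<sigma> polys_below_carrier by blast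
  have "\<exists>l\<in>carrier A. (\<lambda>j. nrm (\<sigma> j i \<ominus> l)) \<longlonglongrightarrow> 0" for i
  proof (rule complete)
    show "\<sigma> j i \<in> carrier A" for j using \<sigma>c by simp
    fix \<epsilon> :: real assume "\<epsilon> > 0"
    then obtain n where n: "\<And>j k. j \<ge> n \<Longrightarrow> k \<ge> n \<Longrightarrow> pnorm (\<sigma> j \<ominus>\<^bsub>UP A\<^esub> \<sigma> k) < \<epsilon>"
      using P.geometric_steps_Cauchy[OF \<sigma>c step] by blast
    have "nrm (\<sigma> j i \<ominus> \<sigma> k i) < \<epsilon>" if "j \<ge> n" "k \<ge> n" for j k
      using n[OF that] coeff_norm_le[of "\<sigma> j \<ominus>\<^bsub>UP A\<^esub> \<sigma> k" i] \<sigma>c by simp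
    then show "\<exists>N. \<forall>j\<ge>N. \<forall>k\<ge>N. nrm (\<sigma> j i \<ominus> \<sigma> k i) < \<epsilon>" by blast
  qed
  then obtain l where l: "\<And>i. l i \<in> carrier A" "\<And>i. (\<lambda>j. nrm (\<sigma> j i \<ominus> l i)) \<longlonglongrightarrow> 0"
    by metis
  have "l i = \<zero>" if "i \<ge> N" for i
  proof -
    have "(\<lambda>j. nrm (l i)) \<longlonglongrightarrow> 0"
      using l[of i] \<sigma> that norm_minus by (simp add: polys_below_def a_minus_def)
    then show ?thesis using l(1) norm_eq_0_iff by (simp add: LIMSEQ_const_iff)
  qed
  then have lB: "l \<in> polys_below A N" using l(1) by (simp add: polys_below_iff)
  have lc: "l \<in> carrier (UP A)" using lB polys_below_carrier by blast
  have "pnorm (\<sigma> j \<ominus>\<^bsub>UP A\<^esub> l) = (\<Sum>i<N. nrm (\<sigma> j i \<ominus> l i))" for j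
    using polys_below_diff[OF \<sigma> lB] \<sigma>c lc by (subst poly_norm_eq[of N]) (auto simp: polys_below_def)
  moreover have "(\<lambda>j. \<Sum>i<N. nrm (\<sigma> j i \<ominus> l i)) \<longlonglongrightarrow> (\<Sum>i<N. 0)"
    by (intro tendsto_sum l)
  ultimately show ?thesis using lB by (intro bexI[of _ l]) auto
qed

text \<open>A factorisation into coprime factors that holds up to a small error, with approximate
  Bezout relations for the powers of \<open>T\<close>, can be corrected to an exact one.\<close>

theorem factorization_near:
  fixes C \<eta> :: real
  assumes g: "g \<in> monics A (m + n)" and p: "p \<in> monics A m" and q: "q \<in> monics A n"
    and u: "\<And>k. k < m + n \<Longrightarrow> u k \<in> polys_below A m" "\<And>k. k < m + n \<Longrightarrow> pnorm (u k) \<le> C"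
    and v: "\<And>k. k < m + n \<Longrightarrow> v k \<in> polys_below A n" "\<And>k. k < m + n \<Longrightarrow> pnorm (v k) \<le> C"
    and uv: "\<And>k. k < m + n \<Longrightarrow>
      pnorm (u k \<otimes>\<^bsub>UP A\<^esub> q \<oplus>\<^bsub>UP A\<^esub> v k \<otimes>\<^bsub>UP A\<^esub> p \<ominus>\<^bsub>UP A\<^esub> up_ring.monom (UP A) \<one> k) \<le> 1 / 4"
    and start: "pnorm (g \<ominus>\<^bsub>UP A\<^esub> p \<otimes>\<^bsub>UP A\<^esub> q) \<le> \<eta>" and C: "1 \<le> C" and \<eta>: "20 * C\<^sup>2 * \<eta> \<le> 1"
  shows "\<exists>p'\<in>monics A m. \<exists>q'\<in>monics A n. p' \<otimes>\<^bsub>UP A\<^esub> q' = g \<and>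
    pnorm (p' \<ominus>\<^bsub>UP A\<^esub> p) \<le> 2 * C * \<eta> \<and> pnorm (q' \<ominus>\<^bsub>UP A\<^esub> q) \<le> 2 * C * \<eta>"
proof -
  interpret P: normed_cring "UP A" pnorm by (rule normed_cring_UP)
  interpret U: UP_cring A "UP A" by unfold_locales simp
  have pc: "p \<in> carrier (UP A)" "q \<in> carrier (UP A)" "g \<in> carrier (UP A)"
    using p q g monics_carrier by blast+
  have uc: "u k \<in> carrier (UP A)" "v k \<in> carrier (UP A)" if "k < m + n" for k
    using u(1)[OF that] v(1)[OF that] polys_below_carrier by blast+
  let ?S = "extend_linearly (m + n) u" and ?T = "extend_linearly (m + n) v"
  have "\<exists>x\<in>polys_below A m. \<exists>y\<in>polys_below A n.
      (p \<oplus>\<^bsub>UP A\<^esub> x) \<otimes>\<^bsub>UP A\<^esub> (q \<oplus>\<^bsub>UP A\<^esub> y) = g \<and> pnorm x \<le> 2 * C * \<eta> \<and> pnorm y \<le> 2 * C * \<eta>"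
  proof (rule P.newton_iteration[where E = "polys_below A (m + n)" and S = ?S and T = ?T, OF pc(3,1,2)])
    fix x y assume "x \<in> polys_below A m" "y \<in> polys_below A n"
    then show "g \<ominus>\<^bsub>UP A\<^esub> (p \<oplus>\<^bsub>UP A\<^esub> x) \<otimes>\<^bsub>UP A\<^esub> (q \<oplus>\<^bsub>UP A\<^esub> y) \<in> polys_below A (m + n)"
      using g p q by (intro monics_diff monics_mult monics_add)
  next
    fix e assume e: "e \<in> polys_below A (m + n)"
    then have ec: "e \<in> carrier (UP A)" using polys_below_carrier by blast
    show "?S e \<in> polys_below A m" "?T e \<in> polys_below A n"
      using extend_linearly_below[OF ec] u v by blast+
    show "pnorm (?S e) \<le> C * pnorm e" "pnorm (?T e) \<le> C * pnorm e"
      using extend_linearly_bound[OF e] uc u v by blast+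
    let ?w = "\<lambda>k. u k \<otimes>\<^bsub>UP A\<^esub> q \<oplus>\<^bsub>UP A\<^esub> v k \<otimes>\<^bsub>UP A\<^esub> p \<ominus>\<^bsub>UP A\<^esub> up_ring.monom (UP A) \<one> k"
    have "?S e \<otimes>\<^bsub>UP A\<^esub> q \<oplus>\<^bsub>UP A\<^esub> ?T e \<otimes>\<^bsub>UP A\<^esub> p =
        extend_linearly (m + n) (\<lambda>k. u k \<otimes>\<^bsub>UP A\<^esub> q \<oplus>\<^bsub>UP A\<^esub> v k \<otimes>\<^bsub>UP A\<^esub> p) e"
      using extend_linearly_mult[of e "m + n" u q, OF ec uc(1) pc(2)]
        extend_linearly_mult[of e "m + n" v p, OF ec uc(2) pc(1)] uc pc
      by (simp add: extend_linearly_add[OF ec])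
    moreover have "\<dots> \<ominus>\<^bsub>UP A\<^esub> extend_linearly (m + n) (up_ring.monom (UP A) \<one>) e = extend_linearly (m + n) ?w e"
      using uc pc by (intro extend_linearly_diff ec) auto
    ultimately have *: "?S e \<otimes>\<^bsub>UP A\<^esub> q \<oplus>\<^bsub>UP A\<^esub> ?T e \<otimes>\<^bsub>UP A\<^esub> p \<ominus>\<^bsub>UP A\<^esub> e = extend_linearly (m + n) ?w e"
      using extend_linearly_monom[OF e] by simp
    show "pnorm (?S e \<otimes>\<^bsub>UP A\<^esub> q \<oplus>\<^bsub>UP A\<^esub> ?T e \<otimes>\<^bsub>UP A\<^esub> p \<ominus>\<^bsub>UP A\<^esub> e) \<le> pnorm e / 4"
      unfolding * using extend_linearly_bound[OF e, of ?w "1/4"] uv uc pc by simp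
  qed (use polys_below_carrier polys_below_zero polys_below_add polys_below_complete start C \<eta> in blast)+
  then obtain x y where xy: "x \<in> polys_below A m" "y \<in> polys_below A n"
    "(p \<oplus>\<^bsub>UP A\<^esub> x) \<otimes>\<^bsub>UP A\<^esub> (q \<oplus>\<^bsub>UP A\<^esub> y) = g" "pnorm x \<le> 2 * C * \<eta>" "pnorm y \<le> 2 * C * \<eta>"
    by blast
  have xc: "x \<in> carrier (UP A)" "y \<in> carrier (UP A)" using xy polys_below_carrier by blast+
  have "(p \<oplus>\<^bsub>UP A\<^esub> x) \<ominus>\<^bsub>UP A\<^esub> p = x" "(q \<oplus>\<^bsub>UP A\<^esub> y) \<ominus>\<^bsub>UP A\<^esub> q = y"
    using pc xc by (simp_all add: P.add_diff_cancel_left)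
  then show ?thesis using xy monics_add[OF p xy(1)] monics_add[OF q xy(2)] by force
qed

end

lemma LIMSEQ_null_squeeze:
  fixes f g :: "nat \<Rightarrow> real"
  assumes "g \<longlonglongrightarrow> 0" "\<And>i. 0 \<le> f i" "\<And>i. f i \<le> g i"
  shows "f \<longlonglongrightarrow> 0"
  by (rule tendsto_sandwich[OF _ _ tendsto_const assms(1)]) (simp_all add: assms)

section \<open>Fraction fields\<close>

lemma UN_eq_singleton_value:
  assumes "P \<noteq> {}" "\<And>z. z \<in> P \<Longrightarrow> F z = D"
  shows "(\<Union>z\<in>P. F z) = D"
  using assms by auto

text \<open>Operations on fractions and on germs are unions over pairs of representatives, all of which
  contribute the same class.\<close>

lemma UN_pairs_eq_value:
  assumes "P \<noteq> {}" "Q \<noteq> {}"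
    and F: "\<And>a s c t. (a, s) \<in> P \<Longrightarrow> (c, t) \<in> Q \<Longrightarrow> F a s c t = D"
  shows "(\<Union>(a, s)\<in>P. \<Union>(c, t)\<in>Q. F a s c t) = D"
proof (rule UN_eq_singleton_value)
  fix z assume "z \<in> P"
  then obtain a s where z: "z = (a, s)" "(a, s) \<in> P" by (cases z) simp
  have "(\<Union>(c, t)\<in>Q. F a s c t) = D"
    using assms(2) F[OF z(2)] by (intro UN_eq_singleton_value) auto
  then show "(case z of (a, s) \<Rightarrow> \<Union>(c, t)\<in>Q. F a s c t) = D" using z by simp
qed (rule assms)

lemma the_elem_image_const:
  assumes "P \<noteq> {}" "\<And>z. z \<in> P \<Longrightarrow> F z = c"
  shows "the_elem (F ` P) = c"
proof -
  have "F ` P = {c}" using assms by auto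
  then show ?thesis by simp
qed

context domain
begin

lemma frac_class_memI:
  assumes "a \<in> carrier R" "s \<in> carrier R - {\<zero>}"
  shows "(a, s) \<in> frac_class R a s"
  using assms by (simp add: frac_class_def)

lemma frac_class_memD:
  assumes "(c, t) \<in> frac_class R a s"
  shows "c \<in> carrier R" "t \<in> carrier R - {\<zero>}" "a \<otimes> t = c \<otimes> s"
  using assms by (auto simp: frac_class_def)

lemma frac_class_subset:
  assumes "a \<in> carrier R" "s \<in> carrier R - {\<zero>}" "c \<in> carrier R" "t \<in> carrier R - {\<zero>}"
    and eq: "a \<otimes> t = c \<otimes> s"
  shows "frac_class R a s \<subseteq> frac_class R c t"
proof
  fix z assume "z \<in> frac_class R a s"
  then obtain d w where z: "z = (d, w)" "d \<in> carrier R" "w \<in> carrier R - {\<zero>}" "a \<otimes> w = d \<otimes> s"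
    by (auto simp: frac_class_def)
  have "s \<otimes> (c \<otimes> w) = (c \<otimes> s) \<otimes> w" using assms z by (simp add: m_ac)
  also have "\<dots> = (a \<otimes> w) \<otimes> t" unfolding eq[symmetric] using assms(1-4) z(2,3) by (simp add: m_ac)
  also have "\<dots> = s \<otimes> (d \<otimes> t)" unfolding z(4) using assms(1-4) z(2,3) by (simp add: m_ac)
  finally have "c \<otimes> w = d \<otimes> t" using assms z m_lcancel[of s "c \<otimes> w" "d \<otimes> t"] by simp
  then show "z \<in> frac_class R c t" using z by (simp add: frac_class_def)
qed

lemma frac_class_eq_iff:
  assumes "a \<in> carrier R" "s \<in> carrier R - {\<zero>}" "c \<in> carrier R" "t \<in> carrier R - {\<zero>}"
  shows "frac_class R a s = frac_class R c t \<longleftrightarrow> a \<otimes> t = c \<otimes> s"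
proof
  assume "frac_class R a s = frac_class R c t"
  then have "(c, t) \<in> frac_class R a s" using frac_class_memI assms by simp
  then show "a \<otimes> t = c \<otimes> s" by (rule frac_class_memD)
next
  assume "a \<otimes> t = c \<otimes> s"
  then show "frac_class R a s = frac_class R c t"
    using frac_class_subset[OF assms] frac_class_subset[OF assms(3,4,1,2)] by simp
qed

lemma frac_field_cases:
  assumes "P \<in> carrier (frac_field R)"
  obtains a s where "P = frac_class R a s" "a \<in> carrier R" "s \<in> carrier R" "s \<noteq> \<zero>"
  using assms by (auto simp: frac_field_def)

lemma frac_class_closed [simp]:
  "a \<in> carrier R \<Longrightarrow> s \<in> carrier R \<Longrightarrow> s \<noteq> \<zero> \<Longrightarrow> frac_class R a s \<in> carrier (frac_field R)"
  by (auto simp: frac_field_def)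

lemma frac_class_mult:
  assumes "a \<in> carrier R" "s \<in> carrier R" "s \<noteq> \<zero>" "c \<in> carrier R" "t \<in> carrier R" "t \<noteq> \<zero>"
  shows "frac_class R a s \<otimes>\<^bsub>frac_field R\<^esub> frac_class R c t = frac_class R (a \<otimes> c) (s \<otimes> t)"
proof -
  have "frac_class R (a' \<otimes> c') (s' \<otimes> t') = frac_class R (a \<otimes> c) (s \<otimes> t)"
    if "(a', s') \<in> frac_class R a s" "(c', t') \<in> frac_class R c t" for a' s' c' t'
  proof -
    note 1 = frac_class_memD[OF that(1)] and 2 = frac_class_memD[OF that(2)]
    have "(a' \<otimes> c') \<otimes> (s \<otimes> t) = (a' \<otimes> s) \<otimes> (c' \<otimes> t)" using assms 1 2 by (simp add: m_ac)
    also have "\<dots> = (a \<otimes> c) \<otimes> (s' \<otimes> t')"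
      unfolding 1(3)[symmetric] 2(3)[symmetric] using assms 1(1,2) 2(1,2) by (simp add: m_ac)
    finally show ?thesis using assms 1 2 by (subst frac_class_eq_iff) (auto simp: integral_iff)
  qed
  moreover have "frac_class R a s \<noteq> {}" "frac_class R c t \<noteq> {}"
    using frac_class_memI[of a s] frac_class_memI[of c t] assms by blast+
  ultimately show ?thesis
    by (subst frac_field_def, simp only: monoid.simps ring.simps) (rule UN_pairs_eq_value)
qed

lemma frac_class_add:
  assumes "a \<in> carrier R" "s \<in> carrier R" "s \<noteq> \<zero>" "c \<in> carrier R" "t \<in> carrier R" "t \<noteq> \<zero>"
  shows "frac_class R a s \<oplus>\<^bsub>frac_field R\<^esub> frac_class R c t = frac_class R (a \<otimes> t \<oplus> c \<otimes> s) (s \<otimes> t)"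
proof -
  have "frac_class R (a' \<otimes> t' \<oplus> c' \<otimes> s') (s' \<otimes> t') = frac_class R (a \<otimes> t \<oplus> c \<otimes> s) (s \<otimes> t)"
    if "(a', s') \<in> frac_class R a s" "(c', t') \<in> frac_class R c t" for a' s' c' t'
  proof -
    note 1 = frac_class_memD[OF that(1)] and 2 = frac_class_memD[OF that(2)]
    have "(a' \<otimes> t' \<oplus> c' \<otimes> s') \<otimes> (s \<otimes> t) = (a' \<otimes> s) \<otimes> (t \<otimes> t') \<oplus> (c' \<otimes> t) \<otimes> (s \<otimes> s')"
      using assms 1(1,2) 2(1,2) by (simp add: l_distr r_distr m_ac)
    also have "\<dots> = (a \<otimes> t \<oplus> c \<otimes> s) \<otimes> (s' \<otimes> t')"
      unfolding 1(3)[symmetric] 2(3)[symmetric] using assms 1(1,2) 2(1,2) by (simp add: l_distr r_distr m_ac)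
    finally show ?thesis using assms 1 2 by (subst frac_class_eq_iff) (auto simp: integral_iff)
  qed
  moreover have "frac_class R a s \<noteq> {}" "frac_class R c t \<noteq> {}"
    using frac_class_memI[of a s] frac_class_memI[of c t] assms by blast+
  ultimately show ?thesis
    by (subst frac_field_def, simp only: monoid.simps ring.simps) (rule UN_pairs_eq_value)
qed

lemma frac_field_one: "\<one>\<^bsub>frac_field R\<^esub> = frac_class R \<one> \<one>"
  and frac_field_zero: "\<zero>\<^bsub>frac_field R\<^esub> = frac_class R \<zero> \<one>"
  by (simp_all add: frac_field_def)

lemma frac_class_eq_zero_iff:
  assumes "a \<in> carrier R" "s \<in> carrier R" "s \<noteq> \<zero>"
  shows "frac_class R a s = \<zero>\<^bsub>frac_field R\<^esub> \<longleftrightarrow> a = \<zero>"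
  using assms by (simp add: frac_field_zero frac_class_eq_iff)

theorem field_frac_field: "field (frac_field R)"
proof -
  let ?F = "frac_field R"
  note ops = frac_class_mult frac_class_add frac_field_one frac_field_zero
    frac_class_eq_iff integral_iff
  have "abelian_group ?F"
  proof (rule abelian_groupI)
    fix x y z assume "x \<in> carrier ?F" "y \<in> carrier ?F" "z \<in> carrier ?F"
    then show "x \<oplus>\<^bsub>?F\<^esub> y \<oplus>\<^bsub>?F\<^esub> z = x \<oplus>\<^bsub>?F\<^esub> (y \<oplus>\<^bsub>?F\<^esub> z)"
      by (elim frac_field_cases) (simp add: ops l_distr r_distr m_ac a_ac)
  next
    fix x y assume xy: "x \<in> carrier ?F" "y \<in> carrier ?F"
    then show "x \<oplus>\<^bsub>?F\<^esub> y \<in> carrier ?F"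
      by (elim frac_field_cases) (simp add: ops)
    show "x \<oplus>\<^bsub>?F\<^esub> y = y \<oplus>\<^bsub>?F\<^esub> x"
      using xy by (elim frac_field_cases) (simp add: ops l_distr r_distr m_ac a_ac)
  next
    fix x assume "x \<in> carrier ?F"
    then obtain a s where x: "x = frac_class R a s" "a \<in> carrier R" "s \<in> carrier R" "s \<noteq> \<zero>"
      by (rule frac_field_cases)
    show "\<zero>\<^bsub>?F\<^esub> \<oplus>\<^bsub>?F\<^esub> x = x" using x by (simp add: ops m_ac)
    have "frac_class R (\<ominus> a) s \<oplus>\<^bsub>?F\<^esub> x = \<zero>\<^bsub>?F\<^esub>"
      using x by (simp add: ops l_minus l_neg)
    then show "\<exists>y\<in>carrier ?F. y \<oplus>\<^bsub>?F\<^esub> x = \<zero>\<^bsub>?F\<^esub>"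
      using x by (intro bexI[of _ "frac_class R (\<ominus> a) s"]) auto
  qed (simp add: ops)
  moreover have "comm_monoid ?F"
  proof (rule comm_monoidI)
    fix x y z assume "x \<in> carrier ?F" "y \<in> carrier ?F" "z \<in> carrier ?F"
    then show "x \<otimes>\<^bsub>?F\<^esub> y \<otimes>\<^bsub>?F\<^esub> z = x \<otimes>\<^bsub>?F\<^esub> (y \<otimes>\<^bsub>?F\<^esub> z)"
      by (elim frac_field_cases) (simp add: ops m_ac)
  next
    fix x y assume xy: "x \<in> carrier ?F" "y \<in> carrier ?F"
    then show "x \<otimes>\<^bsub>?F\<^esub> y \<in> carrier ?F"
      by (elim frac_field_cases) (simp add: ops)
    show "x \<otimes>\<^bsub>?F\<^esub> y = y \<otimes>\<^bsub>?F\<^esub> x"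
      using xy by (elim frac_field_cases) (simp add: ops m_ac)
  next
    fix x assume "x \<in> carrier ?F"
    then show "\<one>\<^bsub>?F\<^esub> \<otimes>\<^bsub>?F\<^esub> x = x"
      by (elim frac_field_cases) (simp add: ops m_ac)
  qed (simp add: ops)
  moreover have "(x \<oplus>\<^bsub>?F\<^esub> y) \<otimes>\<^bsub>?F\<^esub> z = x \<otimes>\<^bsub>?F\<^esub> z \<oplus>\<^bsub>?F\<^esub> y \<otimes>\<^bsub>?F\<^esub> z"
    if "x \<in> carrier ?F" "y \<in> carrier ?F" "z \<in> carrier ?F" for x y z
    using that by (elim frac_field_cases) (simp add: ops l_distr r_distr m_ac a_ac)
  ultimately interpret F: cring ?F by (rule cringI)
  show ?thesis
  proof (rule F.cring_fieldI2)
    show "\<zero>\<^bsub>?F\<^esub> \<noteq> \<one>\<^bsub>?F\<^esub>" by (simp add: ops)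
    fix x assume "x \<in> carrier ?F" and nz: "x \<noteq> \<zero>\<^bsub>?F\<^esub>"
    then obtain a s where x: "x = frac_class R a s" "a \<in> carrier R" "s \<in> carrier R" "s \<noteq> \<zero>"
      by (elim frac_field_cases)
    then have "a \<noteq> \<zero>" using nz frac_class_eq_zero_iff by blast
    then show "\<exists>y\<in>carrier ?F. x \<otimes>\<^bsub>?F\<^esub> y = \<one>\<^bsub>?F\<^esub>"
      using x by (intro bexI[of _ "frac_class R s a"]) (simp_all add: ops m_ac)
  qed
qed

end

section \<open>Completion of a valued field\<close>

locale valued_field = field K for K (structure) +
  fixes v :: "'a \<Rightarrow> real"
  assumes v_nonneg: "a \<in> carrier K \<Longrightarrow> 0 \<le> v a"
    and v_eq_0_iff: "a \<in> carrier K \<Longrightarrow> v a = 0 \<longleftrightarrow> a = \<zero>"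
    and v_mult: "a \<in> carrier K \<Longrightarrow> c \<in> carrier K \<Longrightarrow> v (a \<otimes> c) = v a * v c"
    and v_triangle: "a \<in> carrier K \<Longrightarrow> c \<in> carrier K \<Longrightarrow> v (a \<oplus> c) \<le> v a + v c"
begin

lemma v_one: "v \<one> = 1"
  using v_mult[of \<one> \<one>] v_eq_0_iff[of \<one>] by simp

lemma v_minus: "a \<in> carrier K \<Longrightarrow> v (\<ominus> a) = v a"
proof -
  have "v (\<ominus> \<one>) * v (\<ominus> \<one>) = 1"
    using v_mult[of "\<ominus> \<one>" "\<ominus> \<one>"] by (simp add: l_minus v_one)
  then have "v (\<ominus> \<one>) = 1"
    using v_nonneg[of "\<ominus> \<one>"] by (simp add: square_eq_1_iff)
  then show "a \<in> carrier K \<Longrightarrow> v (\<ominus> a) = v a"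
    using v_mult[of "\<ominus> \<one>" a] by (simp add: l_minus)
qed

end

sublocale valued_field \<subseteq> normed_cring K v
  by unfold_locales (simp_all add: v_nonneg v_eq_0_iff v_mult v_triangle v_minus)

context valued_field
begin

abbreviation CR where "CR \<equiv> cauchy_ring K v"
abbreviation NS where "NS \<equiv> null_seqs K v"

lemma CR_carrier:
  "\<sigma> \<in> carrier CR \<longleftrightarrow> (\<forall>i. \<sigma> i \<in> carrier K) \<and> (\<forall>\<epsilon>>0. \<exists>N. \<forall>i\<ge>N. \<forall>j\<ge>N. v (\<sigma> i \<ominus> \<sigma> j) < \<epsilon>)"
  by (simp add: cauchy_ring_def)

lemma CR_ops [simp]:
  "(\<sigma> \<otimes>\<^bsub>CR\<^esub> \<tau>) = (\<lambda>i. \<sigma> i \<otimes> \<tau> i)" "(\<sigma> \<oplus>\<^bsub>CR\<^esub> \<tau>) = (\<lambda>i. \<sigma> i \<oplus> \<tau> i)"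
  "\<one>\<^bsub>CR\<^esub> = (\<lambda>i. \<one>)" "\<zero>\<^bsub>CR\<^esub> = (\<lambda>i. \<zero>)"
  by (simp_all add: cauchy_ring_def)

lemma CR_closed [simp]: "\<sigma> \<in> carrier CR \<Longrightarrow> \<sigma> i \<in> carrier K"
  by (simp add: CR_carrier)

lemma CR_const [simp]: "a \<in> carrier K \<Longrightarrow> (\<lambda>i. a) \<in> carrier CR"
  by (auto simp: CR_carrier a_minus_def r_neg)

lemma CR_convergent:
  assumes "\<sigma> \<in> carrier CR"
  shows "convergent (\<lambda>i. v (\<sigma> i))"
proof -
  have "Cauchy (\<lambda>i. v (\<sigma> i))"
  proof (rule metric_CauchyI)
    fix \<epsilon> :: real assume "\<epsilon> > 0"
    then obtain N where N: "\<forall>i\<ge>N. \<forall>j\<ge>N. v (\<sigma> i \<ominus> \<sigma> j) < \<epsilon>" using assms by (auto simp: CR_carrier)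
    have "dist (v (\<sigma> i)) (v (\<sigma> j)) \<le> v (\<sigma> i \<ominus> \<sigma> j)" for i j
      using norm_reverse_triangle[of "\<sigma> i" "\<sigma> j"] assms by (simp add: dist_real_def)
    then show "\<exists>N. \<forall>i\<ge>N. \<forall>j\<ge>N. dist (v (\<sigma> i)) (v (\<sigma> j)) < \<epsilon>" using N by (meson le_less_trans)
  qed
  then show ?thesis by (rule Cauchy_convergent)
qed

lemma CR_bounded:
  assumes "\<sigma> \<in> carrier CR"
  obtains M where "M > 0" "\<And>i. v (\<sigma> i) \<le> M"
proof -
  have "Bseq (\<lambda>i. v (\<sigma> i))" using CR_convergent[OF assms] by (rule convergent_imp_Bseq)
  then obtain M where "M > 0" "\<And>i. \<bar>v (\<sigma> i)\<bar> \<le> M" by (auto simp: Bseq_def)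
  then show ?thesis using that[of M] abs_le_D1 by blast
qed

lemma CR_add_closed:
  assumes "\<sigma> \<in> carrier CR" "\<tau> \<in> carrier CR"
  shows "(\<lambda>i. \<sigma> i \<oplus> \<tau> i) \<in> carrier CR"
proof -
  have "\<exists>N. \<forall>i\<ge>N. \<forall>j\<ge>N. v ((\<sigma> i \<oplus> \<tau> i) \<ominus> (\<sigma> j \<oplus> \<tau> j)) < \<epsilon>" if "\<epsilon> > 0" for \<epsilon>
  proof -
    obtain N where N: "\<forall>i\<ge>N. \<forall>j\<ge>N. v (\<sigma> i \<ominus> \<sigma> j) < \<epsilon> / 2"
      using assms(1) \<open>\<epsilon> > 0\<close> unfolding CR_carrier by (meson half_gt_zero)
    obtain N' where N': "\<forall>i\<ge>N'. \<forall>j\<ge>N'. v (\<tau> i \<ominus> \<tau> j) < \<epsilon> / 2"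
      using assms(2) \<open>\<epsilon> > 0\<close> unfolding CR_carrier by (meson half_gt_zero)
    have "v ((\<sigma> i \<oplus> \<tau> i) \<ominus> (\<sigma> j \<oplus> \<tau> j)) < \<epsilon>" if "i \<ge> max N N'" "j \<ge> max N N'" for i j
    proof -
      have "(\<sigma> i \<oplus> \<tau> i) \<ominus> (\<sigma> j \<oplus> \<tau> j) = (\<sigma> i \<ominus> \<sigma> j) \<oplus> (\<tau> i \<ominus> \<tau> j)"
        using assms by (simp add: a_minus_def minus_add a_ac)
      then have "v ((\<sigma> i \<oplus> \<tau> i) \<ominus> (\<sigma> j \<oplus> \<tau> j)) \<le> v (\<sigma> i \<ominus> \<sigma> j) + v (\<tau> i \<ominus> \<tau> j)"
        using assms by (simp add: v_triangle)
      then show ?thesis using N N' that by (smt (verit, best) field_sum_of_halves max.bounded_iff)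
    qed
    then show ?thesis by blast
  qed
  then show ?thesis using assms by (simp add: CR_carrier)
qed

lemma CR_mult_closed:
  assumes "\<sigma> \<in> carrier CR" "\<tau> \<in> carrier CR"
  shows "(\<lambda>i. \<sigma> i \<otimes> \<tau> i) \<in> carrier CR"
proof -
  obtain M where M: "M > 0" "\<And>i. v (\<sigma> i) \<le> M" using CR_bounded[OF assms(1)] by blast
  obtain M' where M': "M' > 0" "\<And>i. v (\<tau> i) \<le> M'" using CR_bounded[OF assms(2)] by blast
  have "\<exists>N. \<forall>i\<ge>N. \<forall>j\<ge>N. v (\<sigma> i \<otimes> \<tau> i \<ominus> \<sigma> j \<otimes> \<tau> j) < \<epsilon>" if "\<epsilon> > 0" for \<epsilon>
  proof -
    obtain N where N: "\<forall>i\<ge>N. \<forall>j\<ge>N. v (\<sigma> i \<ominus> \<sigma> j) < \<epsilon> / (2 * M')"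
      using assms(1) \<open>\<epsilon> > 0\<close> M' unfolding CR_carrier by (metis divide_pos_pos zero_less_mult_iff zero_less_numeral)
    obtain N' where N': "\<forall>i\<ge>N'. \<forall>j\<ge>N'. v (\<tau> i \<ominus> \<tau> j) < \<epsilon> / (2 * M)"
      using assms(2) \<open>\<epsilon> > 0\<close> M unfolding CR_carrier by (metis divide_pos_pos zero_less_mult_iff zero_less_numeral)
    have "v (\<sigma> i \<otimes> \<tau> i \<ominus> \<sigma> j \<otimes> \<tau> j) < \<epsilon>" if "i \<ge> max N N'" "j \<ge> max N N'" for i j
    proof -
      have 1: "v (\<sigma> i \<ominus> \<sigma> j) < \<epsilon> / (2 * M')" "v (\<tau> i \<ominus> \<tau> j) < \<epsilon> / (2 * M)" using N N' that by auto
      have "v (\<sigma> i \<otimes> \<tau> i \<ominus> \<sigma> j \<otimes> \<tau> j) \<le> v (\<sigma> i \<ominus> \<sigma> j) * v (\<tau> i) + v (\<sigma> j) * v (\<tau> i \<ominus> \<tau> j)"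
        using assms by (intro norm_product_diff) auto
      also have "\<dots> \<le> v (\<sigma> i \<ominus> \<sigma> j) * M' + M * v (\<tau> i \<ominus> \<tau> j)"
        using M M' assms by (intro add_mono mult_left_mono mult_right_mono v_nonneg) auto
      also have "\<dots> < \<epsilon> / (2 * M') * M' + M * (\<epsilon> / (2 * M))"
        using 1 M M' by (intro add_strict_mono mult_strict_right_mono mult_strict_left_mono) auto
      also have "\<dots> = \<epsilon>" using M M' by (simp add: field_simps)
      finally show ?thesis .
    qed
    then show ?thesis by blast
  qed
  then show ?thesis using assms by (simp add: CR_carrier)
qed

lemma CR_minus_closed:
  assumes "\<sigma> \<in> carrier CR"
  shows "(\<lambda>i. \<ominus> \<sigma> i) \<in> carrier CR"
  using CR_mult_closed[OF CR_const[of "\<ominus> \<one>"] assms] assms by (simp add: l_minus)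

lemma cring_CR: "cring CR"
proof (rule cringI)
  show "abelian_group CR"
  proof (rule abelian_groupI)
    fix \<sigma> assume \<sigma>: "\<sigma> \<in> carrier CR"
    then show "\<exists>\<tau>\<in>carrier CR. \<tau> \<oplus>\<^bsub>CR\<^esub> \<sigma> = \<zero>\<^bsub>CR\<^esub>"
      by (intro bexI[OF _ CR_minus_closed[OF \<sigma>]]) (auto simp: l_neg)
  qed (auto simp: CR_add_closed a_ac)
  show "comm_monoid CR"
    by (rule comm_monoidI) (auto simp: CR_mult_closed m_ac)
qed (auto simp: l_distr)

lemma CR_a_inv:
  assumes "\<sigma> \<in> carrier CR"
  shows "\<ominus>\<^bsub>CR\<^esub> \<sigma> = (\<lambda>i. \<ominus> \<sigma> i)"
proof -
  interpret C: cring CR by (rule cring_CR)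
  have "\<sigma> \<oplus>\<^bsub>CR\<^esub> (\<lambda>i. \<ominus> \<sigma> i) = \<zero>\<^bsub>CR\<^esub>" using assms by (simp add: r_neg)
  then show ?thesis using assms CR_minus_closed by (metis C.minus_equality C.a_comm)
qed

lemma NS_subset: "NS \<subseteq> carrier CR"
proof
  fix \<sigma> assume "\<sigma> \<in> NS"
  then have c: "\<And>i. \<sigma> i \<in> carrier K" and l: "(\<lambda>i. v (\<sigma> i)) \<longlonglongrightarrow> 0" by (auto simp: null_seqs_def)
  have "\<exists>N. \<forall>i\<ge>N. \<forall>j\<ge>N. v (\<sigma> i \<ominus> \<sigma> j) < \<epsilon>" if "\<epsilon> > 0" for \<epsilon>
  proof -
    obtain N where N: "\<forall>i\<ge>N. v (\<sigma> i) < \<epsilon> / 2"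
      using order_tendstoD(2)[OF l, of "\<epsilon> / 2"] \<open>\<epsilon> > 0\<close> by (auto simp: eventually_sequentially)
    have "v (\<sigma> i \<ominus> \<sigma> j) < \<epsilon>" if "i \<ge> N" "j \<ge> N" for i j
      using norm_diff_triangle[of "\<sigma> i" "\<sigma> j"] c N[rule_format, OF that(1)] N[rule_format, OF that(2)] by simp
    then show ?thesis by blast
  qed
  then show "\<sigma> \<in> carrier CR" using c by (simp add: CR_carrier)
qed

lemma ideal_NS: "ideal NS CR"
proof (rule idealI)
  interpret C: cring CR by (rule cring_CR)
  show "ring CR" by (rule C.ring_axioms)
  show "subgroup NS (add_monoid CR)"
  proof (rule group.subgroupI)
    show "group (add_monoid CR)" by (rule C.add.group_axioms)
    show "NS \<subseteq> carrier (add_monoid CR)" using NS_subset by simp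
    show "NS \<noteq> {}" by (auto simp: null_seqs_def intro!: exI[of _ "\<lambda>i. \<zero>"])
  next
    fix \<sigma> assume s: "\<sigma> \<in> NS"
    then have "\<sigma> \<in> carrier CR" using NS_subset by blast
    then show "inv\<^bsub>add_monoid CR\<^esub> \<sigma> \<in> NS"
      using s CR_a_inv[of \<sigma>] unfolding a_inv_def[symmetric] by (simp add: null_seqs_def v_minus)
  next
    fix \<sigma> \<tau> assume s: "\<sigma> \<in> NS" "\<tau> \<in> NS"
    then have "(\<lambda>i. v (\<sigma> i) + v (\<tau> i)) \<longlonglongrightarrow> 0 + 0" by (intro tendsto_add) (auto simp: null_seqs_def)
    then have "(\<lambda>i. v (\<sigma> i) + v (\<tau> i)) \<longlonglongrightarrow> 0" by simp
    then have "(\<lambda>i. v (\<sigma> i \<oplus> \<tau> i)) \<longlonglongrightarrow> 0"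
      by (rule LIMSEQ_null_squeeze) (use s in \<open>auto simp: null_seqs_def v_nonneg v_triangle\<close>)
    then show "\<sigma> \<otimes>\<^bsub>add_monoid CR\<^esub> \<tau> \<in> NS" using s by (simp add: null_seqs_def)
  qed
  have "(\<lambda>i. \<sigma> i \<otimes> \<tau> i) \<in> NS" if st: "\<sigma> \<in> NS" "\<tau> \<in> carrier CR" for \<sigma> \<tau>
  proof -
    obtain M where M: "M > 0" "\<And>i. v (\<tau> i) \<le> M" using CR_bounded[OF st(2)] by blast
    have "(\<lambda>i. v (\<sigma> i) * M) \<longlonglongrightarrow> 0 * M" using st by (intro tendsto_intros) (auto simp: null_seqs_def)
    then have "(\<lambda>i. v (\<sigma> i) * M) \<longlonglongrightarrow> 0" by simp
    then have "(\<lambda>i. v (\<sigma> i \<otimes> \<tau> i)) \<longlonglongrightarrow> 0"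
      by (rule LIMSEQ_null_squeeze) (use st M in \<open>auto simp: null_seqs_def v_nonneg v_mult intro!: mult_left_mono\<close>)
    then show ?thesis using st by (simp add: null_seqs_def)
  qed
  then have r: "\<sigma> \<otimes>\<^bsub>CR\<^esub> \<tau> \<in> NS" if "\<sigma> \<in> NS" "\<tau> \<in> carrier CR" for \<sigma> \<tau>
    using that by simp
  then show "\<sigma> \<otimes>\<^bsub>CR\<^esub> \<tau> \<in> NS" if "\<sigma> \<in> NS" "\<tau> \<in> carrier CR" for \<sigma> \<tau>
    using that .
  show "\<tau> \<otimes>\<^bsub>CR\<^esub> \<sigma> \<in> NS" if "\<sigma> \<in> NS" "\<tau> \<in> carrier CR" for \<sigma> \<tau>
    using r[OF that] C.m_comm[OF subsetD[OF NS_subset that(1)] that(2)] by metis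
qed

abbreviation KC where "KC \<equiv> completion K v"
abbreviation cls where "cls \<sigma> \<equiv> NS +>\<^bsub>CR\<^esub> \<sigma>"

lemma completion_cases:
  assumes "x \<in> carrier KC"
  obtains \<sigma> where "\<sigma> \<in> carrier CR" "x = cls \<sigma>"
  using assms unfolding completion_def FactRing_simps by auto

lemma cls_hom: "cls \<in> ring_hom CR KC"
  unfolding completion_def by (rule ideal.rcos_ring_hom) (rule ideal_NS)

lemma cring_KC: "cring KC"
  unfolding completion_def by (rule ideal.quotient_is_cring[OF ideal_NS cring_CR])

text \<open>Representatives of a class differ by a null sequence, so their absolute values have the same limit.\<close>

lemma completion_abs_cls:
  assumes \<sigma>: "\<sigma> \<in> carrier CR"
  shows "(\<lambda>i. v (\<sigma> i)) \<longlonglongrightarrow> completion_abs v (cls \<sigma>)"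
proof -
  obtain L where L: "(\<lambda>i. v (\<sigma> i)) \<longlonglongrightarrow> L" using CR_convergent[OF \<sigma>] by (auto simp: convergent_def)
  have "completion_abs v (cls \<sigma>) = L" unfolding completion_abs_def
  proof (rule the_elem_image_const)
    show "cls \<sigma> \<noteq> {}" using abelian_subgroup.a_rcos_self[of NS CR \<sigma>] \<sigma> ideal_NS cring_CR
      by (metis abelian_subgroupI3 cring.axioms(1) empty_iff ideal.axioms(1) ring_def)
    fix \<tau> assume "\<tau> \<in> cls \<sigma>"
    then obtain h where h: "h \<in> NS" "\<tau> = (\<lambda>i. h i \<oplus> \<sigma> i)" by (auto simp: a_r_coset_def' )
    have hc: "h i \<in> carrier K" for i using h by (simp add: null_seqs_def)
    have b: "\<bar>v (\<tau> i) - v (\<sigma> i)\<bar> \<le> v (h i)" for i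
    proof -
      have "\<tau> i \<ominus> \<sigma> i = h i" using h hc \<sigma> by (simp add: a_minus_def a_assoc r_neg)
      then show ?thesis using norm_reverse_triangle[of "\<tau> i" "\<sigma> i"] h hc \<sigma> by simp
    qed
    have "(\<lambda>i. v (h i)) \<longlonglongrightarrow> 0" using h(1) by (simp add: null_seqs_def)
    then have "(\<lambda>i. \<bar>v (\<tau> i) - v (\<sigma> i)\<bar>) \<longlonglongrightarrow> 0"
      by (rule LIMSEQ_null_squeeze[OF _ abs_ge_zero b])
    then have "(\<lambda>i. v (\<tau> i) - v (\<sigma> i)) \<longlonglongrightarrow> 0" by (rule tendsto_rabs_zero_cancel)
    from tendsto_add[OF this L] show "lim (\<lambda>i. v (\<tau> i)) = L" by (simp add: limI)
  qed
  then show ?thesis using L by simp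
qed

lemma cls_eq_zero_iff:
  assumes "\<sigma> \<in> carrier CR"
  shows "cls \<sigma> = \<zero>\<^bsub>KC\<^esub> \<longleftrightarrow> \<sigma> \<in> NS"
proof -
  interpret I: ideal NS CR by (rule ideal_NS)
  have "\<zero>\<^bsub>KC\<^esub> = NS" by (simp add: completion_def FactRing_def)
  then show ?thesis using assms I.a_rcos_const I.a_rcos_self by blast
qed

lemma completion_abs_eq_zero_iff:
  assumes "x \<in> carrier KC"
  shows "completion_abs v x = 0 \<longleftrightarrow> x = \<zero>\<^bsub>KC\<^esub>"
proof -
  obtain \<sigma> where \<sigma>: "\<sigma> \<in> carrier CR" "x = cls \<sigma>" using completion_cases[OF assms] by blast
  then have "x = \<zero>\<^bsub>KC\<^esub> \<longleftrightarrow> (\<lambda>i. v (\<sigma> i)) \<longlonglongrightarrow> 0" using cls_eq_zero_iff by (simp add: null_seqs_def)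
  also have "\<dots> \<longleftrightarrow> completion_abs v x = 0"
    using completion_abs_cls[OF \<sigma>(1)] \<sigma>(2) LIMSEQ_unique by metis
  finally show ?thesis by blast
qed

text \<open>A Cauchy sequence that is not null stays away from zero from some index on, and can be inverted
  termwise from there; changing finitely many terms keeps the class.\<close>

lemma cls_nonzero_inverse:
  assumes \<sigma>: "\<sigma> \<in> carrier CR" and nz: "\<sigma> \<notin> NS"
  shows "\<exists>\<tau>\<in>carrier CR. cls \<sigma> \<otimes>\<^bsub>KC\<^esub> cls \<tau> = \<one>\<^bsub>KC\<^esub>"
proof -
  interpret C: cring CR by (rule cring_CR)
  interpret Q: cring KC by (rule cring_KC)
  define L where "L = completion_abs v (cls \<sigma>)"
  have lim: "(\<lambda>i. v (\<sigma> i)) \<longlonglongrightarrow> L" using completion_abs_cls[OF \<sigma>] by (simp add: L_def)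
  have "L \<noteq> 0" using lim nz \<sigma> by (auto simp: null_seqs_def)
  moreover have "0 \<le> L" by (rule LIMSEQ_le_const[OF lim]) (use \<sigma> v_nonneg in auto)
  ultimately have L: "0 < L" by simp
  then obtain N where N: "\<And>i. i \<ge> N \<Longrightarrow> v (\<sigma> i) > L / 2"
    using order_tendstoD(1)[OF lim, of "L / 2"] by (auto simp: eventually_sequentially)
  define \<tau> where "\<tau> i = (if i < N then \<one> else inv (\<sigma> i))" for i
  have inv: "\<sigma> i \<in> Units K" if "i \<ge> N" for i
  proof -
    have "v (\<sigma> i) \<noteq> 0" using N[OF that] L by simp
    then show ?thesis using \<sigma> v_eq_0_iff field_Units by auto
  qed
  have \<tau>c: "\<tau> i \<in> carrier K" for i using inv by (auto simp: \<tau>_def)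
  have \<tau>\<sigma>: "\<sigma> i \<otimes> \<tau> i = \<one>" if "i \<ge> N" for i using inv that by (simp add: \<tau>_def Units_r_inv)
  have v\<tau>: "v (\<sigma> i) * v (\<tau> i) = 1" if "i \<ge> N" for i
    using v_mult[of "\<sigma> i" "\<tau> i"] \<tau>\<sigma>[OF that] \<sigma> \<tau>c by (simp add: v_one)
  have bd: "v (\<tau> i) \<le> 2 / L" if "i \<ge> N" for i
  proof -
    have "L / 2 * v (\<tau> i) \<le> v (\<sigma> i) * v (\<tau> i)" using N[OF that] v_nonneg[OF \<tau>c[of i]] by (intro mult_right_mono) auto
    then show ?thesis using v\<tau>[OF that] L by (simp add: field_simps)
  qed
  have "\<exists>M. \<forall>i\<ge>M. \<forall>j\<ge>M. v (\<tau> i \<ominus> \<tau> j) < \<epsilon>" if "\<epsilon> > 0" for \<epsilon>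
  proof -
    have "\<epsilon> * (L / 2)\<^sup>2 > 0" using that L by simp
    then obtain M where M: "\<And>i j. i \<ge> M \<Longrightarrow> j \<ge> M \<Longrightarrow> v (\<sigma> i \<ominus> \<sigma> j) < \<epsilon> * (L / 2)\<^sup>2"
      using \<sigma> unfolding CR_carrier by blast
    have "v (\<tau> i \<ominus> \<tau> j) < \<epsilon>" if ij: "i \<ge> max M N" "j \<ge> max M N" for i j
    proof -
      have "\<tau> i \<ominus> \<tau> j = \<tau> i \<otimes> (\<sigma> j \<otimes> \<tau> j) \<ominus> (\<sigma> i \<otimes> \<tau> i) \<otimes> \<tau> j"
        using \<tau>\<sigma> ij \<tau>c by simp
      also have "\<dots> = (\<tau> i \<otimes> \<tau> j) \<otimes> (\<sigma> j \<ominus> \<sigma> i)"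
        using \<tau>c \<sigma> by (simp add: a_minus_def r_distr r_minus m_ac)
      finally have "v (\<tau> i \<ominus> \<tau> j) = v (\<tau> i) * v (\<tau> j) * v (\<sigma> j \<ominus> \<sigma> i)"
        using \<tau>c \<sigma> by (simp add: v_mult)
      also have "\<dots> \<le> (2 / L) * (2 / L) * v (\<sigma> j \<ominus> \<sigma> i)"
        using bd ij \<tau>c \<sigma> L by (intro mult_right_mono mult_mono v_nonneg) auto
      also have "\<dots> < (2 / L) * (2 / L) * (\<epsilon> * (L / 2)\<^sup>2)"
        using M ij L by (intro mult_strict_left_mono) auto
      also have "\<dots> = \<epsilon>" using L by (simp add: power2_eq_square)
      finally show ?thesis .
    qed
    then show ?thesis by blast
  qed
  then have \<tau>: "\<tau> \<in> carrier CR" using \<tau>c by (simp add: CR_carrier)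
  have "(\<lambda>i. v (\<sigma> i \<otimes> \<tau> i \<ominus> \<one>)) \<longlonglongrightarrow> 0"
    by (rule tendsto_eventually) (auto simp: eventually_sequentially \<tau>\<sigma> a_minus_def r_neg intro!: exI[of _ N])
  then have "\<sigma> \<otimes>\<^bsub>CR\<^esub> \<tau> \<ominus>\<^bsub>CR\<^esub> \<one>\<^bsub>CR\<^esub> \<in> NS"
    using \<sigma> \<tau>c by (simp add: a_minus_def[of CR] CR_a_inv null_seqs_def a_minus_def[symmetric]
      CR_a_inv[OF CR_const[OF one_closed]])
  moreover have "\<sigma> \<otimes>\<^bsub>CR\<^esub> \<tau> \<in> carrier CR" using \<sigma> \<tau> by (rule C.m_closed)
  ultimately have "cls (\<sigma> \<otimes>\<^bsub>CR\<^esub> \<tau>) = cls \<one>\<^bsub>CR\<^esub>"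
    using C.quotient_eq_iff_same_a_r_cos[OF ideal_NS] C.one_closed by blast
  then show ?thesis using \<tau> \<sigma> ring_hom_mult[OF cls_hom] ring_hom_one[OF cls_hom] by metis
qed

theorem valued_field_KC: "valued_field KC (completion_abs v)"
proof -
  interpret C: cring CR by (rule cring_CR)
  interpret Q: cring KC by (rule cring_KC)
  have f: "field KC"
  proof (rule Q.cring_fieldI2)
    have "\<one>\<^bsub>CR\<^esub> \<notin> NS" by (auto simp: null_seqs_def v_one LIMSEQ_const_iff)
    then show "\<zero>\<^bsub>KC\<^esub> \<noteq> \<one>\<^bsub>KC\<^esub>"
      using cls_eq_zero_iff[OF C.one_closed] ring_hom_one[OF cls_hom] by metis
    fix x assume x: "x \<in> carrier KC" "x \<noteq> \<zero>\<^bsub>KC\<^esub>"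
    then obtain \<sigma> where \<sigma>: "\<sigma> \<in> carrier CR" "x = cls \<sigma>" using completion_cases by blast
    then have "\<sigma> \<notin> NS" using x cls_eq_zero_iff by blast
    then show "\<exists>y\<in>carrier KC. x \<otimes>\<^bsub>KC\<^esub> y = \<one>\<^bsub>KC\<^esub>"
      using cls_nonzero_inverse[OF \<sigma>(1)] \<sigma> ring_hom_closed[OF cls_hom] by blast
  qed
  show ?thesis
  proof (rule valued_field.intro[OF f], unfold_locales)
    fix x y assume x: "x \<in> carrier KC"
    then obtain \<sigma> where \<sigma>: "\<sigma> \<in> carrier CR" "x = cls \<sigma>" using completion_cases by blast
    note l\<sigma> = completion_abs_cls[OF \<sigma>(1), folded \<sigma>(2)]
    show "0 \<le> completion_abs v x"
      by (rule LIMSEQ_le_const[OF l\<sigma>]) (use \<sigma> v_nonneg in auto)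
    show "completion_abs v x = 0 \<longleftrightarrow> x = \<zero>\<^bsub>KC\<^esub>" using x by (rule completion_abs_eq_zero_iff)
    assume "y \<in> carrier KC"
    then obtain \<tau> where \<tau>: "\<tau> \<in> carrier CR" "y = cls \<tau>" using completion_cases by blast
    note l\<tau> = completion_abs_cls[OF \<tau>(1), folded \<tau>(2)]
    have m: "x \<otimes>\<^bsub>KC\<^esub> y = cls (\<lambda>i. \<sigma> i \<otimes> \<tau> i)" using ring_hom_mult[OF cls_hom \<sigma>(1) \<tau>(1)] \<sigma> \<tau> by simp
    have a: "x \<oplus>\<^bsub>KC\<^esub> y = cls (\<lambda>i. \<sigma> i \<oplus> \<tau> i)" using ring_hom_add[OF cls_hom \<sigma>(1) \<tau>(1)] \<sigma> \<tau> by simp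
    have "(\<lambda>i. v (\<sigma> i \<otimes> \<tau> i)) \<longlonglongrightarrow> completion_abs v x * completion_abs v y"
      using tendsto_mult[OF l\<sigma> l\<tau>] \<sigma> \<tau> by (simp add: v_mult)
    then show "completion_abs v (x \<otimes>\<^bsub>KC\<^esub> y) = completion_abs v x * completion_abs v y"
      using completion_abs_cls[OF CR_mult_closed[OF \<sigma>(1) \<tau>(1)]] m LIMSEQ_unique by metis
    have "(\<lambda>i. v (\<sigma> i \<oplus> \<tau> i)) \<longlonglongrightarrow> completion_abs v (x \<oplus>\<^bsub>KC\<^esub> y)"
      using completion_abs_cls[OF CR_add_closed[OF \<sigma>(1) \<tau>(1)]] a by simp
    from LIMSEQ_le[OF this tendsto_add[OF l\<sigma> l\<tau>]] show
      "completion_abs v (x \<oplus>\<^bsub>KC\<^esub> y) \<le> completion_abs v x + completion_abs v y"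
      using \<sigma> \<tau> v_triangle by auto
  qed
qed

lemma completion_of_hom: "completion_of K v \<in> ring_hom K KC"
proof -
  have "(\<lambda>c i. c) \<in> ring_hom K CR" by (rule ring_hom_memI) auto
  from ring_hom_trans[OF this cls_hom] show ?thesis
    by (simp add: comp_def completion_of_def[abs_def])
qed

lemma completion_abs_of:
  assumes "c \<in> carrier K"
  shows "completion_abs v (completion_of K v c) = v c"
  using completion_abs_cls[OF CR_const[OF assms]] unfolding completion_of_def
  by (simp add: LIMSEQ_const_iff)

lemma CR_diff: "\<sigma> \<in> carrier CR \<Longrightarrow> \<tau> \<in> carrier CR \<Longrightarrow> \<sigma> \<ominus>\<^bsub>CR\<^esub> \<tau> = (\<lambda>i. \<sigma> i \<ominus> \<tau> i)"
  by (simp add: a_minus_def[of CR] CR_a_inv a_minus_def)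

lemma cls_diff:
  assumes "\<sigma> \<in> carrier CR" "\<tau> \<in> carrier CR"
  shows "cls \<sigma> \<ominus>\<^bsub>KC\<^esub> cls \<tau> = cls (\<lambda>i. \<sigma> i \<ominus> \<tau> i)"
proof -
  interpret h: ring_hom_ring CR KC cls
    using cls_hom cring_CR cring_KC by (simp add: ring_hom_ringI2 cring.axioms(1))
  have "cls \<sigma> \<ominus>\<^bsub>KC\<^esub> cls \<tau> = cls \<sigma> \<oplus>\<^bsub>KC\<^esub> cls (\<ominus>\<^bsub>CR\<^esub> \<tau>)"
    unfolding a_minus_def[of KC] h.hom_a_inv[OF assms(2)] ..
  also have "\<dots> = cls (\<sigma> \<ominus>\<^bsub>CR\<^esub> \<tau>)"
    unfolding a_minus_def[of CR] using assms h.R.a_inv_closed by (intro h.hom_add[symmetric])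
  finally show ?thesis unfolding CR_diff[OF assms] .
qed

lemma cls_limit:
  assumes \<sigma>: "\<sigma> \<in> carrier CR"
  shows "(\<lambda>n. completion_abs v (cls \<sigma> \<ominus>\<^bsub>KC\<^esub> completion_of K v (\<sigma> n))) \<longlonglongrightarrow> 0"
proof (rule LIMSEQ_I)
  interpret V: valued_field KC "completion_abs v" by (rule valued_field_KC)
  fix \<epsilon> :: real assume "\<epsilon> > 0"
  then obtain N where N: "\<And>i j. i \<ge> N \<Longrightarrow> j \<ge> N \<Longrightarrow> v (\<sigma> i \<ominus> \<sigma> j) < \<epsilon> / 2"
    using \<sigma> unfolding CR_carrier by (meson half_gt_zero)
  have "norm (completion_abs v (cls \<sigma> \<ominus>\<^bsub>KC\<^esub> completion_of K v (\<sigma> n)) - 0) < \<epsilon>" if "n \<ge> N" for n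
  proof -
    have c: "(\<lambda>i. \<sigma> n) \<in> carrier CR" using \<sigma> by simp
    have d: "(\<lambda>i. \<sigma> i \<ominus> \<sigma> n) \<in> carrier CR"
      using CR_diff[OF \<sigma> c] cring_CR \<sigma> c by (metis cring.cring_simprules(4))
    have eq: "cls \<sigma> \<ominus>\<^bsub>KC\<^esub> completion_of K v (\<sigma> n) = cls (\<lambda>i. \<sigma> i \<ominus> \<sigma> n)"
      unfolding completion_of_def by (rule cls_diff[OF \<sigma> c])
    have "completion_abs v (cls (\<lambda>i. \<sigma> i \<ominus> \<sigma> n)) \<le> \<epsilon> / 2"
      by (rule LIMSEQ_le_const2[OF completion_abs_cls[OF d]]) (use N that in \<open>auto intro: less_imp_le\<close>)
    moreover have "0 \<le> completion_abs v (cls (\<lambda>i. \<sigma> i \<ominus> \<sigma> n))"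
      using d ring_hom_closed[OF cls_hom] V.v_nonneg by blast
    ultimately show ?thesis unfolding eq using \<open>\<epsilon> > 0\<close> by simp
  qed
  then show "\<exists>N. \<forall>n\<ge>N. norm (completion_abs v (cls \<sigma> \<ominus>\<^bsub>KC\<^esub> completion_of K v (\<sigma> n)) - 0) < \<epsilon>" by blast
qed

lemma completion_dense:
  assumes "x \<in> carrier KC" "\<epsilon> > 0"
  shows "\<exists>c\<in>carrier K. completion_abs v (x \<ominus>\<^bsub>KC\<^esub> completion_of K v c) < \<epsilon>"
proof -
  obtain \<sigma> where \<sigma>: "\<sigma> \<in> carrier CR" "x = cls \<sigma>" using completion_cases[OF assms(1)] by blast
  have "eventually (\<lambda>n. completion_abs v (x \<ominus>\<^bsub>KC\<^esub> completion_of K v (\<sigma> n)) < \<epsilon>) sequentially"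
    using order_tendstoD(2)[OF cls_limit[OF \<sigma>(1)] assms(2)] \<sigma>(2) by simp
  then show ?thesis using \<sigma>(1) by (auto simp: eventually_sequentially)
qed

text \<open>The diagonal argument: the \<open>i\<close>-th term of a Cauchy sequence in the completion is replaced by an
  element of \<open>K\<close> at distance less than \<open>1 / (i + 1)\<close>, and the sequence of these elements represents
  the limit.\<close>

theorem banach_ring_KC: "banach_ring KC (completion_abs v)"
proof -
  interpret V: valued_field KC "completion_abs v" by (rule valued_field_KC)
  let ?a = "completion_abs v" and ?c = "completion_of K v"
  have cc: "?c k \<in> carrier KC" if "k \<in> carrier K" for k
    using ring_hom_closed[OF completion_of_hom that] .
  show ?thesis
  proof (rule banach_ring.intro[OF V.is_cring], unfold_locales)
    fix f assume f: "\<And>i::nat. f i \<in> carrier KC"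
      and Cauchy: "\<And>\<epsilon>. \<epsilon> > 0 \<Longrightarrow> \<exists>N. \<forall>i\<ge>N. \<forall>j\<ge>N. ?a (f i \<ominus>\<^bsub>KC\<^esub> f j) < \<epsilon>"
    have "\<exists>k\<in>carrier K. ?a (f i \<ominus>\<^bsub>KC\<^esub> ?c k) < inverse (real (Suc i))" for i
      using completion_dense[OF f] by simp
    then obtain \<sigma> where \<sigma>K: "\<And>i. \<sigma> i \<in> carrier K" and near: "\<And>i. ?a (f i \<ominus>\<^bsub>KC\<^esub> ?c (\<sigma> i)) < inverse (real (Suc i))"
      by metis
    have \<sigma>: "\<sigma> \<in> carrier CR"
    proof -
      have "\<exists>N. \<forall>i\<ge>N. \<forall>j\<ge>N. v (\<sigma> i \<ominus> \<sigma> j) < \<epsilon>" if "\<epsilon> > 0" for \<epsilon>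
      proof -
        obtain N where N: "\<And>i j. i \<ge> N \<Longrightarrow> j \<ge> N \<Longrightarrow> ?a (f i \<ominus>\<^bsub>KC\<^esub> f j) < \<epsilon> / 3" using Cauchy[of "\<epsilon> / 3"] \<open>\<epsilon> > 0\<close> by auto
        obtain M where M: "inverse (real (Suc M)) < \<epsilon> / 3" using reals_Archimedean[of "\<epsilon> / 3"] \<open>\<epsilon> > 0\<close> by auto
        have M': "inverse (real (Suc i)) < \<epsilon> / 3" if "i \<ge> M" for i
        proof -
          have "inverse (real (Suc i)) \<le> inverse (real (Suc M))" using that by (intro le_imp_inverse_le) auto
          then show ?thesis using M by linarith
        qed
        have "v (\<sigma> i \<ominus> \<sigma> j) < \<epsilon>" if "i \<ge> max M N" "j \<ge> max M N" for i j
        proof -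
          have d: "?c (\<sigma> i \<ominus> \<sigma> j) = ?c (\<sigma> i) \<ominus>\<^bsub>KC\<^esub> ?c (\<sigma> j)"
          proof -
            interpret h: ring_hom_ring K KC ?c
              using completion_of_hom ring_axioms V.ring_axioms by (simp add: ring_hom_ringI2)
            show ?thesis using \<sigma>K h.hom_a_inv by (simp add: a_minus_def[of K] a_minus_def[of KC])
          qed
          have "v (\<sigma> i \<ominus> \<sigma> j) = ?a (?c (\<sigma> i) \<ominus>\<^bsub>KC\<^esub> ?c (\<sigma> j))"
            using completion_abs_of[of "\<sigma> i \<ominus> \<sigma> j"] \<sigma>K d by simp
          also have "\<dots> \<le> ?a (?c (\<sigma> i) \<ominus>\<^bsub>KC\<^esub> f i) + ?a (f i \<ominus>\<^bsub>KC\<^esub> ?c (\<sigma> j))"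
            using \<sigma>K cc f by (intro V.norm_diff_trans) auto
          also have "?a (f i \<ominus>\<^bsub>KC\<^esub> ?c (\<sigma> j)) \<le> ?a (f i \<ominus>\<^bsub>KC\<^esub> f j) + ?a (f j \<ominus>\<^bsub>KC\<^esub> ?c (\<sigma> j))"
            using \<sigma>K cc f by (intro V.norm_diff_trans) auto
          finally show ?thesis
            using V.norm_diff_commute[OF f cc[OF \<sigma>K], of i i] near[of i] near[of j] M'[of i] M'[of j] N[of i j] that
            by simp
        qed
        then show ?thesis by blast
      qed
      then show ?thesis using \<sigma>K by (simp add: CR_carrier)
    qed
    have lc: "cls \<sigma> \<in> carrier KC" using \<sigma> by (rule ring_hom_closed[OF cls_hom])
    have "(\<lambda>i. inverse (real (Suc i)) + ?a (cls \<sigma> \<ominus>\<^bsub>KC\<^esub> ?c (\<sigma> i))) \<longlonglongrightarrow> 0 + 0"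
      by (intro tendsto_add LIMSEQ_inverse_real_of_nat cls_limit \<sigma>)
    moreover have b: "?a (f i \<ominus>\<^bsub>KC\<^esub> cls \<sigma>) \<le> inverse (real (Suc i)) + ?a (cls \<sigma> \<ominus>\<^bsub>KC\<^esub> ?c (\<sigma> i))" for i
      using V.norm_diff_trans[OF f cc[OF \<sigma>K] lc, of i i] near[of i] V.norm_diff_commute[OF lc cc[OF \<sigma>K], of i]
      by linarith
    ultimately have "(\<lambda>i. ?a (f i \<ominus>\<^bsub>KC\<^esub> cls \<sigma>)) \<longlonglongrightarrow> 0"
      by (intro LIMSEQ_null_squeeze[OF _ V.v_nonneg b]) (simp_all only: add_0_left V.minus_closed f lc)
    then show "\<exists>l\<in>carrier KC. (\<lambda>i. ?a (f i \<ominus>\<^bsub>KC\<^esub> l)) \<longlonglongrightarrow> 0" using lc by blast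
  qed (simp_all add: V.v_nonneg V.v_eq_0_iff V.v_minus V.v_triangle V.v_mult)
qed

end

section \<open>The completed residue field of a point\<close>

lemma (in domain) valued_field_frac_field:
  fixes w :: "'a \<Rightarrow> real"
  assumes nonneg: "\<And>a. a \<in> carrier R \<Longrightarrow> 0 \<le> w a"
    and zero_iff: "\<And>a. a \<in> carrier R \<Longrightarrow> w a = 0 \<longleftrightarrow> a = \<zero>"
    and mult: "\<And>a c. a \<in> carrier R \<Longrightarrow> c \<in> carrier R \<Longrightarrow> w (a \<otimes> c) = w a * w c"
    and triangle: "\<And>a c. a \<in> carrier R \<Longrightarrow> c \<in> carrier R \<Longrightarrow> w (a \<oplus> c) \<le> w a + w c"
  defines "v \<equiv> \<lambda>P. the_elem ((\<lambda>(a, s). w a / w s) ` P)"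
  shows "valued_field (frac_field R) v"
    and "\<And>a s. a \<in> carrier R \<Longrightarrow> s \<in> carrier R \<Longrightarrow> s \<noteq> \<zero> \<Longrightarrow> v (frac_class R a s) = w a / w s"
proof -
  show v: "v (frac_class R a s) = w a / w s" if "a \<in> carrier R" "s \<in> carrier R" "s \<noteq> \<zero>" for a s
    unfolding v_def
  proof (rule the_elem_image_const)
    show "frac_class R a s \<noteq> {}" using frac_class_memI[of a s] that by blast
    fix z assume "z \<in> frac_class R a s"
    then obtain c t where z: "z = (c, t)" "(c, t) \<in> frac_class R a s" by (cases z) simp
    note ct = frac_class_memD[OF z(2)]
    have "w a * w t = w c * w s" using ct that by (simp flip: mult)
    moreover have "w t \<noteq> 0" "w s \<noteq> 0" using ct that zero_iff by auto
    ultimately show "(case z of (a, s) \<Rightarrow> w a / w s) = w a / w s" using z by (simp add: frac_eq_eq)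
  qed
  show "valued_field (frac_field R) v"
  proof (rule valued_field.intro[OF field_frac_field], unfold_locales)
    fix P Q assume P: "P \<in> carrier (frac_field R)"
    then obtain a s where as: "P = frac_class R a s" "a \<in> carrier R" "s \<in> carrier R" "s \<noteq> \<zero>"
      by (rule frac_field_cases)
    have ws: "0 < w s" using nonneg[of s] zero_iff[of s] as by simp
    show "0 \<le> v P" using as nonneg by (simp add: v)
    show "v P = 0 \<longleftrightarrow> P = \<zero>\<^bsub>frac_field R\<^esub>"
      using as ws by (simp add: v zero_iff frac_class_eq_zero_iff)
    assume "Q \<in> carrier (frac_field R)"
    then obtain c t where ct: "Q = frac_class R c t" "c \<in> carrier R" "t \<in> carrier R" "t \<noteq> \<zero>"
      by (rule frac_field_cases)
    have wt: "0 < w t" using nonneg[of t] zero_iff[of t] ct by simp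
    show "v (P \<otimes>\<^bsub>frac_field R\<^esub> Q) = v P * v Q"
      using as ct by (simp add: frac_class_mult v mult integral_iff)
    have "w (a \<otimes> t \<oplus> c \<otimes> s) \<le> w a * w t + w c * w s"
      using triangle[of "a \<otimes> t" "c \<otimes> s"] as ct by (simp add: mult)
    then show "v (P \<oplus>\<^bsub>frac_field R\<^esub> Q) \<le> v P + v Q"
      using as ct ws wt by (simp add: frac_class_add v mult integral_iff) (simp add: field_simps)
  qed
qed

locale spectrum_point = banach_ring A nrm for A :: "('a, 'm) ring_scheme" (structure) and nrm +
  fixes x :: "'a \<Rightarrow> real"
  assumes in_spectrum: "x \<in> spectrum A nrm"
begin

lemma pt_zero [simp]: "x \<zero> = 0" and pt_one [simp]: "x \<one> = 1"
  and pt_nonneg: "f \<in> carrier A \<Longrightarrow> 0 \<le> x f"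
  and pt_le: "f \<in> carrier A \<Longrightarrow> x f \<le> nrm f"
  and pt_triangle: "f \<in> carrier A \<Longrightarrow> g \<in> carrier A \<Longrightarrow> x (f \<oplus> g) \<le> x f + x g"
  and pt_mult: "f \<in> carrier A \<Longrightarrow> g \<in> carrier A \<Longrightarrow> x (f \<otimes> g) = x f * x g"
  using in_spectrum by (auto simp: spectrum_def)

lemma pt_minus: "f \<in> carrier A \<Longrightarrow> x (\<ominus> f) = x f"
proof -
  have "x (\<ominus> \<one>) * x (\<ominus> \<one>) = 1"
    using pt_mult[of "\<ominus> \<one>" "\<ominus> \<one>"] by (simp add: l_minus)
  then have "x (\<ominus> \<one>) = 1"
    using pt_nonneg[of "\<ominus> \<one>"] by (simp add: square_eq_1_iff)
  then show "f \<in> carrier A \<Longrightarrow> x (\<ominus> f) = x f"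
    using pt_mult[of "\<ominus> \<one>" f] by (simp add: l_minus)
qed

abbreviation ker where "ker \<equiv> seminorm_ker A x"
abbreviation dom where "dom \<equiv> residue_dom A x"
abbreviation coset where "coset a \<equiv> ker +> a"

lemma ker_iff: "f \<in> ker \<longleftrightarrow> f \<in> carrier A \<and> x f = 0"
  by (simp add: seminorm_ker_def)

lemma primeideal_ker: "primeideal ker A"
proof -
  have i: "ideal ker A"
  proof (rule idealI)
    show "subgroup ker (add_monoid A)"
    proof (rule group.subgroupI)
      show "group (add_monoid A)" by (rule add.group_axioms)
      show "ker \<subseteq> carrier (add_monoid A)" by (auto simp: seminorm_ker_def)
      show "ker \<noteq> {}" using zero_closed pt_zero by (auto simp: seminorm_ker_def)
      fix f assume "f \<in> ker"
      then show "inv\<^bsub>add_monoid A\<^esub> f \<in> ker"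
        unfolding a_inv_def[symmetric] by (simp add: seminorm_ker_def pt_minus)
    next
      fix f g assume fg: "f \<in> ker" "g \<in> ker"
      then have "x (f \<oplus> g) = 0"
        using pt_triangle[of f g] pt_nonneg[of "f \<oplus> g"] by (simp add: seminorm_ker_def)
      then show "f \<otimes>\<^bsub>add_monoid A\<^esub> g \<in> ker" using fg by (simp add: seminorm_ker_def)
    qed
  qed (auto simp: seminorm_ker_def pt_mult ring_axioms)
  show ?thesis
  proof (rule primeidealI[OF i is_cring])
    show "carrier A \<noteq> ker" using one_closed pt_one ker_iff zero_neq_one by metis
  qed (auto simp: seminorm_ker_def pt_mult)
qed

lemma domain_dom: "domain dom"
  unfolding residue_dom_def by (rule primeideal.quotient_is_domain[OF primeideal_ker])

lemma coset_hom: "coset \<in> ring_hom A dom"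
  unfolding residue_dom_def by (rule ideal.rcos_ring_hom[OF primeideal.axioms(1)[OF primeideal_ker]])

lemma dom_cases:
  assumes "c \<in> carrier dom"
  obtains a where "a \<in> carrier A" "c = coset a"
  using assms unfolding residue_dom_def FactRing_simps by auto

lemma coset_value:
  assumes a: "a \<in> carrier A"
  shows "the_elem (x ` coset a) = x a"
proof (rule the_elem_image_const)
  interpret I: ideal ker A by (rule primeideal.axioms(1)[OF primeideal_ker])
  show "coset a \<noteq> {}" using I.a_rcos_self[OF a] by blast
  fix d assume "d \<in> coset a"
  then obtain h where h: "h \<in> ker" "d = h \<oplus> a" by (auto simp: a_r_coset_def')
  then have hc: "h \<in> carrier A" "x h = 0" using ker_iff by blast+
  have "a = \<ominus> h \<oplus> d" using a hc h by (simp add: r_neg1 r_neg2)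
  then have "x a \<le> x (\<ominus> h) + x d" using pt_triangle[of "\<ominus> h" d] a hc h by simp
  moreover have "x d \<le> x a" using pt_triangle[of h a] h hc a by simp
  ultimately show "x d = x a" using hc by (simp add: pt_minus)
qed

lemma coset_zero_iff:
  assumes "a \<in> carrier A"
  shows "coset a = \<zero>\<^bsub>dom\<^esub> \<longleftrightarrow> x a = 0"
proof -
  interpret I: ideal ker A by (rule primeideal.axioms(1)[OF primeideal_ker])
  have "\<zero>\<^bsub>dom\<^esub> = ker" by (simp add: residue_dom_def FactRing_def)
  moreover have "a \<in> ker \<longleftrightarrow> x a = 0" using assms ker_iff by blast
  ultimately show ?thesis using assms I.a_rcos_const I.a_rcos_self by blast
qed

lemma valued_field_residue_frac:
  shows "valued_field (frac_field dom) (residue_frac_abs x)"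
    and residue_frac_abs_class: "\<And>a s. a \<in> carrier A \<Longrightarrow> s \<in> carrier A \<Longrightarrow> x s \<noteq> 0 \<Longrightarrow>
      residue_frac_abs x (frac_class dom (coset a) (coset s)) = x a / x s"
proof -
  interpret D: domain dom by (rule domain_dom)
  have 1: "0 \<le> the_elem (x ` c)" if "c \<in> carrier dom" for c
    using dom_cases[OF that] coset_value pt_nonneg by metis
  have 2: "the_elem (x ` c) = 0 \<longleftrightarrow> c = \<zero>\<^bsub>dom\<^esub>" if "c \<in> carrier dom" for c
    using dom_cases[OF that] coset_value coset_zero_iff by metis
  have 3: "the_elem (x ` (c \<otimes>\<^bsub>dom\<^esub> d)) = the_elem (x ` c) * the_elem (x ` d)"
    if cd: "c \<in> carrier dom" "d \<in> carrier dom" for c d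
  proof -
    obtain a e where "a \<in> carrier A" "c = coset a" "e \<in> carrier A" "d = coset e"
      using cd dom_cases by metis
    then show ?thesis using ring_hom_mult[OF coset_hom, of a e, symmetric] coset_value pt_mult by simp
  qed
  have 4: "the_elem (x ` (c \<oplus>\<^bsub>dom\<^esub> d)) \<le> the_elem (x ` c) + the_elem (x ` d)"
    if cd: "c \<in> carrier dom" "d \<in> carrier dom" for c d
  proof -
    obtain a e where "a \<in> carrier A" "c = coset a" "e \<in> carrier A" "d = coset e"
      using cd dom_cases by metis
    then show ?thesis
      using ring_hom_add[OF coset_hom, of a e, symmetric] coset_value pt_triangle by simp
  qed
  note V = D.valued_field_frac_field[of "\<lambda>c. the_elem (x ` c)", OF 1 2 3 4]
  show "valued_field (frac_field dom) (residue_frac_abs x)"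
    using V(1) unfolding residue_frac_abs_def[abs_def] by simp
  fix a s assume as: "a \<in> carrier A" "s \<in> carrier A" "x s \<noteq> 0"
  have "residue_frac_abs x (frac_class dom (coset a) (coset s)) = the_elem (x ` coset a) / the_elem (x ` coset s)"
    unfolding residue_frac_abs_def[abs_def]
    by (rule V(2)) (use as ring_hom_closed[OF coset_hom] coset_zero_iff in auto)
  then show "residue_frac_abs x (frac_class dom (coset a) (coset s)) = x a / x s"
    using as by (simp add: coset_value)
qed

lemma valued_field_residue: "valued_field (\<H> A x) (residue_abs x)"
  unfolding residue_field_def residue_abs_def
  by (rule valued_field.valued_field_KC[OF valued_field_residue_frac(1)])

lemma banach_ring_residue: "banach_ring (\<H> A x) (residue_abs x)"
  unfolding residue_field_def residue_abs_def
  by (rule valued_field.banach_ring_KC[OF valued_field_residue_frac(1)])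

abbreviation fv where "fv a s \<equiv> fraction_value A x a s"

lemma fraction_value_hom:
  "completion_of (frac_field dom) (residue_frac_abs x) \<in> ring_hom (frac_field dom) (\<H> A x)"
  unfolding residue_field_def
  by (rule valued_field.completion_of_hom[OF valued_field_residue_frac(1)])

lemma coset_closed [simp]: "a \<in> carrier A \<Longrightarrow> coset a \<in> carrier dom"
  using ring_hom_closed[OF coset_hom] .

lemma frac_class_coset_closed:
  "a \<in> carrier A \<Longrightarrow> s \<in> carrier A \<Longrightarrow> x s \<noteq> 0 \<Longrightarrow> frac_class dom (coset a) (coset s) \<in> carrier (frac_field dom)"
  using domain.frac_class_closed[OF domain_dom] coset_zero_iff by simp

lemma fraction_value_closed [simp]:
  "a \<in> carrier A \<Longrightarrow> s \<in> carrier A \<Longrightarrow> x s \<noteq> 0 \<Longrightarrow> fv a s \<in> carrier (\<H> A x)"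
  unfolding fraction_value_def
  using ring_hom_closed[OF fraction_value_hom] frac_class_coset_closed by blast

lemma fraction_value_abs:
  "a \<in> carrier A \<Longrightarrow> s \<in> carrier A \<Longrightarrow> x s \<noteq> 0 \<Longrightarrow> residue_abs x (fv a s) = x a / x s"
  unfolding fraction_value_def residue_abs_def
  using valued_field.completion_abs_of[OF valued_field_residue_frac(1)] frac_class_coset_closed
    residue_frac_abs_class by simp

lemma fraction_value_mult:
  assumes "a \<in> carrier A" "s \<in> carrier A" "x s \<noteq> 0" "c \<in> carrier A" "t \<in> carrier A" "x t \<noteq> 0"
  shows "fv a s \<otimes>\<^bsub>\<H> A x\<^esub> fv c t = fv (a \<otimes> c) (s \<otimes> t)"
  unfolding fraction_value_def
  using assms by (simp flip: ring_hom_mult[OF fraction_value_hom]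
    add: frac_class_coset_closed domain.frac_class_mult[OF domain_dom] coset_zero_iff ring_hom_mult[OF coset_hom])

lemma fraction_value_add:
  assumes "a \<in> carrier A" "s \<in> carrier A" "x s \<noteq> 0" "c \<in> carrier A" "t \<in> carrier A" "x t \<noteq> 0"
  shows "fv a s \<oplus>\<^bsub>\<H> A x\<^esub> fv c t = fv (a \<otimes> t \<oplus> c \<otimes> s) (s \<otimes> t)"
  unfolding fraction_value_def
  using assms by (simp flip: ring_hom_add[OF fraction_value_hom]
    add: frac_class_coset_closed domain.frac_class_add[OF domain_dom] coset_zero_iff
      ring_hom_mult[OF coset_hom] ring_hom_add[OF coset_hom])

lemma fraction_value_one: "fv \<one> \<one> = \<one>\<^bsub>\<H> A x\<^esub>"
  unfolding fraction_value_def ring_hom_one[OF coset_hom] domain.frac_field_one[OF domain_dom, symmetric]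
  by (rule ring_hom_one[OF fraction_value_hom])

lemma fraction_value_zero: "fv \<zero> \<one> = \<zero>\<^bsub>\<H> A x\<^esub>"
proof -
  interpret V: valued_field "\<H> A x" "residue_abs x" by (rule valued_field_residue)
  have "residue_abs x (fv \<zero> \<one>) = 0" by (simp add: fraction_value_abs)
  then show ?thesis using V.v_eq_0_iff by simp
qed

lemma fraction_value_dense:
  assumes "z \<in> carrier (\<H> A x)" "\<epsilon> > 0"
  shows "\<exists>a\<in>carrier A. \<exists>s\<in>carrier A. x s \<noteq> 0 \<and> residue_abs x (z \<ominus>\<^bsub>\<H> A x\<^esub> fv a s) < \<epsilon>"
proof -
  interpret D: domain dom by (rule domain_dom)
  obtain P where P: "P \<in> carrier (frac_field dom)"
    "residue_abs x (z \<ominus>\<^bsub>\<H> A x\<^esub> completion_of (frac_field dom) (residue_frac_abs x) P) < \<epsilon>"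
    using valued_field.completion_dense[OF valued_field_residue_frac(1)] assms
    unfolding residue_field_def residue_abs_def by blast
  obtain c d where cd: "P = frac_class dom c d" "c \<in> carrier dom" "d \<in> carrier dom" "d \<noteq> \<zero>\<^bsub>dom\<^esub>"
    using D.frac_field_cases[OF P(1)] by blast
  obtain a where a: "a \<in> carrier A" "c = coset a" using dom_cases cd by blast
  obtain s where s: "s \<in> carrier A" "d = coset s" using dom_cases cd by blast
  have "x s \<noteq> 0" using s cd coset_zero_iff by blast
  then show ?thesis using P(2) a s cd unfolding fraction_value_def by blast
qed

end

section \<open>Uniform sections\<close>

text \<open>Boundedness makes this set closed under products. A section need not lie in it, but does so after
  restriction to a small neighbourhood of any given point.\<close>

definition uniform_sections :: "('a, 'm) ring_scheme \<Rightarrow> ('a \<Rightarrow> real) set \<Rightarrow> (('a \<Rightarrow> real) \<Rightarrow> 'a residue) set" where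
  "uniform_sections A V = {f \<in> \<Pi>\<^sub>E y\<in>V. carrier (\<H> A y).
     (\<exists>M. \<forall>y\<in>V. residue_abs y (f y) \<le> M) \<and>
     (\<forall>\<epsilon>>0. \<exists>a\<in>carrier A. \<exists>s\<in>carrier A.
          (\<forall>y\<in>V. y s \<noteq> 0) \<and>
          (\<forall>y\<in>V. residue_abs y (f y \<ominus>\<^bsub>\<H> A y\<^esub> fraction_value A y a s) < \<epsilon>))}"

definition section_ring :: "('a, 'm) ring_scheme \<Rightarrow> ('a \<Rightarrow> real) set \<Rightarrow> (('a \<Rightarrow> real) \<Rightarrow> 'a residue) ring" where
  "section_ring A V =
     \<lparr> carrier = uniform_sections A V,
       mult = (\<lambda>f g. \<lambda>y\<in>V. f y \<otimes>\<^bsub>\<H> A y\<^esub> g y),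
       one = (\<lambda>y\<in>V. \<one>\<^bsub>\<H> A y\<^esub>),
       zero = (\<lambda>y\<in>V. \<zero>\<^bsub>\<H> A y\<^esub>),
       add = (\<lambda>f g. \<lambda>y\<in>V. f y \<oplus>\<^bsub>\<H> A y\<^esub> g y) \<rparr>"

definition sup_norm :: "('a \<Rightarrow> real) set \<Rightarrow> (('a \<Rightarrow> real) \<Rightarrow> 'a residue) \<Rightarrow> real" where
  "sup_norm V f = (SUP y\<in>V. residue_abs y (f y))"

lemma section_ring_simps [simp]:
  "carrier (section_ring A V) = uniform_sections A V"
  "f \<otimes>\<^bsub>section_ring A V\<^esub> g = (\<lambda>y\<in>V. f y \<otimes>\<^bsub>\<H> A y\<^esub> g y)"
  "f \<oplus>\<^bsub>section_ring A V\<^esub> g = (\<lambda>y\<in>V. f y \<oplus>\<^bsub>\<H> A y\<^esub> g y)"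
  "\<one>\<^bsub>section_ring A V\<^esub> = (\<lambda>y\<in>V. \<one>\<^bsub>\<H> A y\<^esub>)"
  "\<zero>\<^bsub>section_ring A V\<^esub> = (\<lambda>y\<in>V. \<zero>\<^bsub>\<H> A y\<^esub>)"
  by (simp_all add: section_ring_def)

lemma uniform_sections_value: "f \<in> uniform_sections A V \<Longrightarrow> y \<in> V \<Longrightarrow> f y \<in> carrier (\<H> A y)"
  by (auto simp: uniform_sections_def)

lemma uniform_sections_ext:
  "f \<in> uniform_sections A V \<Longrightarrow> g \<in> uniform_sections A V \<Longrightarrow> (\<And>y. y \<in> V \<Longrightarrow> f y = g y) \<Longrightarrow> f = g"
  unfolding uniform_sections_def by (blast intro: PiE_ext)

lemma uniform_sections_bounded:
  assumes "f \<in> uniform_sections A V"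
  obtains M where "M \<ge> 0" "\<And>y. y \<in> V \<Longrightarrow> residue_abs y (f y) \<le> M"
proof -
  obtain M where M: "\<forall>y\<in>V. residue_abs y (f y) \<le> M"
    using assms by (auto simp: uniform_sections_def)
  have "residue_abs y (f y) \<le> max 0 M" if "y \<in> V" for y using M that by force
  then show ?thesis using that[of "max 0 M"] by simp
qed

lemma uniform_sections_approx:
  assumes "f \<in> uniform_sections A V" "\<epsilon> > 0"
  obtains a s where "a \<in> carrier A" "s \<in> carrier A" "\<And>y. y \<in> V \<Longrightarrow> y s \<noteq> 0"
    "\<And>y. y \<in> V \<Longrightarrow> residue_abs y (f y \<ominus>\<^bsub>\<H> A y\<^esub> fraction_value A y a s) < \<epsilon>"
proof -
  have "\<exists>a\<in>carrier A. \<exists>s\<in>carrier A. (\<forall>y\<in>V. y s \<noteq> 0) \<and>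
      (\<forall>y\<in>V. residue_abs y (f y \<ominus>\<^bsub>\<H> A y\<^esub> fraction_value A y a s) < \<epsilon>)"
    using assms by (simp add: uniform_sections_def)
  then obtain a s where "a \<in> carrier A" "s \<in> carrier A" "\<forall>y\<in>V. y s \<noteq> 0"
      "\<forall>y\<in>V. residue_abs y (f y \<ominus>\<^bsub>\<H> A y\<^esub> fraction_value A y a s) < \<epsilon>" by (elim bexE conjE)
  then show ?thesis using that[of a s] by blast
qed

lemma uniform_sections_restrict:
  assumes "f \<in> uniform_sections A V" "W \<subseteq> V"
  shows "restrict f W \<in> uniform_sections A W"
proof -
  have "\<exists>M. \<forall>y\<in>W. residue_abs y (restrict f W y) \<le> M"
  proof -
    obtain M where "\<And>y. y \<in> V \<Longrightarrow> residue_abs y (f y) \<le> M" using uniform_sections_bounded[OF assms(1)] by blast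
    then show ?thesis using assms(2) by (intro exI[of _ M]) auto
  qed
  moreover have "\<exists>a\<in>carrier A. \<exists>s\<in>carrier A. (\<forall>y\<in>W. y s \<noteq> 0) \<and>
      (\<forall>y\<in>W. residue_abs y (restrict f W y \<ominus>\<^bsub>\<H> A y\<^esub> fraction_value A y a s) < \<epsilon>)" if "\<epsilon> > 0" for \<epsilon>
  proof -
    obtain a s where as: "a \<in> carrier A" "s \<in> carrier A" "\<And>y. y \<in> V \<Longrightarrow> y s \<noteq> 0"
      "\<And>y. y \<in> V \<Longrightarrow> residue_abs y (f y \<ominus>\<^bsub>\<H> A y\<^esub> fraction_value A y a s) < \<epsilon>"
      using uniform_sections_approx[OF assms(1) \<open>\<epsilon> > 0\<close>] by blast
    then show ?thesis using assms(2) by (intro bexI[of _ a] bexI[of _ s]) auto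
  qed
  moreover have "restrict f W \<in> (\<Pi>\<^sub>E y\<in>W. carrier (\<H> A y))"
    using uniform_sections_value[OF assms(1)] assms(2) by auto
  ultimately show ?thesis unfolding uniform_sections_def by blast
qed

context banach_ring
begin

lemma spectrum_pointI: "y \<in> spectrum A nrm \<Longrightarrow> spectrum_point A nrm y"
  by (simp add: spectrum_point_def spectrum_point_axioms_def banach_ring_axioms)

lemma field_residue: "y \<in> spectrum A nrm \<Longrightarrow> valued_field (\<H> A y) (residue_abs y)"
  using spectrum_point.valued_field_residue[OF spectrum_pointI] .

lemma cring_residue: "y \<in> spectrum A nrm \<Longrightarrow> cring (\<H> A y)"
  using field_residue valued_field.axioms(1) domain.axioms(1) field.axioms(1) by blast

lemma uniform_sections_add:
  assumes V: "V \<subseteq> spectrum A nrm" and f: "f \<in> uniform_sections A V" and g: "g \<in> uniform_sections A V"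
  shows "(\<lambda>y\<in>V. f y \<oplus>\<^bsub>\<H> A y\<^esub> g y) \<in> uniform_sections A V"
proof -
  obtain M where M: "\<And>y. y \<in> V \<Longrightarrow> residue_abs y (f y) \<le> M" using uniform_sections_bounded[OF f] by blast
  obtain M' where M': "\<And>y. y \<in> V \<Longrightarrow> residue_abs y (g y) \<le> M'" using uniform_sections_bounded[OF g] by blast
  have "f y \<oplus>\<^bsub>\<H> A y\<^esub> g y \<in> carrier (\<H> A y) \<and> residue_abs y (f y \<oplus>\<^bsub>\<H> A y\<^esub> g y) \<le> M + M'" if y: "y \<in> V" for y
  proof -
    interpret H: valued_field "\<H> A y" "residue_abs y" using y V by (intro field_residue) auto
    show ?thesis using H.v_triangle[of "f y" "g y"] M[OF y] M'[OF y] uniform_sections_value[OF f y]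
      uniform_sections_value[OF g y] by auto
  qed
  moreover have "\<exists>a\<in>carrier A. \<exists>s\<in>carrier A. (\<forall>y\<in>V. y s \<noteq> 0) \<and>
      (\<forall>y\<in>V. residue_abs y (f y \<oplus>\<^bsub>\<H> A y\<^esub> g y \<ominus>\<^bsub>\<H> A y\<^esub> fraction_value A y a s) < \<epsilon>)"
    if "\<epsilon> > 0" for \<epsilon>
  proof -
    have \<epsilon>2: "\<epsilon> / 2 > 0" using that by simp
    obtain a s where as: "a \<in> carrier A" "s \<in> carrier A" "\<And>y. y \<in> V \<Longrightarrow> y s \<noteq> 0"
      "\<And>y. y \<in> V \<Longrightarrow> residue_abs y (f y \<ominus>\<^bsub>\<H> A y\<^esub> fraction_value A y a s) < \<epsilon> / 2"
      using uniform_sections_approx[OF f \<epsilon>2] by blast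
    obtain c t where ct: "c \<in> carrier A" "t \<in> carrier A" "\<And>y. y \<in> V \<Longrightarrow> y t \<noteq> 0"
      "\<And>y. y \<in> V \<Longrightarrow> residue_abs y (g y \<ominus>\<^bsub>\<H> A y\<^esub> fraction_value A y c t) < \<epsilon> / 2"
      using uniform_sections_approx[OF g \<epsilon>2] by blast
    have "y (s \<otimes> t) \<noteq> 0 \<and> residue_abs y (f y \<oplus>\<^bsub>\<H> A y\<^esub> g y \<ominus>\<^bsub>\<H> A y\<^esub>
        fraction_value A y (a \<otimes> t \<oplus> c \<otimes> s) (s \<otimes> t)) < \<epsilon>" if y: "y \<in> V" for y
    proof -
      interpret P: spectrum_point A nrm y using y V by (intro spectrum_pointI) auto
      interpret H: valued_field "\<H> A y" "residue_abs y" using y V by (intro field_residue) auto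
      have fg: "f y \<in> carrier (\<H> A y)" "g y \<in> carrier (\<H> A y)"
        using uniform_sections_value f g y by auto
      let ?F = "fraction_value A y a s" and ?G = "fraction_value A y c t"
      have FG: "?F \<in> carrier (\<H> A y)" "?G \<in> carrier (\<H> A y)" using as ct y by auto
      have "(f y \<oplus>\<^bsub>\<H> A y\<^esub> g y) \<ominus>\<^bsub>\<H> A y\<^esub> (?F \<oplus>\<^bsub>\<H> A y\<^esub> ?G) =
          (f y \<ominus>\<^bsub>\<H> A y\<^esub> ?F) \<oplus>\<^bsub>\<H> A y\<^esub> (g y \<ominus>\<^bsub>\<H> A y\<^esub> ?G)"
        using fg FG by (simp add: a_minus_def[of "\<H> A y"] H.minus_add H.a_ac)
      then have "residue_abs y ((f y \<oplus>\<^bsub>\<H> A y\<^esub> g y) \<ominus>\<^bsub>\<H> A y\<^esub> (?F \<oplus>\<^bsub>\<H> A y\<^esub> ?G)) < \<epsilon> / 2 + \<epsilon> / 2"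
        using H.v_triangle[of "f y \<ominus>\<^bsub>\<H> A y\<^esub> ?F" "g y \<ominus>\<^bsub>\<H> A y\<^esub> ?G"] as(4)[OF y] ct(4)[OF y] fg FG by simp
      moreover have "?F \<oplus>\<^bsub>\<H> A y\<^esub> ?G = fraction_value A y (a \<otimes> t \<oplus> c \<otimes> s) (s \<otimes> t)"
        using as ct y by (intro P.fraction_value_add) auto
      ultimately show ?thesis using as ct y by (simp add: P.pt_mult)
    qed
    then show ?thesis using as ct
      by (intro bexI[of _ "a \<otimes> t \<oplus> c \<otimes> s"] bexI[of _ "s \<otimes> t"]) auto
  qed
  ultimately show ?thesis by (auto simp: uniform_sections_def)
qed

lemma uniform_sections_mult:
  assumes V: "V \<subseteq> spectrum A nrm" and f: "f \<in> uniform_sections A V" and g: "g \<in> uniform_sections A V"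
  shows "(\<lambda>y\<in>V. f y \<otimes>\<^bsub>\<H> A y\<^esub> g y) \<in> uniform_sections A V"
proof -
  obtain M where M: "M \<ge> 0" "\<And>y. y \<in> V \<Longrightarrow> residue_abs y (f y) \<le> M" using uniform_sections_bounded[OF f] by blast
  obtain M' where M': "M' \<ge> 0" "\<And>y. y \<in> V \<Longrightarrow> residue_abs y (g y) \<le> M'" using uniform_sections_bounded[OF g] by blast
  have "f y \<otimes>\<^bsub>\<H> A y\<^esub> g y \<in> carrier (\<H> A y) \<and> residue_abs y (f y \<otimes>\<^bsub>\<H> A y\<^esub> g y) \<le> M * M'" if y: "y \<in> V" for y
  proof -
    interpret H: valued_field "\<H> A y" "residue_abs y" using y V by (intro field_residue) auto
    show ?thesis using H.v_mult[of "f y" "g y"] M(1) mult_mono[OF M(2)[OF y] M'(2)[OF y]]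
      H.v_nonneg uniform_sections_value[OF f y] uniform_sections_value[OF g y] by auto
  qed
  moreover have "\<exists>a\<in>carrier A. \<exists>s\<in>carrier A. (\<forall>y\<in>V. y s \<noteq> 0) \<and>
      (\<forall>y\<in>V. residue_abs y (f y \<otimes>\<^bsub>\<H> A y\<^esub> g y \<ominus>\<^bsub>\<H> A y\<^esub> fraction_value A y a s) < \<epsilon>)"
    if "\<epsilon> > 0" for \<epsilon>
  proof -
    define \<delta> where "\<delta> = min 1 (\<epsilon> / (M + M' + 2))"
    have \<delta>: "\<delta> > 0" "\<delta> \<le> 1" using that M M' by (auto simp: \<delta>_def)
    have "\<delta> * (M + M' + 2) \<le> \<epsilon> / (M + M' + 2) * (M + M' + 2)"
      using M M' by (intro mult_right_mono) (auto simp: \<delta>_def)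
    then have \<delta>\<epsilon>: "\<delta> * (M + M' + 2) \<le> \<epsilon>" using M M' by simp
    obtain a s where as: "a \<in> carrier A" "s \<in> carrier A" "\<And>y. y \<in> V \<Longrightarrow> y s \<noteq> 0"
      "\<And>y. y \<in> V \<Longrightarrow> residue_abs y (f y \<ominus>\<^bsub>\<H> A y\<^esub> fraction_value A y a s) < \<delta>"
      using uniform_sections_approx[OF f \<delta>(1)] by blast
    obtain c t where ct: "c \<in> carrier A" "t \<in> carrier A" "\<And>y. y \<in> V \<Longrightarrow> y t \<noteq> 0"
      "\<And>y. y \<in> V \<Longrightarrow> residue_abs y (g y \<ominus>\<^bsub>\<H> A y\<^esub> fraction_value A y c t) < \<delta>"
      using uniform_sections_approx[OF g \<delta>(1)] by blast
    have "y (s \<otimes> t) \<noteq> 0 \<and> residue_abs y (f y \<otimes>\<^bsub>\<H> A y\<^esub> g y \<ominus>\<^bsub>\<H> A y\<^esub>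
        fraction_value A y (a \<otimes> c) (s \<otimes> t)) < \<epsilon>" if y: "y \<in> V" for y
    proof -
      interpret P: spectrum_point A nrm y using y V by (intro spectrum_pointI) auto
      interpret H: valued_field "\<H> A y" "residue_abs y" using y V by (intro field_residue) auto
      have fg: "f y \<in> carrier (\<H> A y)" "g y \<in> carrier (\<H> A y)"
        using uniform_sections_value f g y by auto
      let ?F = "fraction_value A y a s" and ?G = "fraction_value A y c t"
      have FG: "?F \<in> carrier (\<H> A y)" "?G \<in> carrier (\<H> A y)" using as ct y by auto
      have "residue_abs y (f y \<otimes>\<^bsub>\<H> A y\<^esub> g y \<ominus>\<^bsub>\<H> A y\<^esub> ?F \<otimes>\<^bsub>\<H> A y\<^esub> ?G) \<le>
          residue_abs y (f y \<ominus>\<^bsub>\<H> A y\<^esub> ?F) * residue_abs y (g y) +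
          residue_abs y ?F * residue_abs y (g y \<ominus>\<^bsub>\<H> A y\<^esub> ?G)"
        using fg FG by (intro H.norm_product_diff)
      also have "\<dots> \<le> \<delta> * M' + (M + 1) * \<delta>"
      proof (intro add_mono mult_mono)
        show "residue_abs y ?F \<le> M + 1"
          using H.norm_le_diff[OF FG(1) fg(1)] H.norm_diff_commute[OF FG(1) fg(1)] as(4)[OF y] M(2)[OF y] \<delta>
          by linarith
      qed (use as(4)[OF y] ct(4)[OF y] M(1) M'(2)[OF y] H.v_nonneg fg FG \<delta> in auto)
      also have "\<dots> < \<delta> * (M + M' + 2)" using \<delta> by (simp add: algebra_simps)
      finally have "residue_abs y (f y \<otimes>\<^bsub>\<H> A y\<^esub> g y \<ominus>\<^bsub>\<H> A y\<^esub> ?F \<otimes>\<^bsub>\<H> A y\<^esub> ?G) < \<epsilon>" using \<delta>\<epsilon> by simp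
      moreover have "?F \<otimes>\<^bsub>\<H> A y\<^esub> ?G = fraction_value A y (a \<otimes> c) (s \<otimes> t)"
        using as ct y by (intro P.fraction_value_mult) auto
      ultimately show ?thesis using as ct y by (simp add: P.pt_mult)
    qed
    then show ?thesis using as ct
      by (intro bexI[of _ "a \<otimes> c"] bexI[of _ "s \<otimes> t"]) auto
  qed
  ultimately show ?thesis by (auto simp: uniform_sections_def)
qed

lemma fraction_uniform_section:
  assumes V: "V \<subseteq> spectrum A nrm" and a: "a \<in> carrier A" and s: "s \<in> carrier A"
    and c: "c > 0" "\<And>y. y \<in> V \<Longrightarrow> y s \<ge> c"
  shows "(\<lambda>y\<in>V. fraction_value A y a s) \<in> uniform_sections A V"
proof -
  have 1: "fraction_value A y a s \<in> carrier (\<H> A y) \<and> residue_abs y (fraction_value A y a s) \<le> nrm a / c \<and>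
      residue_abs y (fraction_value A y a s \<ominus>\<^bsub>\<H> A y\<^esub> fraction_value A y a s) = 0 \<and> y s \<noteq> 0" if y: "y \<in> V" for y
  proof -
    interpret P: spectrum_point A nrm y using y V by (intro spectrum_pointI) auto
    interpret H: valued_field "\<H> A y" "residue_abs y" using y V by (intro field_residue) auto
    have ys: "y s \<noteq> 0" using c y by fastforce
    have "y a / y s \<le> nrm a / c" using P.pt_le[OF a] P.pt_nonneg[OF a] c y by (intro frac_le) auto
    then show ?thesis using a s ys by (simp add: P.fraction_value_abs a_minus_def[of "\<H> A y"] H.r_neg)
  qed
  then show ?thesis unfolding uniform_sections_def
    using a s by (auto intro!: bexI[where x = a, OF bexI[where x = s]])
qed

lemma uniform_sections_const:
  assumes V: "V \<subseteq> spectrum A nrm"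
  shows "(\<lambda>y\<in>V. \<one>\<^bsub>\<H> A y\<^esub>) \<in> uniform_sections A V" "(\<lambda>y\<in>V. \<zero>\<^bsub>\<H> A y\<^esub>) \<in> uniform_sections A V"
    "(\<lambda>y\<in>V. \<ominus>\<^bsub>\<H> A y\<^esub> \<one>\<^bsub>\<H> A y\<^esub>) \<in> uniform_sections A V"
proof -
  have 1: "y \<one> \<ge> 1 \<and> fraction_value A y \<one> \<one> = \<one>\<^bsub>\<H> A y\<^esub> \<and> fraction_value A y \<zero> \<one> = \<zero>\<^bsub>\<H> A y\<^esub> \<and>
     fraction_value A y (\<ominus> \<one>) \<one> = \<ominus>\<^bsub>\<H> A y\<^esub> \<one>\<^bsub>\<H> A y\<^esub>" if y: "y \<in> V" for y
  proof -
    interpret P: spectrum_point A nrm y using y V by (intro spectrum_pointI) auto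
    interpret H: valued_field "\<H> A y" "residue_abs y" using y V by (intro field_residue) auto
    have "fraction_value A y (\<ominus> \<one>) \<one> \<oplus>\<^bsub>\<H> A y\<^esub> fraction_value A y \<one> \<one> = \<zero>\<^bsub>\<H> A y\<^esub>"
      by (simp add: P.fraction_value_add l_neg P.fraction_value_zero)
    then have "\<ominus>\<^bsub>\<H> A y\<^esub> \<one>\<^bsub>\<H> A y\<^esub> = fraction_value A y (\<ominus> \<one>) \<one>"
      unfolding P.fraction_value_one by (intro H.minus_equality) auto
    then show ?thesis by (simp add: P.fraction_value_one P.fraction_value_zero)
  qed
  have c: "(\<lambda>y\<in>V. fraction_value A y a \<one>) \<in> uniform_sections A V" if "a \<in> carrier A" for a
    using fraction_uniform_section[OF V that one_closed, of 1] 1 by simp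
  show "(\<lambda>y\<in>V. \<one>\<^bsub>\<H> A y\<^esub>) \<in> uniform_sections A V" using c[OF one_closed] 1 by (simp cong: restrict_cong)
  show "(\<lambda>y\<in>V. \<zero>\<^bsub>\<H> A y\<^esub>) \<in> uniform_sections A V" using c[OF zero_closed] 1 by (simp cong: restrict_cong)
  show "(\<lambda>y\<in>V. \<ominus>\<^bsub>\<H> A y\<^esub> \<one>\<^bsub>\<H> A y\<^esub>) \<in> uniform_sections A V"
    using c[OF a_inv_closed[OF one_closed]] 1 by (simp cong: restrict_cong)
qed

lemma uniform_sections_minus:
  assumes V: "V \<subseteq> spectrum A nrm" and f: "f \<in> uniform_sections A V"
  shows "(\<lambda>y\<in>V. \<ominus>\<^bsub>\<H> A y\<^esub> f y) \<in> uniform_sections A V"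
proof -
  have "(\<lambda>y\<in>V. (\<lambda>y\<in>V. \<ominus>\<^bsub>\<H> A y\<^esub> \<one>\<^bsub>\<H> A y\<^esub>) y \<otimes>\<^bsub>\<H> A y\<^esub> f y) \<in> uniform_sections A V"
    by (rule uniform_sections_mult[OF V uniform_sections_const(3)[OF V] f])
  moreover have "\<ominus>\<^bsub>\<H> A y\<^esub> f y = (\<ominus>\<^bsub>\<H> A y\<^esub> \<one>\<^bsub>\<H> A y\<^esub>) \<otimes>\<^bsub>\<H> A y\<^esub> f y" if y: "y \<in> V" for y
  proof -
    interpret H: valued_field "\<H> A y" "residue_abs y" using y V by (intro field_residue) auto
    show ?thesis using uniform_sections_value[OF f y] by (simp add: H.l_minus)
  qed
  ultimately show ?thesis by (simp cong: restrict_cong)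
qed

lemma cring_section_ring:
  assumes V: "V \<subseteq> spectrum A nrm"
  shows "cring (section_ring A V)"
proof (rule cringI)
  let ?S = "section_ring A V"
  note cl = uniform_sections_add[OF V] uniform_sections_mult[OF V] uniform_sections_const[OF V]
    uniform_sections_minus[OF V]
  have H: "cring (\<H> A y)" if "y \<in> V" for y using that V cring_residue by blast
  have val: "f y \<in> carrier (\<H> A y)" if "f \<in> carrier ?S" "y \<in> V" for f y
    using that uniform_sections_value by simp
  have ext: "f = restrict f V" if "f \<in> uniform_sections A V" for f
    using that by (auto simp: uniform_sections_def PiE_iff extensional_restrict)
  show "abelian_group ?S"
  proof (rule abelian_groupI)
    fix f g h assume c: "f \<in> carrier ?S" "g \<in> carrier ?S" "h \<in> carrier ?S"
    show "f \<oplus>\<^bsub>?S\<^esub> g \<oplus>\<^bsub>?S\<^esub> h = f \<oplus>\<^bsub>?S\<^esub> (g \<oplus>\<^bsub>?S\<^esub> h)"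
      unfolding section_ring_simps by (rule restrict_ext) (simp add: val[OF c(1)] val[OF c(2)] val[OF c(3)] cring.cring_simprules(7)[OF H])
  next
    fix f g assume c: "f \<in> carrier ?S" "g \<in> carrier ?S"
    from c show "f \<oplus>\<^bsub>?S\<^esub> g \<in> carrier ?S" using cl by simp
    show "f \<oplus>\<^bsub>?S\<^esub> g = g \<oplus>\<^bsub>?S\<^esub> f"
      unfolding section_ring_simps by (rule restrict_ext) (simp add: val[OF c(1)] val[OF c(2)] cring.cring_simprules(10)[OF H])
  next
    fix f assume c: "f \<in> carrier ?S"
    show "\<zero>\<^bsub>?S\<^esub> \<oplus>\<^bsub>?S\<^esub> f = f"
      unfolding section_ring_simps using c
      by (subst (2) ext) (auto intro!: restrict_ext simp: val[OF c] cring.cring_simprules(8)[OF H])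
    have "(\<lambda>y\<in>V. \<ominus>\<^bsub>\<H> A y\<^esub> f y) \<oplus>\<^bsub>?S\<^esub> f = \<zero>\<^bsub>?S\<^esub>"
      unfolding section_ring_simps by (rule restrict_ext) (simp add: val[OF c] cring.cring_simprules(9)[OF H])
    moreover have "(\<lambda>y\<in>V. \<ominus>\<^bsub>\<H> A y\<^esub> f y) \<in> carrier ?S" using cl c by simp
    ultimately show "\<exists>g\<in>carrier ?S. g \<oplus>\<^bsub>?S\<^esub> f = \<zero>\<^bsub>?S\<^esub>" by (rule bexI)
  qed (use cl in simp)
  show "comm_monoid ?S"
  proof (rule comm_monoidI)
    fix f g h assume c: "f \<in> carrier ?S" "g \<in> carrier ?S" "h \<in> carrier ?S"
    show "f \<otimes>\<^bsub>?S\<^esub> g \<otimes>\<^bsub>?S\<^esub> h = f \<otimes>\<^bsub>?S\<^esub> (g \<otimes>\<^bsub>?S\<^esub> h)"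
      unfolding section_ring_simps by (rule restrict_ext) (simp add: val[OF c(1)] val[OF c(2)] val[OF c(3)] cring.cring_simprules(11)[OF H])
  next
    fix f g assume c: "f \<in> carrier ?S" "g \<in> carrier ?S"
    from c show "f \<otimes>\<^bsub>?S\<^esub> g \<in> carrier ?S" using cl by simp
    show "f \<otimes>\<^bsub>?S\<^esub> g = g \<otimes>\<^bsub>?S\<^esub> f"
      unfolding section_ring_simps by (rule restrict_ext) (simp add: val[OF c(1)] val[OF c(2)] cring.cring_simprules(14)[OF H])
  next
    fix f assume c: "f \<in> carrier ?S"
    show "\<one>\<^bsub>?S\<^esub> \<otimes>\<^bsub>?S\<^esub> f = f"
      unfolding section_ring_simps using c
      by (subst (2) ext) (auto intro!: restrict_ext simp: val[OF c] cring.cring_simprules(12)[OF H])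
  qed (use cl in simp)
  fix f g h assume c: "f \<in> carrier ?S" "g \<in> carrier ?S" "h \<in> carrier ?S"
  show "(f \<oplus>\<^bsub>?S\<^esub> g) \<otimes>\<^bsub>?S\<^esub> h = f \<otimes>\<^bsub>?S\<^esub> h \<oplus>\<^bsub>?S\<^esub> g \<otimes>\<^bsub>?S\<^esub> h"
    unfolding section_ring_simps
    by (rule restrict_ext) (simp add: val[OF c(1)] val[OF c(2)] val[OF c(3)] cring.cring_simprules(13)[OF H])
qed

lemma section_ring_minus:
  assumes V: "V \<subseteq> spectrum A nrm" and f: "f \<in> uniform_sections A V"
  shows "\<ominus>\<^bsub>section_ring A V\<^esub> f = (\<lambda>y\<in>V. \<ominus>\<^bsub>\<H> A y\<^esub> f y)"
proof -
  interpret S: cring "section_ring A V" by (rule cring_section_ring[OF V])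
  have "\<ominus>\<^bsub>\<H> A y\<^esub> f y \<oplus>\<^bsub>\<H> A y\<^esub> f y = \<zero>\<^bsub>\<H> A y\<^esub>" if "y \<in> V" for y
    using that V uniform_sections_value[OF f that] cring.cring_simprules(9)[OF cring_residue] by blast
  then have "(\<lambda>y\<in>V. \<ominus>\<^bsub>\<H> A y\<^esub> f y) \<oplus>\<^bsub>section_ring A V\<^esub> f = \<zero>\<^bsub>section_ring A V\<^esub>"
    by (auto intro!: restrict_ext)
  then show ?thesis using f uniform_sections_minus[OF V f] by (intro S.minus_equality) auto
qed

lemma section_ring_diff:
  assumes V: "V \<subseteq> spectrum A nrm" and f: "f \<in> uniform_sections A V" and g: "g \<in> uniform_sections A V"
  shows "f \<ominus>\<^bsub>section_ring A V\<^esub> g = (\<lambda>y\<in>V. f y \<ominus>\<^bsub>\<H> A y\<^esub> g y)"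
  unfolding a_minus_def[of "section_ring A V"] section_ring_minus[OF V g]
  by (auto intro!: restrict_ext simp: a_minus_def)

lemma sup_norm_le_iff:
  assumes "f \<in> uniform_sections A V" "V \<noteq> {}"
  shows "sup_norm V f \<le> c \<longleftrightarrow> (\<forall>y\<in>V. residue_abs y (f y) \<le> c)"
proof -
  obtain M where "\<And>y. y \<in> V \<Longrightarrow> residue_abs y (f y) \<le> M" using uniform_sections_bounded[OF assms(1)] by blast
  then have "bdd_above ((\<lambda>y. residue_abs y (f y)) ` V)" by (auto intro!: bdd_aboveI2)
  then show ?thesis unfolding sup_norm_def using assms(2) by (simp add: cSUP_le_iff)
qed

lemma sup_norm_ge: "f \<in> uniform_sections A V \<Longrightarrow> y \<in> V \<Longrightarrow> residue_abs y (f y) \<le> sup_norm V f"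
  using sup_norm_le_iff[of f V "sup_norm V f"] by auto

text \<open>A Cauchy sequence converges at each point because \<open>\<H> A y\<close> is complete, and uniformly because the
  Cauchy condition is uniform; approximability by fractions passes to uniform limits.\<close>

theorem banach_ring_section_ring:
  assumes V: "V \<subseteq> spectrum A nrm" "V \<noteq> {}"
  shows "banach_ring (section_ring A V) (sup_norm V)"
proof -
  let ?S = "section_ring A V"
  interpret S: cring ?S by (rule cring_section_ring[OF V(1)])
  have H: "valued_field (\<H> A y) (residue_abs y)" if "y \<in> V" for y using that V field_residue by blast
  note val = uniform_sections_value
  have nonneg: "0 \<le> sup_norm V f" if f: "f \<in> carrier ?S" for f
  proof -
    obtain y where y: "y \<in> V" using V by blast
    have "0 \<le> residue_abs y (f y)" using valued_field.v_nonneg[OF H[OF y] val[OF _ y]] f by simp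
    then show ?thesis using sup_norm_ge[OF _ y, of f] f by simp
  qed
  note ge = sup_norm_ge
  show ?thesis
  proof (rule banach_ring.intro[OF S.is_cring], unfold_locales)
    fix f g assume f: "f \<in> carrier ?S"
    show "0 \<le> sup_norm V f" using nonneg[OF f] .
    show "sup_norm V f = 0 \<longleftrightarrow> f = \<zero>\<^bsub>?S\<^esub>"
    proof
      assume 0: "sup_norm V f = 0"
      have "f y = \<zero>\<^bsub>\<H> A y\<^esub>" if y: "y \<in> V" for y
      proof -
        interpret H: valued_field "\<H> A y" "residue_abs y" by (rule H[OF y])
        have "residue_abs y (f y) \<le> 0" using ge[OF _ y, of f] f 0 by simp
        then show ?thesis using H.v_nonneg H.v_eq_0_iff val[OF _ y] f by (metis antisym section_ring_simps(1))
      qed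
      then show "f = \<zero>\<^bsub>?S\<^esub>"
        using f uniform_sections_const(2)[OF V(1)] by (intro uniform_sections_ext[of f A V]) auto
    next
      assume 0: "f = \<zero>\<^bsub>?S\<^esub>"
      have "residue_abs y (f y) \<le> 0" if y: "y \<in> V" for y
      proof -
        interpret H: valued_field "\<H> A y" "residue_abs y" by (rule H[OF y])
        show ?thesis using 0 y by simp
      qed
      then have "sup_norm V f \<le> 0" using sup_norm_le_iff[of f V 0] f V by simp
      then show "sup_norm V f = 0" using nonneg[OF f] by simp
    qed
    have "residue_abs y (\<ominus>\<^bsub>\<H> A y\<^esub> f y) = residue_abs y (f y)" if y: "y \<in> V" for y
    proof -
      interpret H: valued_field "\<H> A y" "residue_abs y" by (rule H[OF y])
      show ?thesis using H.v_minus[OF val[OF _ y, of f A]] f by simp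
    qed
    then show "sup_norm V (\<ominus>\<^bsub>?S\<^esub> f) = sup_norm V f"
      using f section_ring_minus[OF V(1)] by (simp add: sup_norm_def cong: SUP_cong_simp)
    assume g: "g \<in> carrier ?S"
    have "residue_abs y (f y \<oplus>\<^bsub>\<H> A y\<^esub> g y) \<le> sup_norm V f + sup_norm V g" if y: "y \<in> V" for y
    proof -
      interpret H: valued_field "\<H> A y" "residue_abs y" by (rule H[OF y])
      show ?thesis using H.v_triangle[of "f y" "g y"] val[OF _ y] f g ge[OF _ y, of f] ge[OF _ y, of g] by force
    qed
    then show "sup_norm V (f \<oplus>\<^bsub>?S\<^esub> g) \<le> sup_norm V f + sup_norm V g"
      using f g uniform_sections_add[OF V(1)] V by (subst sup_norm_le_iff) auto
    have "residue_abs y (f y \<otimes>\<^bsub>\<H> A y\<^esub> g y) \<le> sup_norm V f * sup_norm V g" if y: "y \<in> V" for y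
    proof -
      interpret H: valued_field "\<H> A y" "residue_abs y" by (rule H[OF y])
      have fg: "f y \<in> carrier (\<H> A y)" "g y \<in> carrier (\<H> A y)" using f g val[OF _ y] by auto
      then have "residue_abs y (f y \<otimes>\<^bsub>\<H> A y\<^esub> g y) = residue_abs y (f y) * residue_abs y (g y)"
        by (rule H.v_mult)
      also have "\<dots> \<le> sup_norm V f * sup_norm V g"
        using ge[OF _ y, of f] ge[OF _ y, of g] f g nonneg fg H.v_nonneg by (intro mult_mono) auto
      finally show ?thesis .
    qed
    then show "sup_norm V (f \<otimes>\<^bsub>?S\<^esub> g) \<le> sup_norm V f * sup_norm V g"
      using f g uniform_sections_mult[OF V(1)] V by (subst sup_norm_le_iff) auto
  next
    fix \<sigma> assume \<sigma>: "\<And>i::nat. \<sigma> i \<in> carrier ?S"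
      and Cauchy: "\<And>\<epsilon>. \<epsilon> > 0 \<Longrightarrow> \<exists>N. \<forall>i\<ge>N. \<forall>j\<ge>N. sup_norm V (\<sigma> i \<ominus>\<^bsub>?S\<^esub> \<sigma> j) < \<epsilon>"
    have \<sigma>U: "\<sigma> i \<in> uniform_sections A V" for i using \<sigma> by simp
    have dU: "\<sigma> i \<ominus>\<^bsub>?S\<^esub> \<sigma> j \<in> uniform_sections A V" for i j using S.minus_closed[OF \<sigma> \<sigma>] by simp
    have pt: "residue_abs y (\<sigma> i y \<ominus>\<^bsub>\<H> A y\<^esub> \<sigma> j y) \<le> sup_norm V (\<sigma> i \<ominus>\<^bsub>?S\<^esub> \<sigma> j)" if y: "y \<in> V" for i j y
      using ge[OF dU y] section_ring_diff[OF V(1) \<sigma>U \<sigma>U] y by simp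
    have "\<exists>l\<in>carrier (\<H> A y). (\<lambda>i. residue_abs y (\<sigma> i y \<ominus>\<^bsub>\<H> A y\<^esub> l)) \<longlonglongrightarrow> 0" if y: "y \<in> V" for y
    proof -
      interpret H: banach_ring "\<H> A y" "residue_abs y"
        using V y by (intro spectrum_point.banach_ring_residue[OF spectrum_pointI]) auto
      show ?thesis
      proof (rule H.complete)
        show "\<sigma> i y \<in> carrier (\<H> A y)" for i using val[OF \<sigma>U y] .
        show "\<exists>N. \<forall>i\<ge>N. \<forall>j\<ge>N. residue_abs y (\<sigma> i y \<ominus>\<^bsub>\<H> A y\<^esub> \<sigma> j y) < \<epsilon>" if "\<epsilon> > 0" for \<epsilon>
          using Cauchy[OF that] pt[OF y] by (meson le_less_trans)
      qed
    qed
    then obtain l' where l': "\<And>y. y \<in> V \<Longrightarrow> l' y \<in> carrier (\<H> A y) \<and> (\<lambda>i. residue_abs y (\<sigma> i y \<ominus>\<^bsub>\<H> A y\<^esub> l' y)) \<longlonglongrightarrow> 0"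
      by metis
    define l where "l = restrict l' V"
    have l: "l y \<in> carrier (\<H> A y)" "(\<lambda>i. residue_abs y (\<sigma> i y \<ominus>\<^bsub>\<H> A y\<^esub> l y)) \<longlonglongrightarrow> 0" if "y \<in> V" for y
      using l'[OF that] that by (simp_all add: l_def)
    have unif: "\<exists>N. \<forall>i\<ge>N. \<forall>y\<in>V. residue_abs y (\<sigma> i y \<ominus>\<^bsub>\<H> A y\<^esub> l y) \<le> \<epsilon>" if "\<epsilon> > 0" for \<epsilon>
    proof -
      obtain N where N: "\<And>i j. i \<ge> N \<Longrightarrow> j \<ge> N \<Longrightarrow> sup_norm V (\<sigma> i \<ominus>\<^bsub>?S\<^esub> \<sigma> j) < \<epsilon>"
        using Cauchy[OF \<open>\<epsilon> > 0\<close>] by blast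
      have "residue_abs y (\<sigma> i y \<ominus>\<^bsub>\<H> A y\<^esub> l y) \<le> \<epsilon>" if "i \<ge> N" "y \<in> V" for i y
      proof -
        interpret H: valued_field "\<H> A y" "residue_abs y" by (rule H[OF that(2)])
        have lim: "(\<lambda>j. \<epsilon> + residue_abs y (\<sigma> j y \<ominus>\<^bsub>\<H> A y\<^esub> l y)) \<longlonglongrightarrow> \<epsilon> + 0"
          by (intro tendsto_add tendsto_const l that)
        moreover have "residue_abs y (\<sigma> i y \<ominus>\<^bsub>\<H> A y\<^esub> l y) \<le> \<epsilon> + residue_abs y (\<sigma> j y \<ominus>\<^bsub>\<H> A y\<^esub> l y)" if j: "j \<ge> N" for j
          using H.norm_diff_trans[OF val[OF \<sigma>U \<open>y \<in> V\<close>] val[OF \<sigma>U \<open>y \<in> V\<close>] l(1)[OF \<open>y \<in> V\<close>], of i j]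
            pt[OF \<open>y \<in> V\<close>, of i j] N[OF \<open>i \<ge> N\<close> j] by linarith
        ultimately have "residue_abs y (\<sigma> i y \<ominus>\<^bsub>\<H> A y\<^esub> l y) \<le> \<epsilon> + 0"
          by (intro LIMSEQ_le_const[OF lim]) blast
        then show ?thesis by simp
      qed
      then show ?thesis by blast
    qed
    have lU: "l \<in> uniform_sections A V"
    proof -
      have near: "residue_abs y (l y \<ominus>\<^bsub>\<H> A y\<^esub> z) \<le> residue_abs y (\<sigma> i y \<ominus>\<^bsub>\<H> A y\<^esub> l y) + residue_abs y (\<sigma> i y \<ominus>\<^bsub>\<H> A y\<^esub> z)"
        if y: "y \<in> V" and z: "z \<in> carrier (\<H> A y)" for i y z
      proof -
        interpret H: valued_field "\<H> A y" "residue_abs y" by (rule H[OF y])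
        show ?thesis using H.norm_diff_trans[OF l(1)[OF y] val[OF \<sigma>U y] z, of i]
          H.norm_diff_commute[OF l(1)[OF y] val[OF \<sigma>U y], of i] by simp
      qed
      obtain N where N: "\<And>y. y \<in> V \<Longrightarrow> residue_abs y (\<sigma> N y \<ominus>\<^bsub>\<H> A y\<^esub> l y) \<le> 1" using unif[of 1] by auto
      obtain M where M: "\<And>y. y \<in> V \<Longrightarrow> residue_abs y (\<sigma> N y) \<le> M" using uniform_sections_bounded[OF \<sigma>U] by blast
      have "residue_abs y (l y) \<le> 1 + M" if y: "y \<in> V" for y
      proof -
        interpret H: valued_field "\<H> A y" "residue_abs y" by (rule H[OF y])
        show ?thesis using H.norm_le_diff[OF l(1)[OF y] val[OF \<sigma>U y], of N]
          H.norm_diff_commute[OF l(1)[OF y] val[OF \<sigma>U y], of N] N[OF y] M[OF y] by simp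
      qed
      moreover have "\<exists>a\<in>carrier A. \<exists>s\<in>carrier A. (\<forall>y\<in>V. y s \<noteq> 0) \<and>
          (\<forall>y\<in>V. residue_abs y (l y \<ominus>\<^bsub>\<H> A y\<^esub> fraction_value A y a s) < \<epsilon>)" if "\<epsilon> > 0" for \<epsilon>
      proof -
        have \<epsilon>2: "\<epsilon> / 2 > 0" using that by simp
        obtain N where N: "\<And>y. y \<in> V \<Longrightarrow> residue_abs y (\<sigma> N y \<ominus>\<^bsub>\<H> A y\<^esub> l y) \<le> \<epsilon> / 2" using unif[OF \<epsilon>2] by auto
        obtain a s where as: "a \<in> carrier A" "s \<in> carrier A" "\<And>y. y \<in> V \<Longrightarrow> y s \<noteq> 0"
          "\<And>y. y \<in> V \<Longrightarrow> residue_abs y (\<sigma> N y \<ominus>\<^bsub>\<H> A y\<^esub> fraction_value A y a s) < \<epsilon> / 2"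
          using uniform_sections_approx[OF \<sigma>U \<epsilon>2] by blast
        have "residue_abs y (l y \<ominus>\<^bsub>\<H> A y\<^esub> fraction_value A y a s) < \<epsilon>" if y: "y \<in> V" for y
        proof -
          have "fraction_value A y a s \<in> carrier (\<H> A y)"
            using as y V by (intro spectrum_point.fraction_value_closed[OF spectrum_pointI]) auto
          then show ?thesis using near[OF y, of _ N] N[OF y] as(4)[OF y] by force
        qed
        then show ?thesis using as by blast
      qed
      ultimately show ?thesis using l(1) by (auto simp: uniform_sections_def l_def)
    qed
    have "(\<lambda>i. sup_norm V (\<sigma> i \<ominus>\<^bsub>?S\<^esub> l)) \<longlonglongrightarrow> 0"
    proof (rule LIMSEQ_I)
      fix \<epsilon> :: real assume \<epsilon>: "\<epsilon> > 0"
      then obtain N where N: "\<And>i y. i \<ge> N \<Longrightarrow> y \<in> V \<Longrightarrow> residue_abs y (\<sigma> i y \<ominus>\<^bsub>\<H> A y\<^esub> l y) \<le> \<epsilon> / 2"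
        using unif[of "\<epsilon> / 2"] by auto
      have dl: "\<sigma> i \<ominus>\<^bsub>?S\<^esub> l \<in> carrier ?S" for i using S.minus_closed[OF \<sigma>, of l i] lU by simp
      have "sup_norm V (\<sigma> i \<ominus>\<^bsub>?S\<^esub> l) \<le> \<epsilon> / 2" if "i \<ge> N" for i
        using sup_norm_le_iff[of "\<sigma> i \<ominus>\<^bsub>?S\<^esub> l" V "\<epsilon> / 2"] dl[of i] N[OF that] V section_ring_diff[OF V(1) \<sigma>U lU] by simp
      then have "norm (sup_norm V (\<sigma> i \<ominus>\<^bsub>?S\<^esub> l) - 0) < \<epsilon>" if "i \<ge> N" for i
        using nonneg[OF dl, of i] \<epsilon> that by force
      then show "\<exists>N. \<forall>i\<ge>N. norm (sup_norm V (\<sigma> i \<ominus>\<^bsub>?S\<^esub> l) - 0) < \<epsilon>" by blast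
    qed
    then show "\<exists>l\<in>carrier ?S. (\<lambda>i. sup_norm V (\<sigma> i \<ominus>\<^bsub>?S\<^esub> l)) \<longlonglongrightarrow> 0" using lU by auto
  qed
qed

end

section \<open>The stalk as a limit of Banach rings\<close>

context banach_ring
begin

lemma openin_value:
  assumes "f \<in> carrier A" "open T"
  shows "openin (spectrum_topology A nrm) {y \<in> spectrum A nrm. y f \<in> T}"
  unfolding spectrum_topology_def
  by (rule topology_generated_by_Basis) (use assms in blast)

lemma topspace_spectrum [simp]: "topspace (spectrum_topology A nrm) = spectrum A nrm"
proof
  show "topspace (spectrum_topology A nrm) \<subseteq> spectrum A nrm"
    by (auto simp: spectrum_topology_def topology_generated_by_topspace)
  show "spectrum A nrm \<subseteq> topspace (spectrum_topology A nrm)"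
    using openin_subset[OF openin_value[OF zero_closed open_UNIV]] by simp
qed

lemma openin_spectrum: "openin (spectrum_topology A nrm) (spectrum A nrm)"
  using openin_topspace[of "spectrum_topology A nrm"] by simp

text \<open>Openness is reduced to the values of single elements of \<open>A\<close> by a number \<open>r\<close> with
  \<open>y a < r < d * y s\<close>.\<close>

lemma openin_less:
  fixes d :: real
  assumes "a \<in> carrier A" "s \<in> carrier A"
  shows "openin (spectrum_topology A nrm) {y \<in> spectrum A nrm. y a < d * y s}"
proof -
  let ?O = "\<lambda>r. {y \<in> spectrum A nrm. y a \<in> {..<r}} \<inter> {y \<in> spectrum A nrm. y s \<in> {t. r < d * t}}"
  have "open {t. r < d * t}" for r :: real by (intro open_Collect_less continuous_intros)
  then have "openin (spectrum_topology A nrm) (?O r)" for r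
    using assms by (intro openin_Int openin_value) auto
  then have "openin (spectrum_topology A nrm) (\<Union>r. ?O r)" by blast
  moreover have "(\<Union>r. ?O r) = {y \<in> spectrum A nrm. y a < d * y s}"
    using dense by fastforce
  ultimately show ?thesis by simp
qed

text \<open>The absolute value of a uniform section is within any \<open>e > 0\<close> of that of a fraction \<open>a / s\<close>, and
  \<open>y a / y s\<close> depends continuously on \<open>y\<close>.\<close>

lemma uniform_section_small_near:
  assumes V: "openin (spectrum_topology A nrm) V" and b: "b \<in> V" and f: "f \<in> uniform_sections A V"
    and less: "residue_abs b (f b) < c"
  shows "\<exists>W. openin (spectrum_topology A nrm) W \<and> b \<in> W \<and> W \<subseteq> V \<and> (\<forall>y\<in>W. residue_abs y (f y) < c)"
proof -
  have VS: "V \<subseteq> spectrum A nrm" using openin_subset[OF V] by simp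
  define e where "e = (c - residue_abs b (f b)) / 3"
  define d where "d = residue_abs b (f b) + 2 * e"
  have e: "e > 0" "d + e = c" using less by (simp_all add: e_def d_def field_simps)
  obtain a s where as: "a \<in> carrier A" "s \<in> carrier A" "\<And>y. y \<in> V \<Longrightarrow> y s \<noteq> 0"
    "\<And>y. y \<in> V \<Longrightarrow> residue_abs y (f y \<ominus>\<^bsub>\<H> A y\<^esub> fraction_value A y a s) < e"
    using uniform_sections_approx[OF f e(1)] by blast
  have pos: "0 < y s" if "y \<in> V" for y
    using as(3)[OF that] spectrum_point.pt_nonneg[OF spectrum_pointI as(2)] VS that by force
  have abs: "residue_abs y (fraction_value A y a s) = y a / y s"
    "\<bar>residue_abs y (f y) - y a / y s\<bar> < e" if y: "y \<in> V" for y
  proof -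
    interpret P: spectrum_point A nrm y using y VS by (intro spectrum_pointI) auto
    interpret H: valued_field "\<H> A y" "residue_abs y" using y VS by (intro field_residue) auto
    show 1: "residue_abs y (fraction_value A y a s) = y a / y s"
      using as y by (intro P.fraction_value_abs) auto
    show "\<bar>residue_abs y (f y) - y a / y s\<bar> < e"
      using H.norm_reverse_triangle[of "f y" "fraction_value A y a s"] as(1,2) as(3,4)[OF y]
        uniform_sections_value[OF f y] 1 by simp
  qed
  let ?W = "V \<inter> {y \<in> spectrum A nrm. y a < d * y s}"
  have "openin (spectrum_topology A nrm) ?W" using V openin_less[OF as(1,2)] by blast
  moreover have "b \<in> ?W"
  proof -
    have "b a / b s < d" using abs(2)[OF b] by (simp add: d_def)
    then show ?thesis using pos[OF b] b VS by (auto simp: pos_divide_less_eq)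
  qed
  moreover have "residue_abs y (f y) < c" if "y \<in> ?W" for y
  proof -
    have "y a / y s < d" using that pos[of y] by (simp add: pos_divide_less_eq)
    then show ?thesis using abs(2)[of y] that e(2) by auto
  qed
  ultimately show ?thesis by blast
qed

text \<open>A section becomes bounded where the denominator \<open>s\<close> of one approximating fraction has absolute
  value more than \<open>x s / 2\<close>, since numerators are bounded by their norm.\<close>

lemma sections_locally_uniform:
  assumes U: "openin (spectrum_topology A nrm) U" and f: "f \<in> sections A nrm U" and x: "x \<in> U"
  obtains V where "openin (spectrum_topology A nrm) V" "x \<in> V" "V \<subseteq> U" "restrict f V \<in> uniform_sections A V"
proof -
  obtain V where V: "openin (spectrum_topology A nrm) V" "x \<in> V" "V \<subseteq> U"
    and ap: "\<forall>\<epsilon>>0. \<exists>a\<in>carrier A. \<exists>s\<in>carrier A. (\<forall>y\<in>V. y s \<noteq> 0) \<and>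
          (\<forall>y\<in>V. residue_abs y (f y \<ominus>\<^bsub>\<H> A y\<^esub> fraction_value A y a s) < \<epsilon>)"
    using f x unfolding sections_def by blast
  have fH: "f y \<in> carrier (\<H> A y)" if "y \<in> U" for y using f that by (auto simp: sections_def)
  have VS: "V \<subseteq> spectrum A nrm" using openin_subset[OF V(1)] by simp
  obtain a s where as: "a \<in> carrier A" "s \<in> carrier A" "\<forall>y\<in>V. y s \<noteq> 0"
    "\<forall>y\<in>V. residue_abs y (f y \<ominus>\<^bsub>\<H> A y\<^esub> fraction_value A y a s) < 1"
    using ap zero_less_one by meson
  have xs: "0 < x s" using as(2,3) V(2) VS spectrum_point.pt_nonneg[OF spectrum_pointI as(2), of x] by force
  define W where "W = V \<inter> {y \<in> spectrum A nrm. y s \<in> {x s / 2<..}}"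
  have W: "openin (spectrum_topology A nrm) W" "x \<in> W" "W \<subseteq> V"
    using V(1,2) VS openin_value[OF as(2), of "{x s / 2<..}"] xs by (auto simp: W_def)
  have "residue_abs y (f y) \<le> 1 + nrm a / (x s / 2)" if y: "y \<in> W" for y
  proof -
    have yV: "y \<in> V" using y W by blast
    interpret P: spectrum_point A nrm y using yV VS by (intro spectrum_pointI) auto
    interpret H: valued_field "\<H> A y" "residue_abs y" using yV VS by (intro field_residue) auto
    have ys: "y s > x s / 2" "y s \<noteq> 0" using y as(3) by (auto simp: W_def)
    have "residue_abs y (f y) \<le> 1 + y a / y s"
      using H.norm_le_diff[of "f y" "fraction_value A y a s"] as(1,2,4) yV V(3) fH ys
      by (force simp: P.fraction_value_abs)
    also have "y a / y s \<le> nrm a / (x s / 2)"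
      using P.pt_le[OF as(1)] P.pt_nonneg[OF as(1)] ys xs by (intro frac_le) auto
    finally show ?thesis by simp
  qed
  then have bd: "\<exists>M. \<forall>y\<in>W. residue_abs y (restrict f W y) \<le> M" by (intro exI ballI) simp
  have "\<exists>a\<in>carrier A. \<exists>s\<in>carrier A. (\<forall>y\<in>W. y s \<noteq> 0) \<and>
          (\<forall>y\<in>W. residue_abs y (restrict f W y \<ominus>\<^bsub>\<H> A y\<^esub> fraction_value A y a s) < \<epsilon>)" if "\<epsilon> > 0" for \<epsilon>
  proof -
    obtain a s where "a \<in> carrier A" "s \<in> carrier A" "\<forall>y\<in>V. y s \<noteq> 0"
      "\<forall>y\<in>V. residue_abs y (f y \<ominus>\<^bsub>\<H> A y\<^esub> fraction_value A y a s) < \<epsilon>"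
      using ap \<open>\<epsilon> > 0\<close> by meson
    then show ?thesis using W(3) by (intro bexI[of _ a] bexI[of _ s]) auto
  qed
  moreover have "restrict f W \<in> (\<Pi>\<^sub>E y\<in>W. carrier (\<H> A y))" using fH V(3) W(3) by auto
  ultimately have "restrict f W \<in> uniform_sections A W" using bd by (simp add: uniform_sections_def)
  then show ?thesis using that[of W] W V(3) by blast
qed

lemma sectionsI:
  assumes "f \<in> (\<Pi>\<^sub>E y\<in>U. carrier (\<H> A y))"
    and "\<And>x. x \<in> U \<Longrightarrow> \<exists>V. openin (spectrum_topology A nrm) V \<and> x \<in> V \<and> V \<subseteq> U \<and>
      restrict f V \<in> uniform_sections A V"
  shows "f \<in> sections A nrm U"
proof -
  have "\<exists>V. openin (spectrum_topology A nrm) V \<and> x \<in> V \<and> V \<subseteq> U \<and>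
       (\<forall>\<epsilon>>0. \<exists>a\<in>carrier A. \<exists>s\<in>carrier A. (\<forall>y\<in>V. y s \<noteq> 0) \<and>
          (\<forall>y\<in>V. residue_abs y (f y \<ominus>\<^bsub>\<H> A y\<^esub> fraction_value A y a s) < \<epsilon>))" if x: "x \<in> U" for x
  proof -
    obtain V where V: "openin (spectrum_topology A nrm) V" "x \<in> V" "V \<subseteq> U"
      "restrict f V \<in> uniform_sections A V" using assms(2)[OF x] by blast
    have "\<exists>a\<in>carrier A. \<exists>s\<in>carrier A. (\<forall>y\<in>V. y s \<noteq> 0) \<and>
          (\<forall>y\<in>V. residue_abs y (f y \<ominus>\<^bsub>\<H> A y\<^esub> fraction_value A y a s) < \<epsilon>)" if "\<epsilon> > 0" for \<epsilon>
    proof -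
      obtain a s where "a \<in> carrier A" "s \<in> carrier A" "\<And>y. y \<in> V \<Longrightarrow> y s \<noteq> 0"
        "\<And>y. y \<in> V \<Longrightarrow> residue_abs y (restrict f V y \<ominus>\<^bsub>\<H> A y\<^esub> fraction_value A y a s) < \<epsilon>"
        using uniform_sections_approx[OF V(4) \<open>\<epsilon> > 0\<close>] by blast
      then show ?thesis by (intro bexI[of _ a] bexI[of _ s]) auto
    qed
    then show ?thesis using V by blast
  qed
  then show ?thesis using assms(1) by (simp add: sections_def)
qed

end

text \<open>A ring law involves at most three elements. It therefore holds in \<open>R\<close> when any three elements of \<open>R\<close>
  are images of elements of a commutative ring, which may depend on them.\<close>

lemma cring_of_lifts:
  fixes R (structure)
  assumes zero: "\<zero> \<in> carrier R"
    and lift: "\<And>a b c. a \<in> carrier R \<Longrightarrow> b \<in> carrier R \<Longrightarrow> c \<in> carrier R \<Longrightarrow>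
      \<exists>S h. cring (S :: ('s, 't) ring_scheme) \<and> h \<in> ring_hom S R \<and> h \<zero>\<^bsub>S\<^esub> = \<zero> \<and> {a, b, c} \<subseteq> h ` carrier S"
  shows "cring R"
proof -
  have lift': "\<exists>S h p q r. cring (S :: ('s, 't) ring_scheme) \<and> h \<in> ring_hom S R \<and> h \<zero>\<^bsub>S\<^esub> = \<zero> \<and> p \<in> carrier S \<and> q \<in> carrier S \<and>
      r \<in> carrier S \<and> a = h p \<and> b = h q \<and> c = h r"
    if abc: "a \<in> carrier R" "b \<in> carrier R" "c \<in> carrier R" for a b c
  proof -
    obtain S :: "('s, 't) ring_scheme" and h where S: "cring S" "h \<in> ring_hom S R" "h \<zero>\<^bsub>S\<^esub> = \<zero>" "{a, b, c} \<subseteq> h ` carrier S"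
      using lift[OF abc] by blast
    then obtain p q r where "p \<in> carrier S" "q \<in> carrier S" "r \<in> carrier S" "a = h p" "b = h q" "c = h r"
      by auto
    with S show ?thesis by (intro exI conjI)
  qed
  have three: "a \<oplus> b \<oplus> c = a \<oplus> (b \<oplus> c)" "a \<otimes> b \<otimes> c = a \<otimes> (b \<otimes> c)" "(a \<oplus> b) \<otimes> c = a \<otimes> c \<oplus> b \<otimes> c"
    if c: "a \<in> carrier R" "b \<in> carrier R" "c \<in> carrier R" for a b c
  proof -
    obtain S :: "('s, 't) ring_scheme" and h p q r where h: "cring S" "h \<in> ring_hom S R" "p \<in> carrier S" "q \<in> carrier S" "r \<in> carrier S"
      and eq: "a = h p" "b = h q" "c = h r" using lift'[OF c] by blast
    interpret S: cring S by fact
    note ops = ring_hom_add[OF h(2), symmetric] ring_hom_mult[OF h(2), symmetric]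
    show "a \<oplus> b \<oplus> c = a \<oplus> (b \<oplus> c)" "a \<otimes> b \<otimes> c = a \<otimes> (b \<otimes> c)" "(a \<oplus> b) \<otimes> c = a \<otimes> c \<oplus> b \<otimes> c"
      unfolding eq using h(3-5) by (simp_all add: ops S.a_assoc S.m_assoc S.l_distr)
  qed
  have two: "a \<oplus> b \<in> carrier R" "a \<otimes> b \<in> carrier R" "\<one> \<in> carrier R" "a \<oplus> b = b \<oplus> a" "a \<otimes> b = b \<otimes> a"
      "\<zero> \<oplus> a = a" "\<one> \<otimes> a = a" "\<exists>x\<in>carrier R. x \<oplus> a = \<zero>"
    if c: "a \<in> carrier R" "b \<in> carrier R" for a b
  proof -
    obtain S :: "('s, 't) ring_scheme" and h p q where h: "cring S" "h \<in> ring_hom S R" "p \<in> carrier S" "q \<in> carrier S"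
      and h0: "h \<zero>\<^bsub>S\<^esub> = \<zero>" and eq: "a = h p" "b = h q" using lift'[OF c c(1)] by blast
    interpret S: cring S by fact
    note ops = ring_hom_add[OF h(2), symmetric] ring_hom_mult[OF h(2), symmetric]
    show "a \<oplus> b \<in> carrier R" "a \<otimes> b \<in> carrier R" unfolding eq using h(3-4) by (simp_all add: ops ring_hom_closed[OF h(2)])
    show "\<one> \<in> carrier R" using ring_hom_closed[OF h(2) S.one_closed] ring_hom_one[OF h(2)] by simp
    show "a \<oplus> b = b \<oplus> a" "a \<otimes> b = b \<otimes> a" unfolding eq using h(3-4) by (simp_all add: ops S.a_comm S.m_comm)
    show "\<zero> \<oplus> a = a" "\<one> \<otimes> a = a"
      unfolding eq h0[symmetric] ring_hom_one[OF h(2), symmetric] using h(3) by (simp_all add: ops)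
    have "h (\<ominus>\<^bsub>S\<^esub> p) \<oplus> a = \<zero>"
      unfolding eq h0[symmetric] using h(3) by (simp add: ops S.l_neg)
    then show "\<exists>x\<in>carrier R. x \<oplus> a = \<zero>" using ring_hom_closed[OF h(2) S.a_inv_closed[OF h(3)]] by blast
  qed
  show ?thesis
    by (intro cringI abelian_groupI comm_monoidI; fact zero three two two(3)[OF zero zero] two(6-8)[OF _ zero])
qed

locale stalk_point = spectrum_point A nrm b for A :: "('a, 'm) ring_scheme" (structure) and nrm b
begin

definition nbhd :: "('a \<Rightarrow> real) set \<Rightarrow> bool" where
  "nbhd V \<longleftrightarrow> openin (spectrum_topology A nrm) V \<and> b \<in> V"

lemma nbhd_subset: "nbhd V \<Longrightarrow> V \<subseteq> spectrum A nrm"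
  using openin_subset unfolding nbhd_def by fastforce

lemma nbhd_Int: "nbhd V \<Longrightarrow> nbhd W \<Longrightarrow> nbhd (V \<inter> W)"
  by (auto simp: nbhd_def)

lemma nbhd_spectrum: "nbhd (spectrum A nrm)"
  using openin_spectrum in_spectrum by (simp add: nbhd_def)

abbreviation near where "near \<equiv> sections_near A nrm b"
abbreviation gm where "gm \<equiv> germ A nrm b"
abbreviation \<O>\<^sub>b where "\<O>\<^sub>b \<equiv> \<O> A nrm b"
abbreviation \<H>\<^sub>b where "\<H>\<^sub>b \<equiv> \<H> A b"

lemma near_iff: "(U, f) \<in> near \<longleftrightarrow> nbhd U \<and> f \<in> sections A nrm U"
  by (auto simp: sections_near_def nbhd_def)

lemma germ_iff:
  "(V, g) \<in> gm U f \<longleftrightarrow> (V, g) \<in> near \<and> (\<exists>W. nbhd W \<and> W \<subseteq> U \<inter> V \<and> (\<forall>y\<in>W. f y = g y))"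
  by (auto simp: germ_def nbhd_def)

lemma germ_self: "(U, f) \<in> near \<Longrightarrow> (U, f) \<in> gm U f"
  unfolding germ_iff by (auto simp: near_iff)

lemma germ_subset:
  assumes "nbhd W" "W \<subseteq> U \<inter> V" "\<forall>y\<in>W. f y = g y"
  shows "gm U f \<subseteq> gm V g"
proof
  fix z assume z: "z \<in> gm U f"
  obtain V' g' where zz: "z = (V', g')" by (cases z)
  have "(V', g') \<in> gm U f" using z zz by simp
  then obtain W' where W': "nbhd W'" "W' \<subseteq> U \<inter> V'" "\<forall>y\<in>W'. f y = g' y" "(V', g') \<in> near"
    unfolding germ_iff by blast
  have "nbhd (W \<inter> W')" "W \<inter> W' \<subseteq> V \<inter> V'" "\<forall>y\<in>W \<inter> W'. g y = g' y"
    using assms W' nbhd_Int by auto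
  then show "z \<in> gm V g" unfolding zz germ_iff using W'(4) by blast
qed

lemma germ_eqI:
  assumes "nbhd W" "W \<subseteq> U \<inter> V" "\<And>y. y \<in> W \<Longrightarrow> f y = g y"
  shows "gm U f = gm V g"
proof
  show "gm U f \<subseteq> gm V g" by (rule germ_subset[OF assms(1,2)]) (use assms in simp)
  show "gm V g \<subseteq> gm U f" by (rule germ_subset[OF assms(1)]) (use assms in auto)
qed

lemma germ_value_germ:
  assumes "(U, f) \<in> near"
  shows "germ_value b (gm U f) = f b"
  unfolding germ_value_def
proof (rule the_elem_image_const)
  show "gm U f \<noteq> {}" using germ_self[OF assms] by blast
  fix z assume "z \<in> gm U f"
  then show "(case z of (U, f) \<Rightarrow> f b) = f b"
    by (cases z) (auto simp: germ_iff nbhd_def)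
qed

lemma stalk_binary:
  assumes Uf: "(U, f) \<in> near" and Vg: "(V, g) \<in> near"
  shows "(\<Union>(U', f')\<in>gm U f. \<Union>(V', g')\<in>gm V g. gm (U' \<inter> V') (\<lambda>y\<in>U' \<inter> V'. opn y (f' y) (g' y))) =
    gm (U \<inter> V) (\<lambda>y\<in>U \<inter> V. opn y (f y) (g y))"
proof (rule UN_pairs_eq_value)
  show "gm U f \<noteq> {}" "gm V g \<noteq> {}" using germ_self Uf Vg by blast+
  fix U' f' V' g' assume "(U', f') \<in> gm U f" "(V', g') \<in> gm V g"
  then obtain W W' where "nbhd W" "W \<subseteq> U \<inter> U'" "\<forall>y\<in>W. f y = f' y"
    "nbhd W'" "W' \<subseteq> V \<inter> V'" "\<forall>y\<in>W'. g y = g' y" unfolding germ_iff by blast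
  then show "gm (U' \<inter> V') (\<lambda>y\<in>U' \<inter> V'. opn y (f' y) (g' y)) = gm (U \<inter> V) (\<lambda>y\<in>U \<inter> V. opn y (f y) (g y))"
    by (intro germ_eqI[of "W \<inter> W'"] nbhd_Int) auto
qed

lemma uniform_near:
  assumes "nbhd V" "f \<in> uniform_sections A V"
  shows "(V, f) \<in> near"
proof -
  have "f \<in> (\<Pi>\<^sub>E y\<in>V. carrier (\<H> A y))" using assms by (simp add: uniform_sections_def)
  moreover have "restrict f V = f" using calculation by (simp add: PiE_iff extensional_restrict)
  ultimately have "f \<in> sections A nrm V" using assms by (intro sectionsI) (auto simp: nbhd_def)
  then show ?thesis using assms near_iff by blast
qed

lemma stalk_carrier: "carrier \<O>\<^sub>b = {gm U f | U f. (U, f) \<in> near}"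
  by (simp add: stalk_def)

lemma germ_closed: "nbhd V \<Longrightarrow> f \<in> uniform_sections A V \<Longrightarrow> gm V f \<in> carrier \<O>\<^sub>b"
  using uniform_near stalk_carrier by blast

lemma germ_restrict:
  assumes "nbhd W" "W \<subseteq> V"
  shows "gm W (restrict f W) = gm V f"
  using assms by (intro germ_eqI[of W]) auto

lemma stalk_cases:
  assumes "\<phi> \<in> carrier \<O>\<^sub>b"
  obtains V f where "nbhd V" "f \<in> uniform_sections A V" "\<phi> = gm V f"
proof -
  obtain U f where U: "\<phi> = gm U f" "nbhd U" "f \<in> sections A nrm U"
    using assms by (auto simp: stalk_carrier near_iff)
  obtain V where V: "openin (spectrum_topology A nrm) V" "b \<in> V" "V \<subseteq> U" "restrict f V \<in> uniform_sections A V"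
    using sections_locally_uniform[of U f b] U unfolding nbhd_def by blast
  then have n: "nbhd V" by (simp add: nbhd_def)
  have "\<phi> = gm V (restrict f V)" unfolding U(1) by (rule germ_restrict[OF n V(3), symmetric])
  then show ?thesis by (rule that[OF n V(4)])
qed

lemma germ_mult:
  assumes V: "nbhd V" and f: "f \<in> uniform_sections A V" and g: "g \<in> uniform_sections A V"
  shows "gm V f \<otimes>\<^bsub>\<O>\<^sub>b\<^esub> gm V g = gm V (f \<otimes>\<^bsub>section_ring A V\<^esub> g)"
proof -
  have "gm V f \<otimes>\<^bsub>\<O>\<^sub>b\<^esub> gm V g =
      (\<Union>(U, f)\<in>gm V f. \<Union>(V, g)\<in>gm V g. gm (U \<inter> V) (\<lambda>y\<in>U \<inter> V. f y \<otimes>\<^bsub>\<H> A y\<^esub> g y))"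
    by (simp only: stalk_def monoid.simps ring.simps)
  also have "\<dots> = gm (V \<inter> V) (\<lambda>y\<in>V \<inter> V. f y \<otimes>\<^bsub>\<H> A y\<^esub> g y)"
    by (rule stalk_binary[OF uniform_near[OF V f] uniform_near[OF V g]])
  finally show ?thesis by (simp only: Int_absorb section_ring_simps)
qed

lemma germ_add:
  assumes V: "nbhd V" and f: "f \<in> uniform_sections A V" and g: "g \<in> uniform_sections A V"
  shows "gm V f \<oplus>\<^bsub>\<O>\<^sub>b\<^esub> gm V g = gm V (f \<oplus>\<^bsub>section_ring A V\<^esub> g)"
proof -
  have "gm V f \<oplus>\<^bsub>\<O>\<^sub>b\<^esub> gm V g =
      (\<Union>(U, f)\<in>gm V f. \<Union>(V, g)\<in>gm V g. gm (U \<inter> V) (\<lambda>y\<in>U \<inter> V. f y \<oplus>\<^bsub>\<H> A y\<^esub> g y))"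
    by (simp only: stalk_def monoid.simps ring.simps)
  also have "\<dots> = gm (V \<inter> V) (\<lambda>y\<in>V \<inter> V. f y \<oplus>\<^bsub>\<H> A y\<^esub> g y)"
    by (rule stalk_binary[OF uniform_near[OF V f] uniform_near[OF V g]])
  finally show ?thesis by (simp only: Int_absorb section_ring_simps)
qed

lemma germ_one:
  assumes "nbhd V"
  shows "gm V \<one>\<^bsub>section_ring A V\<^esub> = \<one>\<^bsub>\<O>\<^sub>b\<^esub>"
proof -
  have "\<one>\<^bsub>\<O>\<^sub>b\<^esub> = gm (spectrum A nrm) (\<lambda>y\<in>spectrum A nrm. \<one>\<^bsub>\<H> A y\<^esub>)" by (simp add: stalk_def)
  moreover have "gm V \<one>\<^bsub>section_ring A V\<^esub> = \<dots>"
    using nbhd_subset[OF assms] by (intro germ_eqI[OF assms]) auto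
  ultimately show ?thesis by simp
qed

lemma germ_zero:
  assumes "nbhd V"
  shows "gm V \<zero>\<^bsub>section_ring A V\<^esub> = \<zero>\<^bsub>\<O>\<^sub>b\<^esub>"
proof -
  have "\<zero>\<^bsub>\<O>\<^sub>b\<^esub> = gm (spectrum A nrm) (\<lambda>y\<in>spectrum A nrm. \<zero>\<^bsub>\<H> A y\<^esub>)" by (simp add: stalk_def)
  moreover have "gm V \<zero>\<^bsub>section_ring A V\<^esub> = \<dots>"
    using nbhd_subset[OF assms] by (intro germ_eqI[OF assms]) auto
  ultimately show ?thesis by simp
qed

lemma finite_germs_common:
  assumes "finite F" "F \<subseteq> carrier \<O>\<^sub>b"
  shows "\<exists>V. nbhd V \<and> (\<forall>\<phi>\<in>F. \<exists>f\<in>uniform_sections A V. gm V f = \<phi>)"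
  using assms
proof (induction rule: finite_induct)
  case empty
  then show ?case using nbhd_spectrum by blast
next
  case (insert \<phi> F)
  then obtain V where V: "nbhd V" "\<forall>\<psi>\<in>F. \<exists>f\<in>uniform_sections A V. gm V f = \<psi>" by blast
  obtain W f where W: "nbhd W" "f \<in> uniform_sections A W" "\<phi> = gm W f"
    using insert.prems by (meson insert_subset stalk_cases)
  have n: "nbhd (V \<inter> W)" using V W nbhd_Int by blast
  have "\<exists>h\<in>uniform_sections A (V \<inter> W). gm (V \<inter> W) h = \<psi>" if p: "\<psi> \<in> insert \<phi> F" for \<psi>
  proof (cases "\<psi> = \<phi>")
    case True
    have "gm (V \<inter> W) (restrict f (V \<inter> W)) = \<psi>"
      unfolding True W(3) by (rule germ_restrict[OF n Int_lower2])
    then show ?thesis using uniform_sections_restrict[OF W(2) Int_lower2] by blast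
  next
    case False
    then obtain h where h: "h \<in> uniform_sections A V" "gm V h = \<psi>" using V(2) p by blast
    have "gm (V \<inter> W) (restrict h (V \<inter> W)) = \<psi>"
      unfolding h(2)[symmetric] by (rule germ_restrict[OF n Int_lower1])
    then show ?thesis using uniform_sections_restrict[OF h(1) Int_lower1] by blast
  qed
  then show ?case using n by blast
qed

lemma germ_hom: "nbhd V \<Longrightarrow> gm V \<in> ring_hom (section_ring A V) \<O>\<^sub>b"
  by (rule ring_hom_memI) (simp_all add: germ_closed germ_mult germ_add germ_one del: section_ring_simps(2-))

lemma cring_stalk: "cring \<O>\<^sub>b"
proof (rule cring_of_lifts)
  show "\<zero>\<^bsub>\<O>\<^sub>b\<^esub> \<in> carrier \<O>\<^sub>b"
    using germ_closed[OF nbhd_spectrum uniform_sections_const(2)] germ_zero[OF nbhd_spectrum] by simp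
  fix \<phi> \<psi> \<theta> assume "\<phi> \<in> carrier \<O>\<^sub>b" "\<psi> \<in> carrier \<O>\<^sub>b" "\<theta> \<in> carrier \<O>\<^sub>b"
  then obtain V where V: "nbhd V" "\<forall>\<chi>\<in>{\<phi>, \<psi>, \<theta>}. \<exists>f\<in>uniform_sections A V. gm V f = \<chi>"
    using finite_germs_common[of "{\<phi>, \<psi>, \<theta>}"] by auto
  show "\<exists>S h. cring (S :: (('a \<Rightarrow> real) \<Rightarrow> 'a residue) ring) \<and> h \<in> ring_hom S \<O>\<^sub>b \<and> h \<zero>\<^bsub>S\<^esub> = \<zero>\<^bsub>\<O>\<^sub>b\<^esub> \<and> {\<phi>, \<psi>, \<theta>} \<subseteq> h ` carrier S"
    using V(2) cring_section_ring[OF nbhd_subset[OF V(1)]] germ_hom[OF V(1)] germ_zero[OF V(1)]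
    by (intro exI[of _ "section_ring A V"] exI[of _ "gm V"]) auto
qed

lemma germ_value_hom: "germ_value b \<in> ring_hom \<O>\<^sub>b \<H>\<^sub>b"
proof -
  have l: "\<exists>V f g. nbhd V \<and> f \<in> uniform_sections A V \<and> g \<in> uniform_sections A V \<and> \<phi> = gm V f \<and> \<psi> = gm V g"
    if "\<phi> \<in> carrier \<O>\<^sub>b" "\<psi> \<in> carrier \<O>\<^sub>b" for \<phi> \<psi>
    using finite_germs_common[of "{\<phi>, \<psi>}"] that by auto
  have v: "germ_value b (gm V f) = f b" if "nbhd V" "f \<in> uniform_sections A V" for V f
    using germ_value_germ[OF uniform_near[OF that]] .
  have bV: "b \<in> V" if "nbhd V" for V using that by (simp add: nbhd_def)
  show ?thesis
  proof (rule ring_hom_memI)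
    fix \<phi> \<psi> assume c: "\<phi> \<in> carrier \<O>\<^sub>b"
    then show "germ_value b \<phi> \<in> carrier \<H>\<^sub>b"
      using l[OF c c] v bV uniform_sections_value by metis
    assume "\<psi> \<in> carrier \<O>\<^sub>b"
    then obtain V f g where V: "nbhd V" "f \<in> uniform_sections A V" "g \<in> uniform_sections A V" "\<phi> = gm V f" "\<psi> = gm V g"
      using l[OF c] by blast
    show "germ_value b (\<phi> \<otimes>\<^bsub>\<O>\<^sub>b\<^esub> \<psi>) = germ_value b \<phi> \<otimes>\<^bsub>\<H>\<^sub>b\<^esub> germ_value b \<psi>"
      using V bV uniform_sections_mult[OF nbhd_subset, of V f g] by (simp add: germ_mult v)
    show "germ_value b (\<phi> \<oplus>\<^bsub>\<O>\<^sub>b\<^esub> \<psi>) = germ_value b \<phi> \<oplus>\<^bsub>\<H>\<^sub>b\<^esub> germ_value b \<psi>"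
      using V bV uniform_sections_add[OF nbhd_subset, of V f g] by (simp add: germ_add v)
  next
    show "germ_value b \<one>\<^bsub>\<O>\<^sub>b\<^esub> = \<one>\<^bsub>\<H>\<^sub>b\<^esub>"
      using v[OF nbhd_spectrum uniform_sections_const(1)] germ_one[OF nbhd_spectrum] bV[OF nbhd_spectrum] by simp
  qed
qed

lemma germ_value_uniform: "nbhd V \<Longrightarrow> f \<in> uniform_sections A V \<Longrightarrow> germ_value b (gm V f) = f b"
  using germ_value_germ uniform_near by blast

lemma restrict_hom:
  assumes "nbhd V" "W \<subseteq> V"
  shows "(\<lambda>f. restrict f W) \<in> ring_hom (section_ring A V) (section_ring A W)"
  using assms uniform_sections_restrict
  by (intro ring_hom_memI) (auto simp: fun_eq_iff restrict_def subset_iff)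

text \<open>A fraction whose denominator \<open>s\<close> does not vanish at \<open>b\<close> is a uniform section where \<open>s\<close> has absolute
  value more than \<open>b s / 2\<close>.\<close>

lemma germ_value_dense:
  assumes z: "z \<in> carrier \<H>\<^sub>b" and \<epsilon>: "\<epsilon> > 0"
  shows "\<exists>\<phi>\<in>carrier \<O>\<^sub>b. residue_abs b (germ_value b \<phi> \<ominus>\<^bsub>\<H>\<^sub>b\<^esub> z) < \<epsilon>"
proof -
  interpret H: valued_field "\<H> A b" "residue_abs b" by (rule valued_field_residue)
  obtain a s where as: "a \<in> carrier A" "s \<in> carrier A" "b s \<noteq> 0"
    "residue_abs b (z \<ominus>\<^bsub>\<H>\<^sub>b\<^esub> fraction_value A b a s) < \<epsilon>" using fraction_value_dense[OF z \<epsilon>] by blast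
  have bs: "0 < b s" using as pt_nonneg[of s] by simp
  define V where "V = {y \<in> spectrum A nrm. y s \<in> {b s / 2<..}}"
  have V: "nbhd V" using openin_value[OF as(2), of "{b s / 2<..}"] bs in_spectrum by (simp add: V_def nbhd_def)
  let ?f = "\<lambda>y\<in>V. fraction_value A y a s"
  have f: "?f \<in> uniform_sections A V"
    using bs as by (intro fraction_uniform_section[of V a s "b s / 2"]) (auto simp: V_def)
  have "germ_value b (gm V ?f) = fraction_value A b a s"
    using germ_value_uniform[OF V f] V by (simp add: nbhd_def)
  then have "residue_abs b (germ_value b (gm V ?f) \<ominus>\<^bsub>\<H>\<^sub>b\<^esub> z) < \<epsilon>"
    using as z H.norm_diff_commute[OF z, of "fraction_value A b a s"] by simp
  then show ?thesis using germ_closed[OF V f] by blast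
qed

end

section \<open>Lifting a coprime factorisation\<close>

context cring
begin

lemma divide_by_monic:
  assumes q: "q \<in> monics R n" and f: "f \<in> polys_below R (n + k)"
  shows "\<exists>w\<in>carrier (UP R). \<exists>r\<in>polys_below R n. f = w \<otimes>\<^bsub>UP R\<^esub> q \<oplus>\<^bsub>UP R\<^esub> r"
  using f
proof (induction k arbitrary: f)
  case 0
  interpret P: cring "UP R" by (rule cring_UP)
  have "f \<in> carrier (UP R)" "q \<in> carrier (UP R)" using 0 q polys_below_carrier monics_carrier by blast+
  then have "f = \<zero>\<^bsub>UP R\<^esub> \<otimes>\<^bsub>UP R\<^esub> q \<oplus>\<^bsub>UP R\<^esub> f" by simp
  then show ?case using 0 P.zero_closed by (metis add_0_right)
next
  case (Suc k)
  interpret P: cring "UP R" by (rule cring_UP)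
  interpret U: UP_cring R "UP R" by unfold_locales simp
  have qc: "q \<in> carrier (UP R)" and fc: "f \<in> carrier (UP R)"
    using Suc.prems q polys_below_carrier monics_carrier by blast+
  let ?c = "up_ring.monom (UP R) (f (n + k)) k"
  have cc: "?c \<in> carrier (UP R)" using fc by simp
  have cB: "?c \<in> polys_below R (Suc k)" using fc cc by (auto simp: polys_below_def)
  let ?g = "f \<ominus>\<^bsub>UP R\<^esub> q \<otimes>\<^bsub>UP R\<^esub> ?c"
  have "q \<otimes>\<^bsub>UP R\<^esub> ?c \<in> polys_below R (Suc n + k)"
    using polys_below_mult[OF subsetD[OF monics_below q] cB] .
  then have "?g \<in> polys_below R (Suc (n + k))"
    using Suc.prems by (intro polys_below_diff) auto
  moreover have "?g (n + k) = \<zero>"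
    using monics_mult_top[OF q cB] qc cc fc by (simp add: a_minus_def r_neg)
  ultimately have "?g \<in> polys_below R (n + k)"
    unfolding polys_below_def mem_Collect_eq by (metis le_antisym not_less_eq_eq)
  then obtain w r where wr: "w \<in> carrier (UP R)" "r \<in> polys_below R n" "?g = w \<otimes>\<^bsub>UP R\<^esub> q \<oplus>\<^bsub>UP R\<^esub> r"
    using Suc.IH by blast
  have rc: "r \<in> carrier (UP R)" using wr polys_below_carrier by blast
  have "f = ?g \<oplus>\<^bsub>UP R\<^esub> q \<otimes>\<^bsub>UP R\<^esub> ?c"
    using fc qc cc by (simp add: a_minus_def[of "UP R"] P.a_assoc P.l_neg)
  also have "\<dots> = (w \<oplus>\<^bsub>UP R\<^esub> ?c) \<otimes>\<^bsub>UP R\<^esub> q \<oplus>\<^bsub>UP R\<^esub> r"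
    unfolding wr(3) using wr(1) rc qc cc by (simp add: P.l_distr P.r_distr P.a_ac P.m_comm)
  finally show ?case using wr(2) P.a_closed[OF wr(1) cc] by blast
qed

lemma bezout_remainder_identity:
  assumes "x \<in> carrier R" "y \<in> carrier R" "p \<in> carrier R" "q \<in> carrier R" "t \<in> carrier R" "w \<in> carrier R" "u \<in> carrier R"
    and "x \<otimes> p \<oplus> y \<otimes> q = \<one>" "t \<otimes> y = w \<otimes> p \<oplus> u"
  shows "u \<otimes> q \<oplus> (t \<otimes> x \<oplus> w \<otimes> q) \<otimes> p = t"
proof -
  have "u \<otimes> q \<oplus> (t \<otimes> x \<oplus> w \<otimes> q) \<otimes> p = t \<otimes> (x \<otimes> p) \<oplus> (w \<otimes> p \<oplus> u) \<otimes> q"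
    using assms(1-7) by (simp add: l_distr r_distr m_ac a_ac)
  also have "\<dots> = t \<otimes> (x \<otimes> p \<oplus> y \<otimes> q)"
    unfolding assms(9)[symmetric] using assms(1-7) by (simp add: r_distr m_ac)
  finally show ?thesis unfolding assms(8) using assms(5) by simp
qed

lemma bezout_elimination_identity:
  assumes "u \<in> carrier R" "v \<in> carrier R" "x \<in> carrier R" "y \<in> carrier R" "p \<in> carrier R" "q \<in> carrier R"
  shows "u \<otimes> (x \<otimes> p \<oplus> y \<otimes> q) \<ominus> y \<otimes> (u \<otimes> q \<oplus> v \<otimes> p) = p \<otimes> (u \<otimes> x \<ominus> v \<otimes> y)"
proof -
  have "u \<otimes> (x \<otimes> p \<oplus> y \<otimes> q) = u \<otimes> y \<otimes> q \<oplus> p \<otimes> (u \<otimes> x)"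
    "y \<otimes> (u \<otimes> q \<oplus> v \<otimes> p) = u \<otimes> y \<otimes> q \<oplus> p \<otimes> (v \<otimes> y)"
    using assms by (simp_all add: r_distr m_ac a_ac)
  moreover have "p \<otimes> (u \<otimes> x \<ominus> v \<otimes> y) = p \<otimes> (u \<otimes> x) \<ominus> p \<otimes> (v \<otimes> y)"
    using assms by (simp add: a_minus_def r_distr r_minus)
  ultimately show ?thesis using assms by (simp add: add_diff_add_left)
qed

lemma factor_difference_identity:
  assumes "p \<in> carrier R" "q \<in> carrier R" "p' \<in> carrier R" "q' \<in> carrier R" and eq: "p' \<otimes> q' = p \<otimes> q"
  shows "(p' \<ominus> p) \<otimes> q \<oplus> (q' \<ominus> q) \<otimes> p = \<ominus> ((p' \<ominus> p) \<otimes> (q' \<ominus> q))"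
proof -
  have expand: "d \<otimes> q \<oplus> e \<otimes> p \<oplus> d \<otimes> e = (p \<oplus> d) \<otimes> (q \<oplus> e) \<ominus> p \<otimes> q"
    if "d \<in> carrier R" "e \<in> carrier R" for d e
  proof -
    have "(p \<oplus> d) \<otimes> (q \<oplus> e) = p \<otimes> q \<oplus> (d \<otimes> q \<oplus> e \<otimes> p \<oplus> d \<otimes> e)"
      using assms(1,2) that by (simp add: l_distr r_distr m_ac a_ac)
    then show ?thesis
      using add_diff_cancel_left[of "p \<otimes> q" "d \<otimes> q \<oplus> e \<otimes> p \<oplus> d \<otimes> e"] assms(1,2) that by simp
  qed
  have "p \<oplus> (p' \<ominus> p) = p'" "q \<oplus> (q' \<ominus> q) = q'"
    using assms(1-4) by (simp_all add: a_minus_def a_comm[of p'] a_comm[of q'] r_neg1 r_neg2)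
  then have "(p' \<ominus> p) \<otimes> q \<oplus> (q' \<ominus> q) \<otimes> p \<oplus> (p' \<ominus> p) \<otimes> (q' \<ominus> q) = \<zero>"
    using expand[of "p' \<ominus> p" "q' \<ominus> q"] assms by (simp add: eq)
  then show ?thesis using assms(1-4) by (intro minus_equality[symmetric]) auto
qed

lemma combination_difference_identity:
  assumes "a \<in> carrier R" "d \<in> carrier R" "c \<in> carrier R" "e \<in> carrier R" "p \<in> carrier R" "q \<in> carrier R"
    and eq: "a \<otimes> q \<oplus> c \<otimes> p = d \<otimes> q \<oplus> e \<otimes> p"
  shows "(a \<ominus> d) \<otimes> q \<oplus> (c \<ominus> e) \<otimes> p = \<zero>"
proof -
  have "(a \<ominus> d) \<otimes> q = a \<otimes> q \<ominus> d \<otimes> q" "(c \<ominus> e) \<otimes> p = c \<otimes> p \<ominus> e \<otimes> p"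
    using assms(1-6) by (simp_all add: a_minus_def l_distr l_minus)
  then have "(a \<ominus> d) \<otimes> q \<oplus> (c \<ominus> e) \<otimes> p = (a \<otimes> q \<oplus> c \<otimes> p) \<ominus> (d \<otimes> q \<oplus> e \<otimes> p)"
    using add_diff_add[of "a \<otimes> q" "c \<otimes> p" "d \<otimes> q" "e \<otimes> p"] assms(1-6) by simp
  then show ?thesis unfolding eq using assms(1-6) by (simp add: a_minus_def r_neg)
qed

text \<open>Multiply the Bezout relation by \<open>T\<^sup>k\<close> and reduce the cofactor of \<open>q\<close> modulo \<open>p\<close>. The degree of the
  other cofactor is then bounded by \<open>monic_mult_below\<close>.\<close>

lemma bezout_basis:
  assumes p: "p \<in> monics R m" and q: "q \<in> monics R n"
    and x: "x \<in> carrier (UP R)" and y: "y \<in> carrier (UP R)"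
    and xy: "x \<otimes>\<^bsub>UP R\<^esub> p \<oplus>\<^bsub>UP R\<^esub> y \<otimes>\<^bsub>UP R\<^esub> q = \<one>\<^bsub>UP R\<^esub>" and k: "k < m + n"
  shows "\<exists>u\<in>polys_below R m. \<exists>v\<in>polys_below R n.
    u \<otimes>\<^bsub>UP R\<^esub> q \<oplus>\<^bsub>UP R\<^esub> v \<otimes>\<^bsub>UP R\<^esub> p = up_ring.monom (UP R) \<one> k"
proof -
  interpret P: cring "UP R" by (rule cring_UP)
  interpret U: UP_cring R "UP R" by unfold_locales simp
  have pc: "p \<in> carrier (UP R)" "q \<in> carrier (UP R)" using p q monics_carrier by blast+
  let ?t = "up_ring.monom (UP R) \<one> k"
  have tc: "?t \<in> carrier (UP R)" by simp
  obtain N where "\<And>i. i \<ge> N \<Longrightarrow> (?t \<otimes>\<^bsub>UP R\<^esub> y) i = \<zero>"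
    using UP_carrierE[OF P.m_closed[OF tc y]] by blast
  then have "?t \<otimes>\<^bsub>UP R\<^esub> y \<in> polys_below R (m + N)" using tc y by (simp add: polys_below_def)
  then obtain w u where w: "w \<in> carrier (UP R)" and u: "u \<in> polys_below R m"
    and wu: "?t \<otimes>\<^bsub>UP R\<^esub> y = w \<otimes>\<^bsub>UP R\<^esub> p \<oplus>\<^bsub>UP R\<^esub> u" using divide_by_monic[OF p] by blast
  have uc: "u \<in> carrier (UP R)" using u polys_below_carrier by blast
  let ?v = "?t \<otimes>\<^bsub>UP R\<^esub> x \<oplus>\<^bsub>UP R\<^esub> w \<otimes>\<^bsub>UP R\<^esub> q"
  have vc: "?v \<in> carrier (UP R)" using tc x w pc by simp
  have id: "u \<otimes>\<^bsub>UP R\<^esub> q \<oplus>\<^bsub>UP R\<^esub> ?v \<otimes>\<^bsub>UP R\<^esub> p = ?t"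
    using P.bezout_remainder_identity[OF x y pc tc w uc xy wu] .
  have "(u \<otimes>\<^bsub>UP R\<^esub> q \<oplus>\<^bsub>UP R\<^esub> ?v \<otimes>\<^bsub>UP R\<^esub> p) \<ominus>\<^bsub>UP R\<^esub> u \<otimes>\<^bsub>UP R\<^esub> q = ?v \<otimes>\<^bsub>UP R\<^esub> p"
    using uc vc pc by (intro P.add_diff_cancel_left) auto
  then have "p \<otimes>\<^bsub>UP R\<^esub> ?v = ?t \<ominus>\<^bsub>UP R\<^esub> u \<otimes>\<^bsub>UP R\<^esub> q"
    unfolding id P.m_comm[OF pc(1) vc] by (rule sym)
  moreover have "?t \<ominus>\<^bsub>UP R\<^esub> u \<otimes>\<^bsub>UP R\<^esub> q \<in> polys_below R (m + n)"
    using k tc polys_below_mult[OF u subsetD[OF monics_below q]]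
    by (intro polys_below_diff) (auto simp: polys_below_def)
  ultimately have "?v \<in> polys_below R n" using monic_mult_below[OF p vc] by simp
  then show ?thesis using u id by blast
qed

text \<open>If \<open>u q + v p = 0\<close>, then \<open>p\<close> divides \<open>u q\<close>, hence \<open>u\<close>, whose degree is too small.\<close>

lemma coprime_combination_unique:
  assumes p: "p \<in> monics R m" and q: "q \<in> monics R n"
    and x: "x \<in> carrier (UP R)" and y: "y \<in> carrier (UP R)"
    and xy: "x \<otimes>\<^bsub>UP R\<^esub> p \<oplus>\<^bsub>UP R\<^esub> y \<otimes>\<^bsub>UP R\<^esub> q = \<one>\<^bsub>UP R\<^esub>"
    and u: "u \<in> polys_below R m" and v: "v \<in> polys_below R n"
    and 0: "u \<otimes>\<^bsub>UP R\<^esub> q \<oplus>\<^bsub>UP R\<^esub> v \<otimes>\<^bsub>UP R\<^esub> p = \<zero>\<^bsub>UP R\<^esub>"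
  shows "u = \<zero>\<^bsub>UP R\<^esub>"
proof -
  interpret P: cring "UP R" by (rule cring_UP)
  have pc: "p \<in> carrier (UP R)" "q \<in> carrier (UP R)" using p q monics_carrier by blast+
  have uc: "u \<in> carrier (UP R)" "v \<in> carrier (UP R)" using u v polys_below_carrier by blast+
  let ?w = "u \<otimes>\<^bsub>UP R\<^esub> x \<ominus>\<^bsub>UP R\<^esub> v \<otimes>\<^bsub>UP R\<^esub> y"
  have "p \<otimes>\<^bsub>UP R\<^esub> ?w = u \<otimes>\<^bsub>UP R\<^esub> \<one>\<^bsub>UP R\<^esub> \<ominus>\<^bsub>UP R\<^esub> y \<otimes>\<^bsub>UP R\<^esub> \<zero>\<^bsub>UP R\<^esub>"
    using P.bezout_elimination_identity[OF uc x y pc] unfolding xy 0 by simp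
  then have eq: "p \<otimes>\<^bsub>UP R\<^esub> ?w = u" using uc y by (simp add: a_minus_def[of "UP R"])
  have "?w \<in> polys_below R 0"
    by (rule monic_mult_below[OF p]) (use uc x y u eq in auto)
  then have "?w = \<zero>\<^bsub>UP R\<^esub>" by (auto simp: polys_below_def)
  then show ?thesis using eq pc by simp
qed

end

text \<open>The differences \<open>d = p' - p\<close> and \<open>e = q' - q\<close> satisfy \<open>d q + e p = - d e\<close>. The Bezout relations
  recover \<open>d\<close> from the left-hand side with norm at most \<open>C\<close> times larger, so that
  \<open>\<parallel>d\<parallel> \<le> C \<parallel>d\<parallel> \<parallel>e\<parallel>\<close>, and \<open>C \<parallel>e\<parallel> < 1\<close> forces \<open>d = 0\<close>.\<close>

lemma (in normed_cring) coprime_factors_isolated: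
  assumes p: "p \<in> monics R m" and q: "q \<in> monics R n"
    and x: "x \<in> carrier (UP R)" and y: "y \<in> carrier (UP R)"
    and xy: "x \<otimes>\<^bsub>UP R\<^esub> p \<oplus>\<^bsub>UP R\<^esub> y \<otimes>\<^bsub>UP R\<^esub> q = \<one>\<^bsub>UP R\<^esub>"
    and u: "\<And>k. k < m + n \<Longrightarrow> u k \<in> polys_below R m" "\<And>k. k < m + n \<Longrightarrow> pnorm (u k) \<le> C"
    and v: "\<And>k. k < m + n \<Longrightarrow> v k \<in> polys_below R n"
    and uv: "\<And>k. k < m + n \<Longrightarrow>
      u k \<otimes>\<^bsub>UP R\<^esub> q \<oplus>\<^bsub>UP R\<^esub> v k \<otimes>\<^bsub>UP R\<^esub> p = up_ring.monom (UP R) \<one> k"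
    and p': "p' \<in> monics R m" and q': "q' \<in> monics R n" and eq: "p' \<otimes>\<^bsub>UP R\<^esub> q' = p \<otimes>\<^bsub>UP R\<^esub> q"
    and C: "0 \<le> C" and near: "C * pnorm (q' \<ominus>\<^bsub>UP R\<^esub> q) < 1"
  shows "p' = p \<and> q' = q"
proof -
  interpret P: normed_cring "UP R" pnorm by (rule normed_cring_UP)
  interpret U: UP_cring R "UP R" by unfold_locales simp
  have pc: "p \<in> carrier (UP R)" "q \<in> carrier (UP R)" "p' \<in> carrier (UP R)" "q' \<in> carrier (UP R)"
    using p q p' q' monics_carrier by blast+
  let ?d = "p' \<ominus>\<^bsub>UP R\<^esub> p" and ?e = "q' \<ominus>\<^bsub>UP R\<^esub> q"
  have d: "?d \<in> polys_below R m" and e: "?e \<in> polys_below R n" using monics_diff p q p' q' by blast+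
  have dc: "?d \<in> carrier (UP R)" and ec: "?e \<in> carrier (UP R)" using pc by auto
  have lin: "?d \<otimes>\<^bsub>UP R\<^esub> q \<oplus>\<^bsub>UP R\<^esub> ?e \<otimes>\<^bsub>UP R\<^esub> p = \<ominus>\<^bsub>UP R\<^esub> (?d \<otimes>\<^bsub>UP R\<^esub> ?e)"
    using P.factor_difference_identity[OF pc eq] .
  let ?f = "?d \<otimes>\<^bsub>UP R\<^esub> q \<oplus>\<^bsub>UP R\<^esub> ?e \<otimes>\<^bsub>UP R\<^esub> p"
  have f: "?f \<in> polys_below R (m + n)"
    using polys_below_mult[OF d subsetD[OF monics_below q]] polys_below_mult[OF e subsetD[OF monics_below p]]
    by (intro polys_below_add) (simp_all add: add.commute)
  have fc: "?f \<in> carrier (UP R)" using f polys_below_carrier by blast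
  have uc: "u k \<in> carrier (UP R)" "v k \<in> carrier (UP R)" if "k < m + n" for k
    using u(1)[OF that] v(1)[OF that] polys_below_carrier by blast+
  let ?S = "extend_linearly (m + n) u ?f" and ?T = "extend_linearly (m + n) v ?f"
  have S: "?S \<in> polys_below R m" and T: "?T \<in> polys_below R n"
    using extend_linearly_below[OF fc] u v by blast+
  have Sc: "?S \<in> carrier (UP R)" "?T \<in> carrier (UP R)" using S T polys_below_carrier by blast+
  have "?S \<otimes>\<^bsub>UP R\<^esub> q \<oplus>\<^bsub>UP R\<^esub> ?T \<otimes>\<^bsub>UP R\<^esub> p =
      extend_linearly (m + n) (\<lambda>k. u k \<otimes>\<^bsub>UP R\<^esub> q \<oplus>\<^bsub>UP R\<^esub> v k \<otimes>\<^bsub>UP R\<^esub> p) ?f"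
    using extend_linearly_mult[of ?f "m + n" u q, OF fc uc(1) pc(2)]
      extend_linearly_mult[of ?f "m + n" v p, OF fc uc(2) pc(1)] uc pc
    by (simp add: extend_linearly_add[OF fc])
  also have "\<dots> = extend_linearly (m + n) (up_ring.monom (UP R) \<one>) ?f"
    unfolding extend_linearly_def using uv fc uc pc by (intro P.finsum_cong') auto
  also have "\<dots> = ?f" by (rule extend_linearly_monom[OF f])
  finally have ST: "?S \<otimes>\<^bsub>UP R\<^esub> q \<oplus>\<^bsub>UP R\<^esub> ?T \<otimes>\<^bsub>UP R\<^esub> p = ?f" .
  have "?S \<ominus>\<^bsub>UP R\<^esub> ?d = \<zero>\<^bsub>UP R\<^esub>"
  proof (rule coprime_combination_unique[OF p q x y xy])
    show "?S \<ominus>\<^bsub>UP R\<^esub> ?d \<in> polys_below R m" "?T \<ominus>\<^bsub>UP R\<^esub> ?e \<in> polys_below R n"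
      using S T d e polys_below_diff by blast+
    show "(?S \<ominus>\<^bsub>UP R\<^esub> ?d) \<otimes>\<^bsub>UP R\<^esub> q \<oplus>\<^bsub>UP R\<^esub> (?T \<ominus>\<^bsub>UP R\<^esub> ?e) \<otimes>\<^bsub>UP R\<^esub> p = \<zero>\<^bsub>UP R\<^esub>"
      using P.combination_difference_identity[OF Sc(1) dc Sc(2) ec pc(1,2) ST] .
  qed
  then have Sd: "?S = ?d" using Sc dc by simp
  have "pnorm ?d \<le> C * pnorm ?f"
    using extend_linearly_bound[OF f, of u C] uc u Sd by simp
  also have "pnorm ?f = pnorm (?d \<otimes>\<^bsub>UP R\<^esub> ?e)" unfolding lin using dc ec P.norm_minus by simp
  also have "C * \<dots> \<le> C * (pnorm ?d * pnorm ?e)" using C dc ec by (intro mult_left_mono P.norm_submult)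
  finally have "pnorm ?d * (1 - C * pnorm ?e) \<le> 0" by (simp add: algebra_simps)
  then have "pnorm ?d = 0" using near P.norm_nonneg[OF dc] by (simp add: mult_le_0_iff)
  then have d0: "?d = \<zero>\<^bsub>UP R\<^esub>" using P.norm_eq_0_iff dc by blast
  have "p \<otimes>\<^bsub>UP R\<^esub> ?e = \<zero>\<^bsub>UP R\<^esub>" using lin[unfolded d0] pc ec by (simp add: P.m_comm)
  then have "?e \<in> polys_below R 0"
    using monic_mult_below[OF p ec, of 0] polys_below_zero by simp
  then have "?e = \<zero>\<^bsub>UP R\<^esub>" by (auto simp: polys_below_def)
  then show ?thesis using d0 pc by simp
qed

context ring_hom_ring
begin

lemma UP_hom_closed: "p \<in> carrier (UP R) \<Longrightarrow> h \<circ> p \<in> carrier (UP S)"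
proof -
  assume p: "p \<in> carrier (UP R)"
  then obtain n where n: "\<And>i. i \<ge> n \<Longrightarrow> p i = \<zero>\<^bsub>R\<^esub>" using R.UP_carrierE[OF p] by blast
  show ?thesis by (rule S.UP_carrierI[of _ n]) (use p n in auto)
qed

lemma UP_hom_mult:
  assumes "p \<in> carrier (UP R)" "q \<in> carrier (UP R)"
  shows "h \<circ> (p \<otimes>\<^bsub>UP R\<^esub> q) = (h \<circ> p) \<otimes>\<^bsub>UP S\<^esub> (h \<circ> q)"
proof
  fix i
  have "h (\<Oplus>\<^bsub>R\<^esub>k\<in>{..i}. p k \<otimes>\<^bsub>R\<^esub> q (i - k)) = (\<Oplus>\<^bsub>S\<^esub>k\<in>{..i}. h (p k \<otimes>\<^bsub>R\<^esub> q (i - k)))"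
    using assms by (subst hom_finsum) (auto simp: comp_def)
  also have "\<dots> = (\<Oplus>\<^bsub>S\<^esub>k\<in>{..i}. h (p k) \<otimes>\<^bsub>S\<^esub> h (q (i - k)))"
    using assms by (intro S.finsum_cong') auto
  finally show "(h \<circ> (p \<otimes>\<^bsub>UP R\<^esub> q)) i = ((h \<circ> p) \<otimes>\<^bsub>UP S\<^esub> (h \<circ> q)) i"
    using assms UP_hom_closed by (simp add: R.UP_mult_app S.UP_mult_app)
qed

lemma UP_hom_add:
  "p \<in> carrier (UP R) \<Longrightarrow> q \<in> carrier (UP R) \<Longrightarrow> h \<circ> (p \<oplus>\<^bsub>UP R\<^esub> q) = (h \<circ> p) \<oplus>\<^bsub>UP S\<^esub> (h \<circ> q)"
  using UP_hom_closed by (intro ext) simp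

lemma UP_hom_diff:
  "p \<in> carrier (UP R) \<Longrightarrow> q \<in> carrier (UP R) \<Longrightarrow> h \<circ> (p \<ominus>\<^bsub>UP R\<^esub> q) = (h \<circ> p) \<ominus>\<^bsub>UP S\<^esub> (h \<circ> q)"
  using UP_hom_closed by (intro ext) (simp add: a_minus_def[of R] a_minus_def[of S])

lemma UP_hom_monom: "h \<circ> up_ring.monom (UP R) \<one>\<^bsub>R\<^esub> k = up_ring.monom (UP S) \<one>\<^bsub>S\<^esub> k"
  by (intro ext) simp

end

lemma polys_below_comp:
  assumes "p \<in> polys_below R n" "ring R" "ring S"
    and "\<And>i. h (p i) \<in> carrier S" "h \<zero>\<^bsub>R\<^esub> = \<zero>\<^bsub>S\<^esub>"
  shows "h \<circ> p \<in> polys_below S n"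
  using assms by (simp add: ring.polys_below_iff[OF assms(3)]) (simp add: polys_below_def)

lemma monics_comp:
  assumes "p \<in> monics R n" "ring S"
    and "\<And>i. h (p i) \<in> carrier S" "h \<zero>\<^bsub>R\<^esub> = \<zero>\<^bsub>S\<^esub>" "h \<one>\<^bsub>R\<^esub> = \<one>\<^bsub>S\<^esub>"
  shows "h \<circ> p \<in> monics S n"
  using assms ring.UP_carrierI[OF assms(2), of "h \<circ> p" "Suc n"]
  by (auto simp: monics_def)


context ring_hom_ring
begin

lemma UP_hom_monics:
  assumes p: "p \<in> monics R n"
  shows "h \<circ> p \<in> monics S n"
  by (rule monics_comp[OF p S.ring_axioms])
    (use subsetD[OF R.monics_carrier p] in simp_all)

lemma UP_hom_below:
  assumes p: "p \<in> polys_below R n"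
  shows "h \<circ> p \<in> polys_below S n"
  by (rule polys_below_comp[OF p R.ring_axioms S.ring_axioms])
    (use subsetD[OF R.polys_below_carrier p] in simp_all)

end

context stalk_point
begin

interpretation K: valued_field "\<H> A b" "residue_abs b"
  by (rule valued_field_residue)

interpretation O: cring "\<O> A nrm b"
  by (rule cring_stalk)

interpretation ev: ring_hom_ring "\<O> A nrm b" "\<H> A b" "germ_value b"
  using germ_value_hom O.ring_axioms K.ring_axioms by (simp add: ring_hom_ringI2)

abbreviation kn where "kn \<equiv> poly_norm \<H>\<^sub>b (residue_abs b)"
abbreviation ev where "ev \<equiv> germ_value b"

lemma eval_hom_section:
  assumes "nbhd V"
  shows "(\<lambda>f. f b) \<in> ring_hom (section_ring A V) \<H>\<^sub>b"
proof -
  have "b \<in> V" using assms by (simp add: nbhd_def)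
  then show ?thesis by (intro ring_hom_memI) (auto intro: uniform_sections_value)
qed

text \<open>Lifts of coefficients are chosen so that zero and one are preserved; composition with the
  choice function then preserves degrees and leading coefficients of polynomials.\<close>

lemma approximate_coefficients:
  assumes \<epsilon>: "\<epsilon> > 0"
  obtains a where "\<And>z. z \<in> carrier \<H>\<^sub>b \<Longrightarrow> a z \<in> carrier \<O>\<^sub>b"
    "\<And>z. z \<in> carrier \<H>\<^sub>b \<Longrightarrow> residue_abs b (ev (a z) \<ominus>\<^bsub>\<H>\<^sub>b\<^esub> z) < \<epsilon>"
    "a \<zero>\<^bsub>\<H>\<^sub>b\<^esub> = \<zero>\<^bsub>\<O>\<^sub>b\<^esub>" "a \<one>\<^bsub>\<H>\<^sub>b\<^esub> = \<one>\<^bsub>\<O>\<^sub>b\<^esub>"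
proof -
  obtain a' where a': "\<And>z. z \<in> carrier \<H>\<^sub>b \<Longrightarrow> a' z \<in> carrier \<O>\<^sub>b \<and> residue_abs b (ev (a' z) \<ominus>\<^bsub>\<H>\<^sub>b\<^esub> z) < \<epsilon>"
    using germ_value_dense[OF _ \<epsilon>] by metis
  define a where "a z = (if z = \<zero>\<^bsub>\<H>\<^sub>b\<^esub> then \<zero>\<^bsub>\<O>\<^sub>b\<^esub> else if z = \<one>\<^bsub>\<H>\<^sub>b\<^esub> then \<one>\<^bsub>\<O>\<^sub>b\<^esub> else a' z)" for z
  show ?thesis
    by (rule that[of a]) (use a' \<epsilon> in \<open>auto simp: a_def a_minus_def K.r_neg\<close>)
qed

lemma lift_coefficients:
  assumes "finite F" "F \<subseteq> carrier \<O>\<^sub>b"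
  obtains V l where "nbhd V" "\<forall>\<phi>\<in>F. l \<phi> \<in> carrier (section_ring A V) \<and> gm V (l \<phi>) = \<phi>"
    "l \<zero>\<^bsub>\<O>\<^sub>b\<^esub> = \<zero>\<^bsub>section_ring A V\<^esub>" "l \<one>\<^bsub>\<O>\<^sub>b\<^esub> = \<one>\<^bsub>section_ring A V\<^esub>"
proof -
  obtain V where V: "nbhd V" "\<forall>\<phi>\<in>F. \<exists>f\<in>uniform_sections A V. gm V f = \<phi>"
    using finite_germs_common[OF assms] by blast
  interpret S: cring "section_ring A V" by (rule cring_section_ring[OF nbhd_subset[OF V(1)]])
  obtain l' where l': "\<And>\<phi>. \<phi> \<in> F \<Longrightarrow> l' \<phi> \<in> carrier (section_ring A V) \<and> gm V (l' \<phi>) = \<phi>"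
    using V(2) unfolding section_ring_simps(1) by metis
  define l where "l z = (if z = \<zero>\<^bsub>\<O>\<^sub>b\<^esub> then \<zero>\<^bsub>section_ring A V\<^esub> else if z = \<one>\<^bsub>\<O>\<^sub>b\<^esub> then \<one>\<^bsub>section_ring A V\<^esub> else l' z)" for z
  have ne: "\<zero>\<^bsub>\<O>\<^sub>b\<^esub> \<noteq> \<one>\<^bsub>\<O>\<^sub>b\<^esub>" using ev.hom_one ev.hom_zero K.zero_not_one by metis
  have l: "l \<phi> \<in> carrier (section_ring A V) \<and> gm V (l \<phi>) = \<phi>" if "\<phi> \<in> F" for \<phi>
    using l'[OF that] germ_one[OF V(1)] germ_zero[OF V(1)] S.zero_closed S.one_closed unfolding l_def by presburger
  show ?thesis
  proof (rule that[of V l])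
    show "l \<zero>\<^bsub>\<O>\<^sub>b\<^esub> = \<zero>\<^bsub>section_ring A V\<^esub>" by (simp add: l_def)
    show "l \<one>\<^bsub>\<O>\<^sub>b\<^esub> = \<one>\<^bsub>section_ring A V\<^esub>" using ne unfolding l_def by presburger
  qed (use l V in blast)+
qed

lemma small_near_simultaneously:
  assumes V: "nbhd V" and "finite F" "F \<subseteq> carrier (section_ring A V)" and \<delta>: "\<delta> > 0"
  shows "\<exists>W. nbhd W \<and> W \<subseteq> V \<and> (\<forall>f\<in>F. \<forall>y\<in>W. residue_abs y (f y) < residue_abs b (f b) + \<delta>)"
  using assms(2,3)
proof (induction rule: finite_induct)
  case empty
  then show ?case using V by blast
next
  case (insert f F)
  then obtain W where W: "nbhd W" "W \<subseteq> V" "\<forall>f\<in>F. \<forall>y\<in>W. residue_abs y (f y) < residue_abs b (f b) + \<delta>" by auto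
  have "\<exists>W'. openin (spectrum_topology A nrm) W' \<and> b \<in> W' \<and> W' \<subseteq> V \<and> (\<forall>y\<in>W'. residue_abs y (f y) < residue_abs b (f b) + \<delta>)"
    using V insert.prems \<delta> by (intro uniform_section_small_near) (auto simp: nbhd_def)
  then obtain W' where W': "nbhd W'" "W' \<subseteq> V" "\<forall>y\<in>W'. residue_abs y (f y) < residue_abs b (f b) + \<delta>"
    unfolding nbhd_def by blast
  then show ?case using W nbhd_Int[OF W(1) W'(1)] by (intro exI[of _ "W \<inter> W'"]) auto
qed

text \<open>Supremum norms over small neighbourhoods of \<open>b\<close> are controlled by absolute values at \<open>b\<close>. Being an
  estimate on all coefficients, this requires a common degree bound \<open>N\<close>.\<close>

lemma poly_norm_near:
  assumes V: "nbhd V" and F: "finite F" "F \<subseteq> polys_below (section_ring A V) N" and \<delta>: "\<delta> > 0"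
  shows "\<exists>W. nbhd W \<and> W \<subseteq> V \<and> (\<forall>p\<in>F. poly_norm (section_ring A W) (sup_norm W) ((\<lambda>f. restrict f W) \<circ> p) \<le>
    kn ((\<lambda>f. f b) \<circ> p) + \<delta>)"
proof -
  interpret SV: cring "section_ring A V" by (rule cring_section_ring[OF nbhd_subset[OF V]])
  define \<epsilon> where "\<epsilon> = \<delta> / (N + 1)"
  have \<epsilon>: "\<epsilon> > 0" "N * \<epsilon> \<le> \<delta>" using \<delta> by (auto simp: \<epsilon>_def field_simps)
  let ?G = "\<Union>p\<in>F. p ` {..<N}"
  have pc: "p i \<in> carrier (section_ring A V)" if "p \<in> F" for p i
    using F(2) that by (auto simp: SV.polys_below_iff subset_iff simp del: section_ring_simps)
  have "?G \<subseteq> carrier (section_ring A V)" using pc by blast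
  then obtain W where W: "nbhd W" "W \<subseteq> V" and small: "\<forall>f\<in>?G. \<forall>y\<in>W. residue_abs y (f y) < residue_abs b (f b) + \<epsilon>"
    using small_near_simultaneously[OF V, of ?G \<epsilon>] F(1) \<epsilon>(1) by blast
  have bW: "b \<in> W" using W by (simp add: nbhd_def)
  have WS: "W \<subseteq> spectrum A nrm" "W \<noteq> {}" using nbhd_subset[OF W(1)] bW by auto
  interpret SW: banach_ring "section_ring A W" "sup_norm W" by (rule banach_ring_section_ring[OF WS])
  interpret r: ring_hom_ring "section_ring A V" "section_ring A W" "\<lambda>f. restrict f W"
    using restrict_hom[OF V W(2)] SV.ring_axioms SW.ring_axioms by (simp add: ring_hom_ringI2 del: section_ring_simps)
  interpret e: ring_hom_ring "section_ring A V" "\<H> A b" "\<lambda>f. f b"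
    using eval_hom_section[OF V] SV.ring_axioms K.ring_axioms by (simp add: ring_hom_ringI2 del: section_ring_simps)
  have "poly_norm (section_ring A W) (sup_norm W) ((\<lambda>f. restrict f W) \<circ> p) \<le> kn ((\<lambda>f. f b) \<circ> p) + \<delta>" if p: "p \<in> F" for p
  proof -
    have z: "p i = \<zero>\<^bsub>section_ring A V\<^esub>" if "i \<ge> N" for i using F(2) p that by (auto simp: polys_below_def simp del: section_ring_simps)
    have n: "sup_norm W (restrict (p i) W) \<le> residue_abs b (p i b) + \<epsilon>" if "i < N" for i
    proof -
      have "restrict (p i) W \<in> uniform_sections A W"
        using uniform_sections_restrict[of "p i" A V W] W(2) pc[OF p] by simp
      moreover have "\<forall>y\<in>W. residue_abs y (p i y) < residue_abs b (p i b) + \<epsilon>" using small p that by blast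
      ultimately show ?thesis using WS(2) by (subst sup_norm_le_iff) (auto intro: less_imp_le)
    qed
    have "poly_norm (section_ring A W) (sup_norm W) ((\<lambda>f. restrict f W) \<circ> p) = (\<Sum>i<N. sup_norm W (restrict (p i) W))"
      using z r.hom_zero by (subst SW.poly_norm_eq[of N]) (simp_all del: section_ring_simps)
    also have "\<dots> \<le> (\<Sum>i<N. residue_abs b (p i b) + \<epsilon>)" using n by (intro sum_mono) simp
    also have "\<dots> = (\<Sum>i<N. residue_abs b (p i b)) + N * \<epsilon>" by (simp add: sum.distrib)
    also have "(\<Sum>i<N. residue_abs b (p i b)) = kn ((\<lambda>f. f b) \<circ> p)"
      using z e.hom_zero by (subst K.poly_norm_eq[of N]) (simp_all del: section_ring_simps)
    finally show ?thesis using \<epsilon>(2) by linarith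
  qed
  then show ?thesis using W by blast
qed

lemma poly_norm_approx:
  assumes a: "\<And>z. z \<in> carrier \<H>\<^sub>b \<Longrightarrow> a z \<in> carrier \<O>\<^sub>b"
    "\<And>z. z \<in> carrier \<H>\<^sub>b \<Longrightarrow> residue_abs b (ev (a z) \<ominus>\<^bsub>\<H>\<^sub>b\<^esub> z) < \<epsilon>"
    "a \<zero>\<^bsub>\<H>\<^sub>b\<^esub> = \<zero>\<^bsub>\<O>\<^sub>b\<^esub>"
    and p: "p \<in> polys_below \<H>\<^sub>b N"
  shows "ev \<circ> (a \<circ> p) \<in> carrier (UP \<H>\<^sub>b)" "kn ((ev \<circ> (a \<circ> p)) \<ominus>\<^bsub>UP \<H>\<^sub>b\<^esub> p) \<le> N * \<epsilon>"
proof -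
  have pc: "p \<in> carrier (UP \<H>\<^sub>b)" using p K.polys_below_carrier by blast
  have "a \<circ> p \<in> polys_below \<O>\<^sub>b N"
    by (rule polys_below_comp[OF p K.ring_axioms O.ring_axioms]) (use pc a in auto)
  then have "ev \<circ> (a \<circ> p) \<in> polys_below \<H>\<^sub>b N"
    by (rule polys_below_comp[OF _ O.ring_axioms K.ring_axioms]) (use pc a in auto)
  then show 1: "ev \<circ> (a \<circ> p) \<in> carrier (UP \<H>\<^sub>b)" and "kn ((ev \<circ> (a \<circ> p)) \<ominus>\<^bsub>UP \<H>\<^sub>b\<^esub> p) \<le> N * \<epsilon>"
  proof -
    assume B: "ev \<circ> (a \<circ> p) \<in> polys_below \<H>\<^sub>b N"
    then show 1: "ev \<circ> (a \<circ> p) \<in> carrier (UP \<H>\<^sub>b)" using K.polys_below_carrier by blast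
    have "(ev \<circ> (a \<circ> p)) \<ominus>\<^bsub>UP \<H>\<^sub>b\<^esub> p \<in> polys_below \<H>\<^sub>b N" using K.polys_below_diff[OF B p] .
    then have "kn ((ev \<circ> (a \<circ> p)) \<ominus>\<^bsub>UP \<H>\<^sub>b\<^esub> p) = (\<Sum>i<N. residue_abs b (ev (a (p i)) \<ominus>\<^bsub>\<H>\<^sub>b\<^esub> p i))"
      using 1 pc by (subst K.poly_norm_eq[of N]) (auto simp: polys_below_def)
    also have "\<dots> \<le> (\<Sum>i<N. \<epsilon>)" using a(2) pc by (intro sum_mono less_imp_le) auto
    finally show "kn ((ev \<circ> (a \<circ> p)) \<ominus>\<^bsub>UP \<H>\<^sub>b\<^esub> p) \<le> N * \<epsilon>" by simp
  qed
qed

lemma poly_norm_at_point_le: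
  assumes W: "nbhd W" and p: "p \<in> carrier (UP (section_ring A W))"
  shows "kn ((\<lambda>f. f b) \<circ> p) \<le> poly_norm (section_ring A W) (sup_norm W) p"
proof -
  have bW: "b \<in> W" using W by (simp add: nbhd_def)
  have WS: "W \<subseteq> spectrum A nrm" "W \<noteq> {}" using nbhd_subset[OF W] bW by auto
  interpret SW: banach_ring "section_ring A W" "sup_norm W" by (rule banach_ring_section_ring[OF WS])
  obtain N where N: "\<And>i. i \<ge> N \<Longrightarrow> p i = \<zero>\<^bsub>section_ring A W\<^esub>" using SW.UP_carrierE[OF p] by blast
  have "kn ((\<lambda>f. f b) \<circ> p) = (\<Sum>i<N. residue_abs b (p i b))"
    using N bW by (subst K.poly_norm_eq[of N]) simp_all
  also have "\<dots> \<le> (\<Sum>i<N. sup_norm W (p i))"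
    using SW.UP_coeff_closed[OF p] bW by (intro sum_mono sup_norm_ge) simp_all
  also have "\<dots> = poly_norm (section_ring A W) (sup_norm W) p"
    by (rule SW.poly_norm_eq[OF N, symmetric])
  finally show ?thesis .
qed

text \<open>From here on the section rings enter only through their ring structure.\<close>

declare section_ring_simps [simp del]

text \<open>The constants are chosen as follows. \<open>D\<close> bounds the data at \<open>b\<close> and \<open>C = D + 2\<close> bounds their lifts;
  \<open>\<eta>\<close> is the size of error that Newton's iteration tolerates. The data are approximated up to
  \<open>\<kappa> = \<eta> / (8 C)\<close>, so that the defects are at most \<open>\<eta> / 2\<close> at \<open>b\<close>, and shrinking the
  neighbourhood adds at most \<open>\<eta> / 4\<close>. The factors obtained deviate from \<open>P\<close> and \<open>Q\<close> by at most
  \<open>2 C \<eta> + \<kappa>\<close>, and \<open>C (2 C \<eta> + \<kappa>) < 1\<close> is what \<open>coprime_factors_isolated\<close> requires.\<close>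

theorem lift_coprime_factors:
  assumes g: "g \<in> monics \<O>\<^sub>b (m + n)" and P: "P \<in> monics \<H>\<^sub>b m" and Q: "Q \<in> monics \<H>\<^sub>b n"
    and gPQ: "ev \<circ> g = P \<otimes>\<^bsub>UP \<H>\<^sub>b\<^esub> Q"
    and x: "x \<in> carrier (UP \<H>\<^sub>b)" and y: "y \<in> carrier (UP \<H>\<^sub>b)"
    and xy: "x \<otimes>\<^bsub>UP \<H>\<^sub>b\<^esub> P \<oplus>\<^bsub>UP \<H>\<^sub>b\<^esub> y \<otimes>\<^bsub>UP \<H>\<^sub>b\<^esub> Q = \<one>\<^bsub>UP \<H>\<^sub>b\<^esub>"
  shows "\<exists>p\<in>monics \<O>\<^sub>b m. \<exists>q\<in>monics \<O>\<^sub>b n. p \<otimes>\<^bsub>UP \<O>\<^sub>b\<^esub> q = g \<and> ev \<circ> p = P \<and> ev \<circ> q = Q"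
proof -
  interpret KP: normed_cring "UP \<H>\<^sub>b" kn by (rule K.normed_cring_UP)
  let ?K = "UP \<H>\<^sub>b" and ?N = "Suc (m + n)"
  have PQ: "P \<in> carrier ?K" "Q \<in> carrier ?K" using P Q K.monics_carrier by blast+
  have "\<exists>u v. u \<in> polys_below \<H>\<^sub>b m \<and> v \<in> polys_below \<H>\<^sub>b n \<and>
      u \<otimes>\<^bsub>?K\<^esub> Q \<oplus>\<^bsub>?K\<^esub> v \<otimes>\<^bsub>?K\<^esub> P = up_ring.monom ?K \<one>\<^bsub>\<H>\<^sub>b\<^esub> k" if "k < m + n" for k
    using K.bezout_basis[OF P Q x y xy that] by blast
  then obtain u v where u: "\<And>k. k < m + n \<Longrightarrow> u k \<in> polys_below \<H>\<^sub>b m" and v: "\<And>k. k < m + n \<Longrightarrow> v k \<in> polys_below \<H>\<^sub>b n"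
    and uv: "\<And>k. k < m + n \<Longrightarrow> u k \<otimes>\<^bsub>?K\<^esub> Q \<oplus>\<^bsub>?K\<^esub> v k \<otimes>\<^bsub>?K\<^esub> P = up_ring.monom ?K \<one>\<^bsub>\<H>\<^sub>b\<^esub> k"
    by metis
  have uc: "u k \<in> carrier ?K" "v k \<in> carrier ?K" if "k < m + n" for k
    using u[OF that] v[OF that] K.polys_below_carrier by blast+
  define D where "D = 1 + kn P + kn Q + (\<Sum>k<m+n. kn (u k) + kn (v k))"
  have nn: "0 \<le> kn (u k) + kn (v k)" if "k < m + n" for k
    using KP.norm_nonneg[OF uc(1)[OF that]] KP.norm_nonneg[OF uc(2)[OF that]] by simp
  have s0: "0 \<le> (\<Sum>k<m+n. kn (u k) + kn (v k))" using nn by (intro sum_nonneg) auto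
  have D: "1 \<le> D" "kn P \<le> D" "kn Q \<le> D"
    using s0 KP.norm_nonneg[OF PQ(1)] KP.norm_nonneg[OF PQ(2)] by (simp_all add: D_def)
  have Duv: "kn (u k) \<le> D" "kn (v k) \<le> D" if k: "k < m + n" for k
  proof -
    have "kn (u k) + kn (v k) \<le> (\<Sum>k<m+n. kn (u k) + kn (v k))"
      using nn k by (intro member_le_sum) auto
    then show "kn (u k) \<le> D" "kn (v k) \<le> D"
      using KP.norm_nonneg[OF uc(1)[OF k]] KP.norm_nonneg[OF uc(2)[OF k]]
        KP.norm_nonneg[OF PQ(1)] KP.norm_nonneg[OF PQ(2)] by (simp_all add: D_def)
  qed
  define C where "C = D + 2"
  define \<eta> where "\<eta> = 1 / (20 * C\<^sup>2)"
  have C: "3 \<le> C" using D by (simp add: C_def)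
  have \<eta>: "0 < \<eta>" "20 * C\<^sup>2 * \<eta> = 1" using C by (simp_all add: \<eta>_def)
  have CC: "3 * C \<le> C\<^sup>2" "9 \<le> C\<^sup>2"
    using mult_right_mono[OF C, of C] mult_mono[OF C C] C by (simp_all add: power2_eq_square)
  have C2\<eta>: "C\<^sup>2 * (20 * \<eta>) = 1" using \<eta>(2) by (simp add: mult.commute mult.left_commute)
  have C\<eta>: "3 * C * (20 * \<eta>) \<le> 1" "9 * (20 * \<eta>) \<le> 1"
    using mult_right_mono[OF CC(1), of "20 * \<eta>"] mult_right_mono[OF CC(2), of "20 * \<eta>"] \<eta>(1) C2\<eta> by linarith+
  define \<kappa> where "\<kappa> = \<eta> / (8 * C)"
  have \<kappa>: "0 < \<kappa>" "8 * C * \<kappa> = \<eta>" using \<eta> C by (simp_all add: \<kappa>_def)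
  have \<kappa>1: "\<kappa> \<le> 1" using mult_right_mono[of 1 "8 * C" \<kappa>] \<kappa> C C\<eta>(2) by simp
  have D\<kappa>: "\<kappa> * (2 * D + 1) \<le> \<eta> / 4"
    using \<kappa> by (simp add: C_def algebra_simps)
  have "\<kappa> / ?N > 0" using \<kappa> by simp
  then obtain a where a: "\<And>z. z \<in> carrier \<H>\<^sub>b \<Longrightarrow> a z \<in> carrier \<O>\<^sub>b"
    "\<And>z. z \<in> carrier \<H>\<^sub>b \<Longrightarrow> residue_abs b (ev (a z) \<ominus>\<^bsub>\<H>\<^sub>b\<^esub> z) < \<kappa> / ?N"
    and a01: "a \<zero>\<^bsub>\<H>\<^sub>b\<^esub> = \<zero>\<^bsub>\<O>\<^sub>b\<^esub>" "a \<one>\<^bsub>\<H>\<^sub>b\<^esub> = \<one>\<^bsub>\<O>\<^sub>b\<^esub>"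
    using approximate_coefficients by metis
  have near: "ev \<circ> (a \<circ> p) \<in> carrier ?K" "kn ((ev \<circ> (a \<circ> p)) \<ominus>\<^bsub>?K\<^esub> p) \<le> \<kappa>" "kn (ev \<circ> (a \<circ> p)) \<le> kn p + \<kappa>"
    if p: "p \<in> polys_below \<H>\<^sub>b ?N" for p
  proof -
    have pc: "p \<in> carrier ?K" using p K.polys_below_carrier by blast
    show 1: "ev \<circ> (a \<circ> p) \<in> carrier ?K" and 2: "kn ((ev \<circ> (a \<circ> p)) \<ominus>\<^bsub>?K\<^esub> p) \<le> \<kappa>"
      using poly_norm_approx[OF a a01(1) p] by simp_all
    show "kn (ev \<circ> (a \<circ> p)) \<le> kn p + \<kappa>" using KP.norm_le_diff[OF 1 pc] 2 by simp
  qed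
  have below: "P \<in> polys_below \<H>\<^sub>b ?N" "Q \<in> polys_below \<H>\<^sub>b ?N"
    using P Q K.monics_below K.polys_below_mono[of "Suc m" ?N] K.polys_below_mono[of "Suc n" ?N] by force+
  have belowuv: "u k \<in> polys_below \<H>\<^sub>b ?N" "v k \<in> polys_below \<H>\<^sub>b ?N" if "k < m + n" for k
    using u[OF that] v[OF that] K.polys_below_mono[of m ?N] K.polys_below_mono[of n ?N] by force+
  let ?P = "ev \<circ> (a \<circ> P)" and ?Q = "ev \<circ> (a \<circ> Q)" and ?u = "\<lambda>k. ev \<circ> (a \<circ> u k)" and ?v = "\<lambda>k. ev \<circ> (a \<circ> v k)"
  note nP = near[OF below(1)] and nQ = near[OF below(2)]
  have prod: "kn (p' \<otimes>\<^bsub>?K\<^esub> q' \<ominus>\<^bsub>?K\<^esub> p \<otimes>\<^bsub>?K\<^esub> q) \<le> \<eta> / 4"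
    if c: "p \<in> carrier ?K" "q \<in> carrier ?K" "p' \<in> carrier ?K" "q' \<in> carrier ?K"
      and b: "kn (p' \<ominus>\<^bsub>?K\<^esub> p) \<le> \<kappa>" "kn (q' \<ominus>\<^bsub>?K\<^esub> q) \<le> \<kappa>" "kn q' \<le> D + \<kappa>" "kn p \<le> D" for p q p' q'
  proof -
    have "kn (p' \<otimes>\<^bsub>?K\<^esub> q' \<ominus>\<^bsub>?K\<^esub> p \<otimes>\<^bsub>?K\<^esub> q) \<le> kn (p' \<ominus>\<^bsub>?K\<^esub> p) * kn q' + kn p * kn (q' \<ominus>\<^bsub>?K\<^esub> q)"
      using c by (intro KP.norm_product_diff)
    also have "\<dots> \<le> \<kappa> * (D + 1) + D * \<kappa>"
      using b c \<kappa> \<kappa>1 D KP.norm_nonneg by (intro add_mono mult_mono) auto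
    also have "\<dots> = \<kappa> * (2 * D + 1)" by (simp add: algebra_simps)
    finally show ?thesis using D\<kappa> by simp
  qed
  have e0: "kn ((ev \<circ> g) \<ominus>\<^bsub>?K\<^esub> ?P \<otimes>\<^bsub>?K\<^esub> ?Q) \<le> \<eta> / 4"
  proof -
    have "kn (?P \<otimes>\<^bsub>?K\<^esub> ?Q \<ominus>\<^bsub>?K\<^esub> P \<otimes>\<^bsub>?K\<^esub> Q) \<le> \<eta> / 4"
      using nP nQ D PQ by (intro prod) auto
    then show ?thesis unfolding gPQ
      using KP.norm_diff_commute[of "P \<otimes>\<^bsub>?K\<^esub> Q" "?P \<otimes>\<^bsub>?K\<^esub> ?Q"] nP(1) nQ(1) PQ by simp
  qed
  have ek: "kn (?u k \<otimes>\<^bsub>?K\<^esub> ?Q \<oplus>\<^bsub>?K\<^esub> ?v k \<otimes>\<^bsub>?K\<^esub> ?P \<ominus>\<^bsub>?K\<^esub> up_ring.monom ?K \<one>\<^bsub>\<H>\<^sub>b\<^esub> k) \<le> \<eta> / 2" if k: "k < m + n" for k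
  proof -
    note nu = near[OF belowuv(1)[OF k]] and nv = near[OF belowuv(2)[OF k]]
    have 1: "kn (?u k \<otimes>\<^bsub>?K\<^esub> ?Q \<ominus>\<^bsub>?K\<^esub> u k \<otimes>\<^bsub>?K\<^esub> Q) \<le> \<eta> / 4"
      using nu nQ D Duv[OF k] PQ uc[OF k] by (intro prod) auto
    have 2: "kn (?v k \<otimes>\<^bsub>?K\<^esub> ?P \<ominus>\<^bsub>?K\<^esub> v k \<otimes>\<^bsub>?K\<^esub> P) \<le> \<eta> / 4"
      using nv nP D Duv[OF k] PQ uc[OF k] by (intro prod) auto
    have "?u k \<otimes>\<^bsub>?K\<^esub> ?Q \<oplus>\<^bsub>?K\<^esub> ?v k \<otimes>\<^bsub>?K\<^esub> ?P \<ominus>\<^bsub>?K\<^esub> up_ring.monom ?K \<one>\<^bsub>\<H>\<^sub>b\<^esub> k =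
      (?u k \<otimes>\<^bsub>?K\<^esub> ?Q \<ominus>\<^bsub>?K\<^esub> u k \<otimes>\<^bsub>?K\<^esub> Q) \<oplus>\<^bsub>?K\<^esub> (?v k \<otimes>\<^bsub>?K\<^esub> ?P \<ominus>\<^bsub>?K\<^esub> v k \<otimes>\<^bsub>?K\<^esub> P)"
      unfolding uv[OF k, symmetric] using nu(1) nv(1) nP(1) nQ(1) PQ uc[OF k]
      by (intro KP.add_diff_add) auto
    then show ?thesis
      using 1 2 KP.norm_triangle[of "?u k \<otimes>\<^bsub>?K\<^esub> ?Q \<ominus>\<^bsub>?K\<^esub> u k \<otimes>\<^bsub>?K\<^esub> Q" "?v k \<otimes>\<^bsub>?K\<^esub> ?P \<ominus>\<^bsub>?K\<^esub> v k \<otimes>\<^bsub>?K\<^esub> P"]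
        nu(1) nv(1) nP(1) nQ(1) PQ uc[OF k] by simp
  qed
  \<comment> \<open>All coefficients in play, together with the zero that occurs beyond their degrees.\<close>
  let ?F = "g ` {..<?N} \<union> (a \<circ> P) ` {..<?N} \<union> (a \<circ> Q) ` {..<?N} \<union>
    (\<Union>k<m+n. (a \<circ> u k) ` {..<?N}) \<union> (\<Union>k<m+n. (a \<circ> v k) ` {..<?N}) \<union> {\<zero>\<^bsub>\<O>\<^sub>b\<^esub>}"
  have gB: "g \<in> polys_below \<O>\<^sub>b ?N" and gc: "g \<in> carrier (UP \<O>\<^sub>b)" using g O.monics_below O.monics_carrier by blast+
  have FO: "?F \<subseteq> carrier \<O>\<^sub>b"
    using O.UP_coeff_closed[OF gc] a(1)[OF K.UP_coeff_closed[OF PQ(1)]] a(1)[OF K.UP_coeff_closed[OF PQ(2)]]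
      a(1)[OF K.UP_coeff_closed[OF uc(1)]] a(1)[OF K.UP_coeff_closed[OF uc(2)]] O.zero_closed
    by auto
  have finF: "finite ?F" by simp
  obtain V l where V: "nbhd V"
    and l: "\<forall>\<phi>\<in>?F. l \<phi> \<in> carrier (section_ring A V) \<and> gm V (l \<phi>) = \<phi>"
    and l01: "l \<zero>\<^bsub>\<O>\<^sub>b\<^esub> = \<zero>\<^bsub>section_ring A V\<^esub>" "l \<one>\<^bsub>\<O>\<^sub>b\<^esub> = \<one>\<^bsub>section_ring A V\<^esub>"
    by (rule lift_coefficients[OF finF FO]) iprover
  let ?S = "section_ring A V" and ?O = "UP \<O>\<^sub>b"
  interpret S: cring ?S by (rule cring_section_ring[OF nbhd_subset[OF V]])
  interpret e: ring_hom_ring ?S "\<H> A b" "\<lambda>f. f b"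
    using eval_hom_section[OF V] S.ring_axioms K.ring_axioms by (simp add: ring_hom_ringI2)
  have good: "l (f i) \<in> carrier ?S" "gm V (l (f i)) = f i"
    if f: "f \<in> polys_below \<O>\<^sub>b ?N" "f ` {..<?N} \<subseteq> ?F" for f i
  proof -
    have "f i \<in> ?F"
    proof (cases "i < ?N")
      case True
      then show ?thesis using subsetD[OF f(2) imageI[of i]] by blast
    next
      case False
      then have "f i = \<zero>\<^bsub>\<O>\<^sub>b\<^esub>" using f(1) by (simp add: polys_below_def)
      then show ?thesis by blast
    qed
    then show "l (f i) \<in> carrier ?S" "gm V (l (f i)) = f i" using bspec[OF l, of "f i"] by simp_all
  qed
  have evl: "(\<lambda>f. f b) \<circ> (l \<circ> f) = ev \<circ> f" if f: "f \<in> polys_below \<O>\<^sub>b ?N" "f ` {..<?N} \<subseteq> ?F" for f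
  proof
    fix i
    have "l (f i) \<in> uniform_sections A V" using good(1)[OF f] by (simp add: section_ring_simps)
    then show "((\<lambda>f. f b) \<circ> (l \<circ> f)) i = (ev \<circ> f) i"
      using germ_value_uniform[OF V, of "l (f i)"] good(2)[OF f] by simp
  qed
  have aM: "a \<circ> P \<in> monics \<O>\<^sub>b m" "a \<circ> Q \<in> monics \<O>\<^sub>b n"
    by (rule monics_comp[OF P O.ring_axioms] monics_comp[OF Q O.ring_axioms]; use a a01 PQ in auto)+
  have aU: "a \<circ> u k \<in> polys_below \<O>\<^sub>b m" "a \<circ> v k \<in> polys_below \<O>\<^sub>b n" if k: "k < m + n" for k
    by (rule polys_below_comp[OF u[OF k] K.ring_axioms O.ring_axioms] polys_below_comp[OF v[OF k] K.ring_axioms O.ring_axioms];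
      use a a01 uc[OF k] in auto)+
  have aB: "a \<circ> P \<in> polys_below \<O>\<^sub>b ?N" "a \<circ> Q \<in> polys_below \<O>\<^sub>b ?N"
    using aM O.monics_below O.polys_below_mono[of "Suc m" ?N] O.polys_below_mono[of "Suc n" ?N] by force+
  have aUB: "a \<circ> u k \<in> polys_below \<O>\<^sub>b ?N" "a \<circ> v k \<in> polys_below \<O>\<^sub>b ?N" if "k < m + n" for k
    using aU[OF that] O.polys_below_mono[of m ?N] O.polys_below_mono[of n ?N] by force+
  have inF: "g ` {..<?N} \<subseteq> ?F" "(a \<circ> P) ` {..<?N} \<subseteq> ?F" "(a \<circ> Q) ` {..<?N} \<subseteq> ?F" by blast+
  have inFu: "(a \<circ> u k) ` {..<?N} \<subseteq> ?F" "(a \<circ> v k) ` {..<?N} \<subseteq> ?F" if "k < m + n" for k using that by blast+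
  let ?g = "l \<circ> g" and ?p = "l \<circ> (a \<circ> P)" and ?q = "l \<circ> (a \<circ> Q)" and ?s = "\<lambda>k. l \<circ> (a \<circ> u k)" and ?t = "\<lambda>k. l \<circ> (a \<circ> v k)"
  have gpq: "?g \<in> monics ?S (m + n)" "?p \<in> monics ?S m" "?q \<in> monics ?S n"
    by (rule monics_comp[OF g S.ring_axioms good(1)[OF gB inF(1)] l01]
        monics_comp[OF aM(1) S.ring_axioms good(1)[OF aB(1) inF(2)] l01]
        monics_comp[OF aM(2) S.ring_axioms good(1)[OF aB(2) inF(3)] l01])+
  have st: "?s k \<in> polys_below ?S m" "?t k \<in> polys_below ?S n" if k: "k < m + n" for k
    by (rule polys_below_comp[OF aU(1)[OF k] O.ring_axioms S.ring_axioms good(1)[OF aUB(1)[OF k] inFu(1)[OF k]] l01(1)]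
        polys_below_comp[OF aU(2)[OF k] O.ring_axioms S.ring_axioms good(1)[OF aUB(2)[OF k] inFu(2)[OF k]] l01(1)])+
  interpret SP: cring "UP ?S" by (rule S.cring_UP)
  interpret SU: UP_cring ?S "UP ?S" by unfold_locales simp
  have gpqc: "?g \<in> carrier (UP ?S)" "?p \<in> carrier (UP ?S)" "?q \<in> carrier (UP ?S)"
    using gpq S.monics_carrier by blast+
  have stc: "?s k \<in> carrier (UP ?S)" "?t k \<in> carrier (UP ?S)" if "k < m + n" for k
    using st[OF that] S.polys_below_carrier by blast+
  \<comment> \<open>The defects of the factorisation and of the Bezout relations over the neighbourhood \<open>V\<close>.\<close>
  let ?err = "?g \<ominus>\<^bsub>UP ?S\<^esub> ?p \<otimes>\<^bsub>UP ?S\<^esub> ?q"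
  let ?dev = "\<lambda>k. ?s k \<otimes>\<^bsub>UP ?S\<^esub> ?q \<oplus>\<^bsub>UP ?S\<^esub> ?t k \<otimes>\<^bsub>UP ?S\<^esub> ?p \<ominus>\<^bsub>UP ?S\<^esub> up_ring.monom (UP ?S) \<one>\<^bsub>?S\<^esub> k"
  have e0B: "?err \<in> polys_below ?S ?N"
    using S.monics_diff[OF gpq(1) S.monics_mult[OF gpq(2,3)]] S.polys_below_mono[of "m + n" ?N] by auto
  have eB: "?dev k \<in> polys_below ?S ?N" if k: "k < m + n" for k
  proof -
    have "?s k \<otimes>\<^bsub>UP ?S\<^esub> ?q \<in> polys_below ?S (m + n)" "?t k \<otimes>\<^bsub>UP ?S\<^esub> ?p \<in> polys_below ?S (n + m)"
      using S.polys_below_mult[OF st(1)[OF k] subsetD[OF S.monics_below gpq(3)]]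
        S.polys_below_mult[OF st(2)[OF k] subsetD[OF S.monics_below gpq(2)]] by blast+
    moreover have "up_ring.monom (UP ?S) \<one>\<^bsub>?S\<^esub> k \<in> polys_below ?S (m + n)" using k by (auto simp: polys_below_def)
    ultimately have "?dev k \<in> polys_below ?S (m + n)"
      by (intro S.polys_below_diff S.polys_below_add) (simp_all add: add.commute)
    then show ?thesis using S.polys_below_mono[of "m + n" ?N] by auto
  qed
  let ?Fs = "{?err} \<union> ?dev ` {..<m+n} \<union> ?s ` {..<m+n} \<union> ?t ` {..<m+n}"
  have "?Fs \<subseteq> polys_below ?S ?N"
    using e0B eB st S.polys_below_mono[of m ?N] S.polys_below_mono[of n ?N] by auto
  \<comment> \<open>On \<open>W\<close> the defects and the solution maps satisfy the estimates required for the iteration.\<close>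
  then obtain W where W: "nbhd W" "W \<subseteq> V" and shrunk: "\<forall>p\<in>?Fs. poly_norm (section_ring A W) (sup_norm W) ((\<lambda>f. restrict f W) \<circ> p) \<le>
    kn ((\<lambda>f. f b) \<circ> p) + \<eta> / 4"
    using poly_norm_near[OF V, of ?Fs ?N "\<eta> / 4"] \<eta>(1) by auto
  let ?T = "section_ring A W" and ?r = "\<lambda>f. restrict f W"
  have WS: "W \<subseteq> spectrum A nrm" "W \<noteq> {}" using nbhd_subset[OF W(1)] W(1) by (auto simp: nbhd_def)
  interpret T: banach_ring ?T "sup_norm W" by (rule banach_ring_section_ring[OF WS])
  interpret r: ring_hom_ring ?S ?T ?r
    using restrict_hom[OF V W(2)] S.ring_axioms T.ring_axioms by (simp add: ring_hom_ringI2)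
  interpret eT: ring_hom_ring ?T "\<H> A b" "\<lambda>f. f b"
    using eval_hom_section[OF W(1)] T.ring_axioms K.ring_axioms by (simp add: ring_hom_ringI2)
  interpret gT: ring_hom_ring ?T "\<O> A nrm b" "gm W"
    using germ_hom[OF W(1)] T.ring_axioms O.ring_axioms by (simp add: ring_hom_ringI2)
  let ?pn = "poly_norm ?T (sup_norm W)"
  have rM: "?r \<circ> ?g \<in> monics ?T (m + n)" "?r \<circ> ?p \<in> monics ?T m" "?r \<circ> ?q \<in> monics ?T n"
    using gpq r.UP_hom_monics by blast+
  have rB: "?r \<circ> ?s k \<in> polys_below ?T m" "?r \<circ> ?t k \<in> polys_below ?T n" if k: "k < m + n" for k
    using st[OF k] r.UP_hom_below by blast+
  have evs: "(\<lambda>f. f b) \<circ> ?g = ev \<circ> g" "(\<lambda>f. f b) \<circ> ?p = ?P" "(\<lambda>f. f b) \<circ> ?q = ?Q"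
    using evl[OF gB inF(1)] evl[OF aB(1) inF(2)] evl[OF aB(2) inF(3)] by blast+
  have evst: "(\<lambda>f. f b) \<circ> ?s k = ?u k" "(\<lambda>f. f b) \<circ> ?t k = ?v k" if k: "k < m + n" for k
    using evl[OF aUB(1)[OF k] inFu(1)[OF k]] evl[OF aUB(2)[OF k] inFu(2)[OF k]] by blast+
  have start: "?pn ((?r \<circ> ?g) \<ominus>\<^bsub>UP ?T\<^esub> (?r \<circ> ?p) \<otimes>\<^bsub>UP ?T\<^esub> (?r \<circ> ?q)) \<le> \<eta>"
  proof -
    have "?pn (?r \<circ> ?err) \<le> kn ((\<lambda>f. f b) \<circ> ?err) + \<eta> / 4" using shrunk by blast
    also have "(\<lambda>f. f b) \<circ> ?err = (ev \<circ> g) \<ominus>\<^bsub>?K\<^esub> ?P \<otimes>\<^bsub>?K\<^esub> ?Q"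
      using gpqc by (simp only: e.UP_hom_diff e.UP_hom_mult SP.m_closed evs)
    finally have "?pn (?r \<circ> ?err) \<le> \<eta>" using e0 \<eta>(1) by linarith
    moreover have "?r \<circ> ?err = (?r \<circ> ?g) \<ominus>\<^bsub>UP ?T\<^esub> (?r \<circ> ?p) \<otimes>\<^bsub>UP ?T\<^esub> (?r \<circ> ?q)"
      using gpqc by (simp only: r.UP_hom_diff r.UP_hom_mult SP.m_closed)
    ultimately show ?thesis by simp
  qed
  have bez: "?pn ((?r \<circ> ?s k) \<otimes>\<^bsub>UP ?T\<^esub> (?r \<circ> ?q) \<oplus>\<^bsub>UP ?T\<^esub> (?r \<circ> ?t k) \<otimes>\<^bsub>UP ?T\<^esub> (?r \<circ> ?p)
      \<ominus>\<^bsub>UP ?T\<^esub> up_ring.monom (UP ?T) \<one>\<^bsub>?T\<^esub> k) \<le> 1 / 4" if k: "k < m + n" for k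
  proof -
    have "?pn (?r \<circ> ?dev k) \<le> kn ((\<lambda>f. f b) \<circ> ?dev k) + \<eta> / 4" using shrunk k by blast
    also have "(\<lambda>f. f b) \<circ> ?dev k = ?u k \<otimes>\<^bsub>?K\<^esub> ?Q \<oplus>\<^bsub>?K\<^esub> ?v k \<otimes>\<^bsub>?K\<^esub> ?P \<ominus>\<^bsub>?K\<^esub> up_ring.monom ?K \<one>\<^bsub>\<H>\<^sub>b\<^esub> k"
      using gpqc stc[OF k]
      by (simp only: e.UP_hom_diff e.UP_hom_add e.UP_hom_mult e.UP_hom_monom SP.m_closed SP.a_closed SU.monom_closed
        S.one_closed evs evst[OF k])
    finally have "?pn (?r \<circ> ?dev k) \<le> 1 / 4" using ek[OF k] C\<eta>(2) by linarith
    moreover have "?r \<circ> ?dev k = (?r \<circ> ?s k) \<otimes>\<^bsub>UP ?T\<^esub> (?r \<circ> ?q) \<oplus>\<^bsub>UP ?T\<^esub> (?r \<circ> ?t k) \<otimes>\<^bsub>UP ?T\<^esub> (?r \<circ> ?p)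
      \<ominus>\<^bsub>UP ?T\<^esub> up_ring.monom (UP ?T) \<one>\<^bsub>?T\<^esub> k"
      using gpqc stc[OF k]
      by (simp only: r.UP_hom_diff r.UP_hom_add r.UP_hom_mult r.UP_hom_monom SP.m_closed SP.a_closed SU.monom_closed
        S.one_closed)
    ultimately show ?thesis by simp
  qed
  have bd: "?pn (?r \<circ> ?s k) \<le> C" "?pn (?r \<circ> ?t k) \<le> C" if k: "k < m + n" for k
  proof -
    have "?pn (?r \<circ> ?s k) \<le> kn ((\<lambda>f. f b) \<circ> ?s k) + \<eta> / 4" "?pn (?r \<circ> ?t k) \<le> kn ((\<lambda>f. f b) \<circ> ?t k) + \<eta> / 4"
      using shrunk k by blast+
    then show "?pn (?r \<circ> ?s k) \<le> C" "?pn (?r \<circ> ?t k) \<le> C"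
      unfolding evst[OF k] using near(3)[OF belowuv(1)[OF k]] near(3)[OF belowuv(2)[OF k]] Duv[OF k] \<kappa>1 C\<eta>(2)
      by (simp_all add: C_def)
  qed
  have "\<exists>p'\<in>monics ?T m. \<exists>q'\<in>monics ?T n. p' \<otimes>\<^bsub>UP ?T\<^esub> q' = ?r \<circ> ?g \<and>
    ?pn (p' \<ominus>\<^bsub>UP ?T\<^esub> (?r \<circ> ?p)) \<le> 2 * C * \<eta> \<and> ?pn (q' \<ominus>\<^bsub>UP ?T\<^esub> (?r \<circ> ?q)) \<le> 2 * C * \<eta>"
    using C \<eta>(2) by (intro T.factorization_near[OF rM rB(1) bd(1) rB(2) bd(2) bez start]) auto
  then obtain p' q' where p': "p' \<in> monics ?T m" and q': "q' \<in> monics ?T n" and p'q': "p' \<otimes>\<^bsub>UP ?T\<^esub> q' = ?r \<circ> ?g"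
    and q'near: "?pn (q' \<ominus>\<^bsub>UP ?T\<^esub> (?r \<circ> ?q)) \<le> 2 * C * \<eta>" by blast
  interpret TP: cring "UP ?T" by (rule T.cring_UP)
  have c': "p' \<in> carrier (UP ?T)" "q' \<in> carrier (UP ?T)" "?r \<circ> ?q \<in> carrier (UP ?T)"
    using p' q' rM(3) T.monics_carrier by blast+
  have eM: "(\<lambda>f. f b) \<circ> p' \<in> monics \<H>\<^sub>b m" "(\<lambda>f. f b) \<circ> q' \<in> monics \<H>\<^sub>b n"
    using p' q' eT.UP_hom_monics by blast+
  have gM: "gm W \<circ> p' \<in> monics \<O>\<^sub>b m" "gm W \<circ> q' \<in> monics \<O>\<^sub>b n"
    using p' q' gT.UP_hom_monics by blast+
  have evg: "ev \<circ> (gm W \<circ> p) = (\<lambda>f. f b) \<circ> p" if p: "p \<in> carrier (UP ?T)" for p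
    using T.UP_coeff_closed[OF p] germ_value_uniform[OF W(1)] by (auto simp: section_ring_simps)
  have bW: "b \<in> W" using W(1) by (simp add: nbhd_def)
  have er: "(\<lambda>f. f b) \<circ> (?r \<circ> f) = (\<lambda>f. f b) \<circ> f" for f :: "nat \<Rightarrow> ('a \<Rightarrow> real) \<Rightarrow> 'a residue" using bW by auto
  \<comment> \<open>The germs of the coefficients of \<open>p\'\<close> and \<open>q\'\<close> are the polynomials sought.\<close>
  have factors: "(gm W \<circ> p') \<otimes>\<^bsub>?O\<^esub> (gm W \<circ> q') = g"
  proof -
    have "(gm W \<circ> p') \<otimes>\<^bsub>?O\<^esub> (gm W \<circ> q') = gm W \<circ> (?r \<circ> ?g)"
      using c' p'q' by (simp flip: gT.UP_hom_mult)
    also have "\<dots> = g"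
      using germ_restrict[OF W] good(2)[OF gB inF(1)] by (auto simp: fun_eq_iff)
    finally show ?thesis .
  qed
  \<comment> \<open>At \<open>b\<close> these are two factorisations of \<open>G(b)\<close>, close to each other.\<close>
  have "((\<lambda>f. f b) \<circ> p') \<otimes>\<^bsub>?K\<^esub> ((\<lambda>f. f b) \<circ> q') = (\<lambda>f. f b) \<circ> (?r \<circ> ?g)"
    using c' p'q' by (simp flip: eT.UP_hom_mult)
  also have "\<dots> = P \<otimes>\<^bsub>?K\<^esub> Q" unfolding er evs gPQ ..
  finally have same: "((\<lambda>f. f b) \<circ> p') \<otimes>\<^bsub>?K\<^esub> ((\<lambda>f. f b) \<circ> q') = P \<otimes>\<^bsub>?K\<^esub> Q" .
  have "kn (((\<lambda>f. f b) \<circ> q') \<ominus>\<^bsub>?K\<^esub> ?Q) \<le> 2 * C * \<eta>"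
  proof -
    have "(\<lambda>f. f b) \<circ> (q' \<ominus>\<^bsub>UP ?T\<^esub> (?r \<circ> ?q)) = ((\<lambda>f. f b) \<circ> q') \<ominus>\<^bsub>?K\<^esub> ?Q"
      unfolding eT.UP_hom_diff[OF c'(2,3)] er evs ..
    then show ?thesis
      using poly_norm_at_point_le[OF W(1), of "q' \<ominus>\<^bsub>UP ?T\<^esub> (?r \<circ> ?q)"] c' q'near by simp
  qed
  moreover have "(\<lambda>f. f b) \<circ> q' \<in> carrier ?K" using eM K.monics_carrier by blast
  ultimately have q'Q: "kn (((\<lambda>f. f b) \<circ> q') \<ominus>\<^bsub>?K\<^esub> Q) \<le> 2 * C * \<eta> + \<kappa>"
    using KP.norm_diff_trans[of "(\<lambda>f. f b) \<circ> q'" ?Q Q] nQ PQ by simp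
  have "C * kn (((\<lambda>f. f b) \<circ> q') \<ominus>\<^bsub>?K\<^esub> Q) < 1"
  proof -
    have "C * kn (((\<lambda>f. f b) \<circ> q') \<ominus>\<^bsub>?K\<^esub> Q) \<le> C * (2 * C * \<eta> + \<kappa>)"
      using q'Q C by (intro mult_left_mono) auto
    also have "\<dots> = C\<^sup>2 * (20 * \<eta>) / 10 + 8 * C * \<kappa> / 8" by (simp add: power2_eq_square algebra_simps)
    also have "\<dots> < 1" using C2\<eta> \<kappa>(2) C\<eta>(2) by linarith
    finally show ?thesis .
  qed
  then have "(\<lambda>f. f b) \<circ> p' = P \<and> (\<lambda>f. f b) \<circ> q' = Q"
    using K.coprime_factors_isolated[OF P Q x y xy u _ v uv eM same, of C] Duv C by (force simp: C_def)
  then show ?thesis using gM factors evg c' by auto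
qed

end

section \<open>Coefficient lists and the decomposition into powers of irreducibles\<close>

context cring
begin

definition comaximal :: "'a \<Rightarrow> 'a \<Rightarrow> bool" where
  "comaximal a c \<longleftrightarrow> (\<exists>x\<in>carrier R. \<exists>y\<in>carrier R. x \<otimes> a \<oplus> y \<otimes> c = \<one>)"

lemma comaximalI:
  "x \<in> carrier R \<Longrightarrow> y \<in> carrier R \<Longrightarrow> x \<otimes> a \<oplus> y \<otimes> c = \<one> \<Longrightarrow> comaximal a c"
  by (auto simp: comaximal_def)

lemma comaximal_sym:
  assumes "a \<in> carrier R" "c \<in> carrier R" "comaximal a c"
  shows "comaximal c a"
proof -
  obtain x y where "x \<in> carrier R" "y \<in> carrier R" "x \<otimes> a \<oplus> y \<otimes> c = \<one>"
    using assms by (auto simp: comaximal_def)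
  then show ?thesis using assms by (intro comaximalI[of y x]) (simp_all add: a_comm)
qed

lemma comaximal_one: "a \<in> carrier R \<Longrightarrow> comaximal a \<one>"
  by (rule comaximalI[of \<zero> \<one>]) auto

lemma comaximal_mult:
  assumes a: "a \<in> carrier R" and c: "c \<in> carrier R" and d: "d \<in> carrier R"
    and ac: "comaximal a c" and ad: "comaximal a d"
  shows "comaximal a (c \<otimes> d)"
proof -
  obtain x y where xy: "x \<in> carrier R" "y \<in> carrier R" "x \<otimes> a \<oplus> y \<otimes> c = \<one>"
    using ac by (auto simp: comaximal_def)
  obtain x' y' where xy': "x' \<in> carrier R" "y' \<in> carrier R" "x' \<otimes> a \<oplus> y' \<otimes> d = \<one>"
    using ad by (auto simp: comaximal_def)
  have "(x \<otimes> (x' \<otimes> a \<oplus> y' \<otimes> d) \<oplus> y \<otimes> c \<otimes> x') \<otimes> a \<oplus> (y \<otimes> y') \<otimes> (c \<otimes> d) =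
      (x \<otimes> a \<oplus> y \<otimes> c) \<otimes> (x' \<otimes> a \<oplus> y' \<otimes> d)"
    using a c d xy(1,2) xy'(1,2) by (simp add: l_distr r_distr m_ac a_ac)
  also have "\<dots> = \<one>" unfolding xy(3) xy'(3) by simp
  finally show ?thesis
    using a c d xy(1,2) xy'(1,2)
    by (intro comaximalI[of "x \<otimes> (x' \<otimes> a \<oplus> y' \<otimes> d) \<oplus> y \<otimes> c \<otimes> x'" "y \<otimes> y'"]) auto
qed

lemma comaximal_pow:
  assumes a: "a \<in> carrier R" and c: "c \<in> carrier R" and ac: "comaximal a c"
  shows "comaximal a (c [^] (k::nat))"
  by (induction k) (use assms in \<open>auto intro: comaximal_one comaximal_mult\<close>)

lemma comaximal_pow_pow:
  assumes a: "a \<in> carrier R" and c: "c \<in> carrier R" and ac: "comaximal a c"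
  shows "comaximal (a [^] (j::nat)) (c [^] (k::nat))"
  using assms by (meson comaximal_pow comaximal_sym nat_pow_closed)

lemma comaximal_finprod:
  assumes a: "a \<in> carrier R" and "finite I" and "\<And>i. i \<in> I \<Longrightarrow> f i \<in> carrier R"
    and "\<And>i. i \<in> I \<Longrightarrow> comaximal a (f i)"
  shows "comaximal a (\<Otimes>i\<in>I. f i)"
  using assms(2-)
proof (induction rule: finite_induct)
  case (insert i I)
  then have "f \<in> I \<rightarrow> carrier R" by auto
  with insert a show ?case by (auto intro!: comaximal_mult finprod_closed)
qed (use a in \<open>simp add: comaximal_one\<close>)

end

context cring
begin

lemma poly_ring_carrier_set: "p \<in> carrier (poly_ring R) \<Longrightarrow> set p \<subseteq> carrier R"
  using polynomial_incl[of "carrier R"] by (simp add: univ_poly_carrier)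

lemma coeff_UP_closed: "p \<in> carrier (poly_ring R) \<Longrightarrow> coeff p \<in> carrier (UP R)"
  using poly_ring_carrier_set by (intro UP_carrierI[of _ "length p"]) (auto simp: coeff_length)

lemma coeff_UP_mult:
  assumes "p \<in> carrier (poly_ring R)" "q \<in> carrier (poly_ring R)"
  shows "coeff (p \<otimes>\<^bsub>poly_ring R\<^esub> q) = coeff p \<otimes>\<^bsub>UP R\<^esub> coeff q"
  using assms poly_mult_coeff[of p q] poly_ring_carrier_set coeff_UP_closed
  by (auto simp: univ_poly_mult UP_mult_app fun_eq_iff)

lemma coeff_UP_add:
  assumes "p \<in> carrier (poly_ring R)" "q \<in> carrier (poly_ring R)"
  shows "coeff (p \<oplus>\<^bsub>poly_ring R\<^esub> q) = coeff p \<oplus>\<^bsub>UP R\<^esub> coeff q"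
  using assms poly_add_coeff[of p q] poly_ring_carrier_set coeff_UP_closed
  by (auto simp: univ_poly_add fun_eq_iff)

lemma coeff_UP_one: "coeff \<one>\<^bsub>poly_ring R\<^esub> = \<one>\<^bsub>UP R\<^esub>"
  by (auto simp: univ_poly_one UP_one_app)

lemma coeff_inject:
  "p \<in> carrier (poly_ring R) \<Longrightarrow> q \<in> carrier (poly_ring R) \<Longrightarrow> coeff p = coeff q \<longleftrightarrow> p = q"
  using coeff_iff_polynomial_cond[of "carrier R" p q] by (simp add: univ_poly_carrier)

lemma coeff_surj:
  assumes "f \<in> carrier (UP R)"
  shows "\<exists>p\<in>carrier (poly_ring R). coeff p = f"
proof -
  obtain n where n: "\<And>i. i \<ge> n \<Longrightarrow> f i = \<zero>" using UP_carrierE[OF assms] by blast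
  let ?l = "map f (rev [0..<n])"
  have "set ?l \<subseteq> carrier R" using assms by auto
  then have "normalize ?l \<in> carrier (poly_ring R)"
    using normalize_gives_polynomial univ_poly_carrier by blast
  moreover have "coeff (normalize ?l) i = f i" for i
  proof (cases "i < n")
    case True
    then show ?thesis by (simp flip: normalize_coeff add: coeff_nth rev_nth)
  next
    case False
    then show ?thesis using n[of i] by (simp flip: normalize_coeff add: coeff_length)
  qed
  ultimately show ?thesis by blast
qed

lemma one_poly_closed: "\<one> \<noteq> \<zero> \<Longrightarrow> \<one>\<^bsub>poly_ring R\<^esub> \<in> carrier (poly_ring R)"
  unfolding univ_poly_one univ_poly_carrier[symmetric] by (intro const_is_polynomial) auto

lemma poly_ring_closed:
  assumes "p \<in> carrier (poly_ring R)" "q \<in> carrier (poly_ring R)"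
  shows "p \<otimes>\<^bsub>poly_ring R\<^esub> q \<in> carrier (poly_ring R)" "p \<oplus>\<^bsub>poly_ring R\<^esub> q \<in> carrier (poly_ring R)"
  using assms poly_mult_closed[OF carrier_is_subring] poly_add_closed[OF carrier_is_subring]
  by (simp_all add: univ_poly_mult univ_poly_add univ_poly_carrier[symmetric])

text \<open>Reading off coefficients is an isomorphism onto the ring of finitely supported functions,
  along which the ring axioms are transported.\<close>

lemma cring_poly_ring:
  assumes "\<one> \<noteq> \<zero>"
  shows "cring (poly_ring R)"
proof (rule cring_of_lifts)
  interpret P: cring "UP R" by (rule cring_UP)
  let ?h = "inv_into (carrier (poly_ring R)) coeff"
  have surj: "coeff ` carrier (poly_ring R) = carrier (UP R)" using coeff_surj coeff_UP_closed by force
  have h: "?h f \<in> carrier (poly_ring R)" "coeff (?h f) = f" if "f \<in> carrier (UP R)" for f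
    using that surj inv_into_into[of f coeff] f_inv_into_f[of f coeff] by auto
  have hI: "?h f = p" if "f \<in> carrier (UP R)" "p \<in> carrier (poly_ring R)" "coeff p = f" for f p
    using h[OF that(1)] that coeff_inject by metis
  have z: "\<zero>\<^bsub>poly_ring R\<^esub> \<in> carrier (poly_ring R)" by (simp add: univ_poly_zero univ_poly_zero_closed)
  then show "\<zero>\<^bsub>poly_ring R\<^esub> \<in> carrier (poly_ring R)" .
  fix a c d assume acd: "a \<in> carrier (poly_ring R)" "c \<in> carrier (poly_ring R)" "d \<in> carrier (poly_ring R)"
  have "?h \<in> ring_hom (UP R) (poly_ring R)"
  proof (rule ring_hom_memI)
    fix f g assume fg: "f \<in> carrier (UP R)" "g \<in> carrier (UP R)"
    show "?h (f \<otimes>\<^bsub>UP R\<^esub> g) = ?h f \<otimes>\<^bsub>poly_ring R\<^esub> ?h g"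
      using fg h by (intro hI) (simp_all add: poly_ring_closed coeff_UP_mult)
    show "?h (f \<oplus>\<^bsub>UP R\<^esub> g) = ?h f \<oplus>\<^bsub>poly_ring R\<^esub> ?h g"
      using fg h by (intro hI) (simp_all add: poly_ring_closed coeff_UP_add)
  qed (use h hI[OF P.one_closed one_poly_closed[OF assms] coeff_UP_one] in auto)
  moreover have "?h \<zero>\<^bsub>UP R\<^esub> = \<zero>\<^bsub>poly_ring R\<^esub>"
    using z by (intro hI) (auto simp: univ_poly_zero fun_eq_iff)
  moreover have "{a, c, d} \<subseteq> ?h ` carrier (UP R)"
  proof -
    have "p \<in> ?h ` carrier (UP R)" if "p \<in> carrier (poly_ring R)" for p
    proof (rule image_eqI[OF _ coeff_UP_closed[OF that]])
      show "p = ?h (coeff p)" by (rule hI[OF coeff_UP_closed[OF that] that refl, symmetric])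
    qed
    then show ?thesis using acd by blast
  qed
  ultimately show "\<exists>S h. cring (S :: ('a, nat \<Rightarrow> 'a) up_ring) \<and> h \<in> ring_hom S (poly_ring R) \<and> h \<zero>\<^bsub>S\<^esub> = \<zero>\<^bsub>poly_ring R\<^esub> \<and> {a, c, d} \<subseteq> h ` carrier S"
    by - (rule exI[of _ "UP R"], rule exI[of _ ?h], intro conjI P.is_cring)
qed

lemma monic_polys_coeff:
  assumes "p \<in> monic_polys R"
  shows "coeff p \<in> monics R (degree p)"
  using assms coeff_UP_closed[of p] lead_coeff_simp[of p] coeff_degree[of p]
  by (auto simp: monic_polys_def monics_def)

lemma monic_polysI:
  assumes ne: "\<one> \<noteq> \<zero>" and p: "p \<in> carrier (poly_ring R)" and m: "coeff p \<in> monics R n"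
  shows "p \<in> monic_polys R" "degree p = n"
proof -
  have c: "coeff p n = \<one>" "\<And>i. i > n \<Longrightarrow> coeff p i = \<zero>" using m by (auto simp: monics_def)
  have pn: "p \<noteq> []" using c(1) ne by auto
  have lc: "lead_coeff p \<noteq> \<zero>" using p pn by (simp add: univ_poly_carrier[symmetric] polynomial_def)
  have "n \<le> degree p" using coeff_degree[of p n] c(1) ne by fastforce
  moreover have "degree p \<le> n" using c(2)[of "degree p"] lead_coeff_simp[OF pn] lc by fastforce
  ultimately show d: "degree p = n" by simp
  show "p \<in> monic_polys R" using p pn c(1) lead_coeff_simp[OF pn] d by (simp add: monic_polys_def)
qed

lemma monic_polys_mult:
  assumes ne: "\<one> \<noteq> \<zero>" and p: "p \<in> monic_polys R" and q: "q \<in> monic_polys R"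
  shows "p \<otimes>\<^bsub>poly_ring R\<^esub> q \<in> monic_polys R" "degree (p \<otimes>\<^bsub>poly_ring R\<^esub> q) = degree p + degree q"
proof -
  have c: "p \<in> carrier (poly_ring R)" "q \<in> carrier (poly_ring R)" using p q by (auto simp: monic_polys_def)
  have "coeff (p \<otimes>\<^bsub>poly_ring R\<^esub> q) \<in> monics R (degree p + degree q)"
    unfolding coeff_UP_mult[OF c] by (intro monics_mult monic_polys_coeff p q)
  then show "p \<otimes>\<^bsub>poly_ring R\<^esub> q \<in> monic_polys R" "degree (p \<otimes>\<^bsub>poly_ring R\<^esub> q) = degree p + degree q"
    using monic_polysI[OF ne poly_ring_closed(1)[OF c]] by auto
qed

lemma monic_polys_one: "\<one> \<noteq> \<zero> \<Longrightarrow> \<one>\<^bsub>poly_ring R\<^esub> \<in> monic_polys R"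
  using one_poly_closed by (simp add: monic_polys_def univ_poly_one)

lemma monic_polys_carrier: "p \<in> monic_polys R \<Longrightarrow> p \<in> carrier (poly_ring R)"
  by (simp add: monic_polys_def)

lemma monic_polys_pow:
  assumes ne: "\<one> \<noteq> \<zero>" and p: "p \<in> monic_polys R"
  shows "p [^]\<^bsub>poly_ring R\<^esub> (k::nat) \<in> monic_polys R"
proof -
  interpret P: cring "poly_ring R" by (rule cring_poly_ring[OF ne])
  show ?thesis by (induction k) (auto simp: monic_polys_one monic_polys_mult ne p)
qed

lemma monic_polys_finprod:
  assumes ne: "\<one> \<noteq> \<zero>" and "finite I" "\<And>i. i \<in> I \<Longrightarrow> f i \<in> monic_polys R"
  shows "(\<Otimes>\<^bsub>poly_ring R\<^esub>i\<in>I. f i) \<in> monic_polys R"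
proof -
  interpret P: cring "poly_ring R" by (rule cring_poly_ring[OF ne])
  show ?thesis using assms(2,3)
    by (induction rule: finite_induct)
      (auto simp: monic_polys_one monic_polys_mult ne Pi_iff monic_polys_carrier)
qed

end

text \<open>The ideal generated by \<open>p\<close> is maximal. If it contained \<open>q\<close>, the two polynomials would be
  associated, and equal because both are monic.\<close>

lemma (in field) distinct_irreducibles_comaximal:
  assumes p: "p \<in> monic_polys R" "pirreducible (carrier R) p"
    and q: "q \<in> monic_polys R" "pirreducible (carrier R) q" and ne: "p \<noteq> q"
  shows "cring.comaximal (poly_ring R) p q"
proof -
  interpret P: principal_domain "poly_ring R" by (rule univ_poly_is_principal[OF carrier_is_subfield])
  have c: "p \<in> carrier (poly_ring R)" "q \<in> carrier (poly_ring R)" using p q monic_polys_carrier by auto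
  interpret M: maximalideal "PIdl\<^bsub>poly_ring R\<^esub> p" "poly_ring R"
    by (rule P.irreducible_imp_maximalideal[OF c(1) p(2)])
  have "q \<notin> PIdl\<^bsub>poly_ring R\<^esub> p"
  proof
    assume "q \<in> PIdl\<^bsub>poly_ring R\<^esub> p"
    then have "p \<sim>\<^bsub>poly_ring R\<^esub> q"
      by (rule cgenideal_pirreducible[OF carrier_is_subfield c(1) p(2) q(2)])
    then obtain k where k: "k \<in> carrier R - {\<zero>}" "p = [k] \<otimes>\<^bsub>poly_ring R\<^esub> q"
      using associated_polynomials_iff[OF carrier_is_subfield c] by blast
    have len: "length p = length q"
      using associated_polynomials_imp_same_length[OF carrier_is_subring c \<open>p \<sim>\<^bsub>poly_ring R\<^esub> q\<close>] .
    have kc: "[k] \<in> carrier (poly_ring R)" using k(1) const_is_polynomial univ_poly_carrier by blast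
    have "coeff p (degree p) = k \<otimes> coeff q (degree p)"
    proof -
      have "coeff p = (\<lambda>i. k \<otimes> coeff q i)"
      proof
        fix i
        have "coeff p i = (\<Oplus>j\<in>{..i}. coeff [k] j \<otimes> coeff q (i - j))"
          unfolding k(2) coeff_UP_mult[OF kc c(2)] using coeff_UP_closed[OF kc] coeff_UP_closed[OF c(2)]
          by (rule UP_mult_app)
        also have "\<dots> = (\<Oplus>j\<in>{..i}. if 0 = j then k \<otimes> coeff q i else \<zero>)"
          using k(1) coeff_UP_closed[OF c(2)] by (intro finsum_cong') auto
        also have "\<dots> = k \<otimes> coeff q i"
          using finsum_singleton[of 0 "{..i}" "\<lambda>_. k \<otimes> coeff q i"] k(1) coeff_UP_closed[OF c(2)] by auto
        finally show "coeff p i = k \<otimes> coeff q i" .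
      qed
      then show ?thesis by simp
    qed
    then have "\<one> = k \<otimes> \<one>" using p(1) q(1) len lead_coeff_simp[of p] lead_coeff_simp[of q] by (simp add: monic_polys_def)
    then have "k = \<one>" using k(1) by simp
    moreover have "[\<one>] = \<one>\<^bsub>poly_ring R\<^esub>" by (simp add: univ_poly_one)
    ultimately show False using k(2) ne c by simp
  qed
  moreover have "PIdl\<^bsub>poly_ring R\<^esub> p \<union> {q} \<subseteq> carrier (poly_ring R)" using M.a_subset c by auto
  ultimately have max: "PIdl\<^bsub>poly_ring R\<^esub> p <+>\<^bsub>poly_ring R\<^esub> PIdl\<^bsub>poly_ring R\<^esub> q = carrier (poly_ring R)"
  proof -
    let ?J = "PIdl\<^bsub>poly_ring R\<^esub> p <+>\<^bsub>poly_ring R\<^esub> PIdl\<^bsub>poly_ring R\<^esub> q"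
    assume nq: "q \<notin> PIdl\<^bsub>poly_ring R\<^esub> p"
    have id: "ideal ?J (poly_ring R)" using P.add_ideals P.cgenideal_ideal c by blast
    have q0: "\<zero>\<^bsub>poly_ring R\<^esub> \<in> PIdl\<^bsub>poly_ring R\<^esub> q" "\<zero>\<^bsub>poly_ring R\<^esub> \<in> PIdl\<^bsub>poly_ring R\<^esub> p"
      using additive_subgroup.zero_closed ideal.axioms(1) P.cgenideal_ideal c by blast+
    have sub: "PIdl\<^bsub>poly_ring R\<^esub> p \<subseteq> ?J"
    proof
      fix z assume z: "z \<in> PIdl\<^bsub>poly_ring R\<^esub> p"
      then have "z = z \<oplus>\<^bsub>poly_ring R\<^esub> \<zero>\<^bsub>poly_ring R\<^esub>" using M.a_subset by auto
      then show "z \<in> ?J" using z q0(1) unfolding set_add_def' by blast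
    qed
    have "q = \<zero>\<^bsub>poly_ring R\<^esub> \<oplus>\<^bsub>poly_ring R\<^esub> q" using c by simp
    then have qJ: "q \<in> ?J" using q0(2) P.cgenideal_self[OF c(2)] unfolding set_add_def' by blast
    have "?J = PIdl\<^bsub>poly_ring R\<^esub> p \<or> ?J = carrier (poly_ring R)"
      using M.I_maximal[OF id sub] ideal.axioms(1)[OF id] additive_subgroup.a_subset by blast
    then show ?thesis using qJ nq by blast
  qed
  have "\<one>\<^bsub>poly_ring R\<^esub> \<in> PIdl\<^bsub>poly_ring R\<^esub> p <+>\<^bsub>poly_ring R\<^esub> PIdl\<^bsub>poly_ring R\<^esub> q" unfolding max by simp
  then obtain x y where "x \<in> carrier (poly_ring R)" "y \<in> carrier (poly_ring R)"
    "\<one>\<^bsub>poly_ring R\<^esub> = x \<otimes>\<^bsub>poly_ring R\<^esub> p \<oplus>\<^bsub>poly_ring R\<^esub> y \<otimes>\<^bsub>poly_ring R\<^esub> q"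
    unfolding set_add_def' cgenideal_def by blast
  then show ?thesis using P.comaximalI by metis
qed

context stalk_point
begin

interpretation K: valued_field "\<H> A b" "residue_abs b"
  by (rule valued_field_residue)

interpretation O: cring "\<O> A nrm b"
  by (rule cring_stalk)

interpretation ev: ring_hom_ring "\<O> A nrm b" "\<H> A b" "germ_value b"
  using germ_value_hom O.ring_axioms K.ring_axioms by (simp add: ring_hom_ringI2)

lemma residue_one_not_zero: "\<one>\<^bsub>\<H>\<^sub>b\<^esub> \<noteq> \<zero>\<^bsub>\<H>\<^sub>b\<^esub>"
  by simp

lemma stalk_one_not_zero: "\<one>\<^bsub>\<O>\<^sub>b\<^esub> \<noteq> \<zero>\<^bsub>\<O>\<^sub>b\<^esub>"
  using ev.hom_one ev.hom_zero residue_one_not_zero by metis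

interpretation KP: cring "poly_ring \<H>\<^sub>b"
  by (rule K.cring_poly_ring[OF residue_one_not_zero])

interpretation OP: cring "poly_ring \<O>\<^sub>b"
  by (rule O.cring_poly_ring[OF stalk_one_not_zero])

lemma lift_comaximal_factors:
  assumes G: "G \<in> monic_polys \<O>\<^sub>b" and P: "P \<in> monic_polys \<H>\<^sub>b" and Q: "Q \<in> monic_polys \<H>\<^sub>b"
    and GPQ: "poly_at A b G = P \<otimes>\<^bsub>poly_ring \<H>\<^sub>b\<^esub> Q" and com: "cring.comaximal (poly_ring \<H>\<^sub>b) P Q"
  shows "\<exists>H\<in>monic_polys \<O>\<^sub>b. \<exists>H'\<in>monic_polys \<O>\<^sub>b. G = H \<otimes>\<^bsub>poly_ring \<O>\<^sub>b\<^esub> H' \<and>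
    poly_at A b H = P \<and> poly_at A b H' = Q"
proof -
  have at: "poly_at A b H \<in> carrier (poly_ring \<H>\<^sub>b)" "K.coeff (poly_at A b H) = ev \<circ> O.coeff H"
    if H: "H \<in> carrier (poly_ring \<O>\<^sub>b)" for H
  proof -
    have s: "set H \<subseteq> carrier \<O>\<^sub>b" using O.poly_ring_carrier_set[OF H] .
    then have "set (map ev H) \<subseteq> carrier \<H>\<^sub>b" by auto
    then show "poly_at A b H \<in> carrier (poly_ring \<H>\<^sub>b)"
      unfolding poly_at_def using K.normalize_gives_polynomial univ_poly_carrier by blast
    show "K.coeff (poly_at A b H) = ev \<circ> O.coeff H"
      unfolding poly_at_def using ev.coeff_hom'[OF s] by (auto simp flip: K.normalize_coeff)
  qed
  have c: "G \<in> carrier (poly_ring \<O>\<^sub>b)" "P \<in> carrier (poly_ring \<H>\<^sub>b)" "Q \<in> carrier (poly_ring \<H>\<^sub>b)"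
    using G P Q O.monic_polys_carrier K.monic_polys_carrier by blast+
  obtain x y where xy: "x \<in> carrier (poly_ring \<H>\<^sub>b)" "y \<in> carrier (poly_ring \<H>\<^sub>b)"
    "x \<otimes>\<^bsub>poly_ring \<H>\<^sub>b\<^esub> P \<oplus>\<^bsub>poly_ring \<H>\<^sub>b\<^esub> y \<otimes>\<^bsub>poly_ring \<H>\<^sub>b\<^esub> Q = \<one>\<^bsub>poly_ring \<H>\<^sub>b\<^esub>"
    using com by (auto simp: KP.comaximal_def)
  have eq: "ev \<circ> O.coeff G = K.coeff P \<otimes>\<^bsub>UP \<H>\<^sub>b\<^esub> K.coeff Q"
    using at(2)[OF c(1)] GPQ c by (simp add: K.coeff_UP_mult)
  have gM: "O.coeff G \<in> monics \<O>\<^sub>b (degree G)" by (rule O.monic_polys_coeff[OF G])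
  have PM: "K.coeff P \<in> monics \<H>\<^sub>b (degree P)" "K.coeff Q \<in> monics \<H>\<^sub>b (degree Q)"
    using K.monic_polys_coeff P Q by blast+
  have "degree G = degree P + degree Q"
  proof -
    have "ev \<circ> O.coeff G \<in> monics \<H>\<^sub>b (degree G)" by (rule ev.UP_hom_monics[OF gM])
    moreover have "ev \<circ> O.coeff G \<in> monics \<H>\<^sub>b (degree P + degree Q)" unfolding eq by (rule K.monics_mult[OF PM])
    ultimately show ?thesis using residue_one_not_zero unfolding monics_def by (metis (mono_tags, lifting) linorder_neqE_nat mem_Collect_eq)
  qed
  moreover have "K.coeff x \<otimes>\<^bsub>UP \<H>\<^sub>b\<^esub> K.coeff P \<oplus>\<^bsub>UP \<H>\<^sub>b\<^esub> K.coeff y \<otimes>\<^bsub>UP \<H>\<^sub>b\<^esub> K.coeff Q = \<one>\<^bsub>UP \<H>\<^sub>b\<^esub>"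
    using arg_cong[OF xy(3), of K.coeff] xy(1,2) c by (simp add: K.coeff_UP_mult K.coeff_UP_add K.coeff_UP_one)
  ultimately obtain p q where pq: "p \<in> monics \<O>\<^sub>b (degree P)" "q \<in> monics \<O>\<^sub>b (degree Q)"
    "p \<otimes>\<^bsub>UP \<O>\<^sub>b\<^esub> q = O.coeff G" "ev \<circ> p = K.coeff P" "ev \<circ> q = K.coeff Q"
    using lift_coprime_factors[OF _ PM eq, of "K.coeff x" "K.coeff y"] gM K.coeff_UP_closed xy(1,2) by metis
  obtain H where H: "H \<in> carrier (poly_ring \<O>\<^sub>b)" "O.coeff H = p"
    using O.coeff_surj subsetD[OF O.monics_carrier pq(1)] by blast
  obtain H' where H': "H' \<in> carrier (poly_ring \<O>\<^sub>b)" "O.coeff H' = q"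
    using O.coeff_surj subsetD[OF O.monics_carrier pq(2)] by blast
  have "H \<in> monic_polys \<O>\<^sub>b" "H' \<in> monic_polys \<O>\<^sub>b"
    using O.monic_polysI[OF stalk_one_not_zero H(1)] O.monic_polysI[OF stalk_one_not_zero H'(1)] H(2) H'(2) pq by blast+
  moreover have "G = H \<otimes>\<^bsub>poly_ring \<O>\<^sub>b\<^esub> H'"
    using O.coeff_inject[OF c(1) O.poly_ring_closed(1)[OF H(1) H'(1)]] H H' pq(3) by (simp add: O.coeff_UP_mult)
  moreover have "poly_at A b H = P" "poly_at A b H' = Q"
    using K.coeff_inject[OF at(1)[OF H(1)] c(2)] K.coeff_inject[OF at(1)[OF H'(1)] c(3)] at(2)[OF H(1)] at(2)[OF H'(1)] H(2) H'(2) pq(4,5)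
    by simp_all
  ultimately show ?thesis by blast
qed

lemma lift_comaximal_family:
  fixes r :: nat
  assumes "G \<in> monic_polys \<O>\<^sub>b" and "\<And>i. i \<in> {1..r} \<Longrightarrow> f i \<in> monic_polys \<H>\<^sub>b"
    and "\<And>i j. i \<in> {1..r} \<Longrightarrow> j \<in> {1..r} \<Longrightarrow> i \<noteq> j \<Longrightarrow> cring.comaximal (poly_ring \<H>\<^sub>b) (f i) (f j)"
    and "poly_at A b G = (\<Otimes>\<^bsub>poly_ring \<H>\<^sub>b\<^esub>i\<in>{1..r}. f i)"
  shows "\<exists>H. (\<forall>i\<in>{1..r}. H i \<in> monic_polys \<O>\<^sub>b \<and> poly_at A b (H i) = f i) \<and>
    G = (\<Otimes>\<^bsub>poly_ring \<O>\<^sub>b\<^esub>i\<in>{1..r}. H i)"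
  using assms
proof (induction r arbitrary: G)
  case 0
  \<comment> \<open>A monic polynomial keeps its length on evaluation, so a value of length one comes from \<open>1\<close>.\<close>
  have "poly_at A b G = [\<one>\<^bsub>\<H>\<^sub>b\<^esub>]" using 0 by (simp add: univ_poly_one)
  obtain c cs where G: "G = c # cs" "c = \<one>\<^bsub>\<O>\<^sub>b\<^esub>" using 0 by (cases G) (auto simp: monic_polys_def)
  then have "poly_at A b G = map ev G" using residue_one_not_zero by (simp add: poly_at_def)
  then have "G = [\<one>\<^bsub>\<O>\<^sub>b\<^esub>]" using G \<open>poly_at A b G = [\<one>\<^bsub>\<H>\<^sub>b\<^esub>]\<close> by simp
  then show ?case by (simp add: univ_poly_one)
next
  case (Suc r)
  have fM: "f i \<in> monic_polys \<H>\<^sub>b" "f i \<in> carrier (poly_ring \<H>\<^sub>b)" if "i \<in> {1..Suc r}" for i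
    using Suc.prems(2)[OF that] K.monic_polys_carrier by blast+
  let ?Q = "\<Otimes>\<^bsub>poly_ring \<H>\<^sub>b\<^esub>i\<in>{1..r}. f i"
  have ins: "{1..Suc r} = insert (Suc r) {1..r}" by auto
  have Q: "?Q \<in> monic_polys \<H>\<^sub>b" using fM by (intro K.monic_polys_finprod[OF residue_one_not_zero]) auto
  have "poly_at A b G = f (Suc r) \<otimes>\<^bsub>poly_ring \<H>\<^sub>b\<^esub> ?Q"
    unfolding Suc.prems(4) ins using fM by (subst KP.finprod_insert) auto
  moreover have "cring.comaximal (poly_ring \<H>\<^sub>b) (f (Suc r)) ?Q"
    using fM Suc.prems(3) by (intro KP.comaximal_finprod) auto
  ultimately obtain H0 G' where H0: "H0 \<in> monic_polys \<O>\<^sub>b" "G' \<in> monic_polys \<O>\<^sub>b"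
    "G = H0 \<otimes>\<^bsub>poly_ring \<O>\<^sub>b\<^esub> G'" "poly_at A b H0 = f (Suc r)" "poly_at A b G' = ?Q"
    using lift_comaximal_factors[OF Suc.prems(1) fM(1) Q] by fastforce
  obtain H where H: "\<forall>i\<in>{1..r}. H i \<in> monic_polys \<O>\<^sub>b \<and> poly_at A b (H i) = f i"
    "G' = (\<Otimes>\<^bsub>poly_ring \<O>\<^sub>b\<^esub>i\<in>{1..r}. H i)"
    using Suc.IH[OF H0(2) _ _ H0(5)] Suc.prems(2,3) by fastforce
  let ?H = "H(Suc r := H0)"
  have G': "G' = (\<Otimes>\<^bsub>poly_ring \<O>\<^sub>b\<^esub>i\<in>{1..r}. ?H i)"
    unfolding H(2) using H(1) O.monic_polys_carrier by (intro OP.finprod_cong') auto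
  have "(\<Otimes>\<^bsub>poly_ring \<O>\<^sub>b\<^esub>i\<in>insert (Suc r) {1..r}. ?H i) =
      ?H (Suc r) \<otimes>\<^bsub>poly_ring \<O>\<^sub>b\<^esub> (\<Otimes>\<^bsub>poly_ring \<O>\<^sub>b\<^esub>i\<in>{1..r}. ?H i)"
    using H(1) H0(1) O.monic_polys_carrier by (intro OP.finprod_insert) auto
  then have "G = (\<Otimes>\<^bsub>poly_ring \<O>\<^sub>b\<^esub>i\<in>{1..Suc r}. ?H i)"
    unfolding ins H0(3) G'[symmetric] by simp
  then show ?case using H(1) H0(1,4) by (intro exI[of _ ?H]) auto
qed

end

theorem mainTheorem11:
  fixes A :: "('a, 'm) ring_scheme" and nrm :: "'a \<Rightarrow> real"
    and b :: "'a \<Rightarrow> real" and G :: "'a germ list"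
  assumes "banach_ring A nrm"
    and "b \<in> spectrum A nrm"
    and "G \<in> monic_polys (\<O> A nrm b)"
    and "degree G \<ge> 1"
  shows "condition_D A nrm b G"
  unfolding condition_D_def
proof (intro allI impI)
  interpret S: stalk_point A nrm b
    using assms(1,2) by (simp add: stalk_point_def spectrum_point_def spectrum_point_axioms_def)
  interpret K: valued_field "\<H> A b" "residue_abs b" by (rule S.valued_field_residue)
  have nK: "\<one>\<^bsub>\<H> A b\<^esub> \<noteq> \<zero>\<^bsub>\<H> A b\<^esub>" by simp
  interpret KP: cring "poly_ring (\<H> A b)" by (rule K.cring_poly_ring[OF nK])
  fix r h and n :: "nat \<Rightarrow> nat"
  assume "irreducible_decomposition (\<H> A b) (poly_at A b G) r h n"
  then have h: "\<And>i. i \<in> {1..r} \<Longrightarrow> h i \<in> monic_polys (\<H> A b) \<and> pirreducible\<^bsub>\<H> A b\<^esub> (carrier (\<H> A b)) (h i)"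
    and inj: "inj_on h {1..r}"
    and eq: "poly_at A b G = (\<Otimes>\<^bsub>poly_ring (\<H> A b)\<^esub>i\<in>{1..r}. h i [^]\<^bsub>poly_ring (\<H> A b)\<^esub> n i)"
    by (auto simp: irreducible_decomposition_def)
  have "\<exists>H. (\<forall>i\<in>{1..r}. H i \<in> monic_polys (\<O> A nrm b) \<and>
      poly_at A b (H i) = h i [^]\<^bsub>poly_ring (\<H> A b)\<^esub> n i) \<and>
      G = (\<Otimes>\<^bsub>poly_ring (\<O> A nrm b)\<^esub>i\<in>{1..r}. H i)"
  proof (rule S.lift_comaximal_family[OF assms(3) _ _ eq])
    show "h i [^]\<^bsub>poly_ring (\<H> A b)\<^esub> n i \<in> monic_polys (\<H> A b)" if "i \<in> {1..r}" for i
      using K.monic_polys_pow[OF nK] h[OF that] by blast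
    show "KP.comaximal (h i [^]\<^bsub>poly_ring (\<H> A b)\<^esub> n i) (h j [^]\<^bsub>poly_ring (\<H> A b)\<^esub> n j)"
      if ij: "i \<in> {1..r}" "j \<in> {1..r}" "i \<noteq> j" for i j
    proof (rule KP.comaximal_pow_pow)
      have "h i \<noteq> h j" using inj ij by (auto dest: inj_onD)
      then show "KP.comaximal (h i) (h j)"
        using h ij by (intro K.distinct_irreducibles_comaximal) auto
    qed (use h ij K.monic_polys_carrier in blast)+
  qed
  then show "\<exists>H. (\<forall>i\<in>{1..r}. H i \<in> monic_polys (\<O> A nrm b)) \<and>
      G = (\<Otimes>\<^bsub>poly_ring (\<O> A nrm b)\<^esub>i\<in>{1..r}. H i) \<and>
      (\<forall>i\<in>{1..r}. poly_at A b (H i) = h i [^]\<^bsub>poly_ring (\<H> A b)\<^esub> n i)"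
    by blast
qed

end
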